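(* Let $k,n\ge1$ be integers and let $\xi=(\xi_1\ge\xi_2\ge\cdots\ge\xi_{n+1}>0)$ be a partition of $k$ into exactly $n+1$ parts. Let $V=\mathbb{C}^{n+1}$, $A_k=\mathbb{C}[t_1,\dots,t_k]$, $W(k)=(V^{\otimes k}\otimes A_k)^{S_k}$, and let $W(k)^{\mathfrak n^+}_\xi$, $\mathbf{e}(\xi)$, $\langle\ ,\ \rangle$, $M_{k,\xi}$ and $\sigma_1,\dots,\sigma_{d_\xi}\in S_k$ be as defined in the context. Then the restriction to $W(k)^{\mathfrak n^+}_\xi$ of the map $$\langle\ \cdot\ ,\ \mathbf{e}(\xi)\rangle: V^{\otimes k}\otimes A_k\to A_k$$ gives an isomorphism of $A_k^{S_k}$-modules $W(k)^{\mathfrak n^+}_\xi\to M_{k,\xi}$. Moreover, for all $\sigma\in S_k$, $$M_{k,\xi}\,\sigma=\langle W(k)^{\mathfrak n^+}_\xi,\ \mathbf{e}(\xi)\sigma\rangle,$$ and $$\langle W(k)^{\mathfrak n^+}_\xi,\ (V^{\otimes k})^{\mathfrak n^+}_\xi\rangle\;\cong\;\bigoplus_{s=1}^{d_\xi}M_{k,\xi}\,\sigma_s\;\cong\;A_k^\xi$$ as $S_k$- and $A_k^{S_k}$-modules (the direct sum being an internal direct sum of subspaces of $A_k$).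
   Context: $\mathbb{Z}_+$ is the set of non-negative integers. For a partition $\xi$ of $k$, $\xi$ also denotes the corresponding irreducible complex representation of $S_k$ (with $(k)$ corresponding to the trivial representation), $d_\xi$ is its dimension, and $A_k^\xi$ is the $\xi$-isotypical component of $A_k$. Actions. $S_k$ acts on the right on $V^{\otimes k}$ by permuting factors, $(u_1\otimes\cdots\otimes u_k)\sigma=u_{\sigma(1)}\otimes\cdots\otimes u_{\sigma(k)}$, on the right on $A_k$ by permuting variables (compatibly: $t_s\sigma=t_{\sigma^{-1}(s)}$, extended to algebra automorphisms), and diagonally on $V^{\otimes k}\otimes A_k$. $W(k)=(V^{\otimes k}\otimes A_k)^{S_k}$ denotes the space of $S_k$-invariants; it is a right $A_k^{S_k}$-module by multiplication on the factor $A_k$. The Lie algebra $\mathfrak{sl}_{n+1}$ acts on $V=\mathbb{C}^{n+1}$ (standard basis $e_1,\dots,e_{n+1}$) naturally, on $V^{\otimes k}$ in the usual way, and on $V^{\otimes k}\otimes A_k$ through the first factor; this preserves $W(k)$. Let $\mathfrak n^+\subset\mathfrak{sl}_{n+1}$ be the strictly upper triangular matrices and $h_i=e_{i,i}-e_{i+1,i+1}$, $1\le i\le n$, where $e_{i,j}$ are the matrix units. For such an $\mathfrak{sl}_{n+1}$-module $U$, $$U^{\mathfrak n^+}_\xi=\{u\in U:\ \mathfrak n^+u=0,\ h_iu=(\xi_i-\xi_{i+1})u,\ 1\le i\le n\}.$$ Forms. $(\ ,\ )_k$ is the symmetric bilinear form on $V^{\otimes k}$ with $(e_{i_1}\otimes\cdots\otimes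 e_{i_k},\,e_{j_1}\otimes\cdots\otimes e_{j_k})_k=\delta_{i_1,j_1}\cdots\delta_{i_k,j_k}$, and $\langle\ ,\ \rangle:(V^{\otimes k}\otimes A_k)\times(V^{\otimes k}\otimes A_k)\to A_k$ is the bilinear form with $\langle \mathbf v\otimes f,\mathbf v'\otimes g\rangle=(\mathbf v,\mathbf v')_k\,fg$. An element $\mathbf v\in V^{\otimes k}$ is identified with $\mathbf v\otimes1$. $\langle W(k)^{\mathfrak n^+}_\xi,(V^{\otimes k})^{\mathfrak n^+}_\xi\rangle$ denotes the linear span in $A_k$ of all values $\langle w,v\rangle$ with $w\in W(k)^{\mathfrak n^+}_\xi$, $v\in(V^{\otimes k})^{\mathfrak n^+}_\xi$. Put $k_i=\xi_i-\xi_{i+1}$ for $1\le i\le n$ and $k_{n+1}=\xi_{n+1}$. With $e_1\wedge\cdots\wedge e_i=\sum_{\tau\in S_i}\mathrm{sgn}(\tau)\,e_{\tau(1)}\otimes\cdots\otimes e_{\tau(i)}\in V^{\otimes i}$, set $$\mathbf{e}(\xi)=e_1^{\otimes k_1}\otimes(e_1\wedge e_2)^{\otimes k_2}\otimes\cdots\otimes(e_1\wedge\cdots\wedge e_{n+1})^{\otimes k_{n+1}}\in(V^{\otimes k})^{\mathfrak n^+}_\xi .$$ By Schur-Weyl duality, $(V^{\otimes k})^{\mathfrak n^+}_\xi$ is an irreducible $S_k$-module isomorphic to $\xi$. The elements $\sigma_1=\mathrm{id},\sigma_2,\dots,\sigma_{d_\xi}\in S_k$ are fixed representatives of distinct cosets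 of the stabilizer of $\mathbf{e}(\xi)$ in $S_k$, such that $\{\mathbf{e}(\xi)\sigma_\ell:1\le\ell\le d_\xi\}$ is a basis of $(V^{\otimes k})^{\mathfrak n^+}_\xi$. Definition of $M_{k,\xi}$. Identify $$A_k=A_1^{\otimes k_1}\otimes A_2^{\otimes k_2}\otimes\cdots\otimes A_{n+1}^{\otimes k_{n+1}}$$ by splitting $t_1,\dots,t_k$, in order, into $k_1$ blocks of size $1$, then $k_2$ blocks of size $2$, ..., then $k_{n+1}$ blocks of size $n+1$; the variables of each block of size $\ell$ are renamed $t_1,\dots,t_\ell$ in the corresponding factor $A_\ell$. For $\mathbf{r}=(\mathbf{r}^{(2)},\dots,\mathbf{r}^{(n+1)})\in\mathbb{Z}_+^{\xi_2}\times\cdots\times\mathbb{Z}_+^{\xi_{n+1}}$ with $\mathbf{r}^{(j)}=(r^{(j)}_1,\dots,r^{(j)}_{\xi_j})$, and for $2\le\ell\le n+1$, $1\le s\le k_\ell$, set $$\Phi_\xi^{\ell,s}(\mathbf{r})=\bigl(r^{(2)}_{\xi_2-\xi_\ell+s},\,r^{(3)}_{\xi_3-\xi_\ell+s},\dots,r^{(\ell)}_{s}\bigr)\in\mathbb{Z}_+^{\ell-1}$$ (the columns of the array whose right-justified rows are the $\mathbf r^{(j)}$). For $(r_1,\dots,r_\ell)\in\mathbb{Z}_+^\ell$ set $\mathbf{a}(r_1,\dots,r_\ell)=\sum_{\tau\in S_{\ell+1}}\mathrm{sgn}(\tau)\,t_{\tau(1)}^{r_1}\cdots t_{\tau(\ell)}^{r_\ell}\in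 A_{\ell+1}$. Set $$\mathbf{b}(\mathbf{r})=1^{\otimes k_1}\otimes\mathbf{a}(\Phi_\xi^{2,1}(\mathbf{r}))\otimes\cdots\otimes\mathbf{a}(\Phi_\xi^{2,k_2}(\mathbf{r}))\otimes\cdots\otimes\mathbf{a}(\Phi_\xi^{n+1,1}(\mathbf{r}))\otimes\cdots\otimes\mathbf{a}(\Phi_\xi^{n+1,k_{n+1}}(\mathbf{r}))\in A_k$$ (factors with $k_\ell=0$ are omitted), and $\mathbf{p}(\mathbf{r})=\sum_{\sigma\in S_{\xi_2}\times\cdots\times S_{\xi_{n+1}}}\mathbf{b}(\sigma(\mathbf{r}))$, where $S_{\xi_j}$ permutes the coordinates of $\mathbb{Z}_+^{\xi_j}$. $M_{k,\xi}$ is the $A_k^{S_k}$-submodule of $A_k$ generated by all $\mathbf{p}(\mathbf{r})$. *)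

theory Defs
  imports Complex_Main "HOL-Library.Poly_Mapping" "HOL-Library.FuncSet"
    "HOL-Combinatorics.Permutations"
begin

text \<open>
  Indexing. Variables and tensor positions are numbered from 0, so that t_s is \<open>var (s - 1)\<close> and
  S_k consists of the permutations of \<open>{..<k}\<close>. Everything else is numbered from 1: the basis
  e_1, ..., e_{n+1}, the parts \<open>\<xi> 1, ..., \<xi> (n + 1)\<close> (other values of \<open>\<xi>\<close> are ignored), the blocks
  and the entries of the arrays r.
\<close>


section \<open>Polynomials\<close>

type_synonym cpoly = "(nat \<Rightarrow>\<^sub>0 nat) \<Rightarrow>\<^sub>0 complex"

definition cst :: "complex \<Rightarrow> cpoly" where
  "cst c = Poly_Mapping.single 0 c"

definition var :: "nat \<Rightarrow> cpoly" where
  "var i = Poly_Mapping.single (Poly_Mapping.single i 1) 1"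

definition polys :: "nat \<Rightarrow> cpoly set" where
  "polys k = {p. \<forall>m \<in> Poly_Mapping.keys p. Poly_Mapping.keys m \<subseteq> {..<k}}"

definition pscale :: "complex \<Rightarrow> cpoly \<Rightarrow> cpoly" where
  "pscale c p = cst c * p"

text \<open>The algebra homomorphism with \<open>var i \<mapsto> var (g i)\<close>.\<close>

definition rename_vars :: "(nat \<Rightarrow> nat) \<Rightarrow> cpoly \<Rightarrow> cpoly" where
  "rename_vars g p = (\<Sum>m \<in> Poly_Mapping.keys p. cst (Poly_Mapping.lookup p m) *
     (\<Prod>i \<in> Poly_Mapping.keys m. var (g i) ^ Poly_Mapping.lookup m i))"

text \<open>Right actions of S_k are written with the permutation first; \<open>\<sigma>\<tau>\<close> is \<open>\<sigma> \<circ> \<tau>\<close>.\<close>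

definition poly_act :: "(nat \<Rightarrow> nat) \<Rightarrow> cpoly \<Rightarrow> cpoly" where
  "poly_act \<sigma> = rename_vars (inv \<sigma>)"

definition sym_polys :: "nat \<Rightarrow> cpoly set" where
  "sym_polys k = {p \<in> polys k. \<forall>\<sigma>. \<sigma> permutes {..<k} \<longrightarrow> poly_act \<sigma> p = p}"


section \<open>Tensors\<close>

text \<open>
  \<open>V\<^sup>\<otimes>\<^sup>k \<otimes> A_k\<close> is the free \<open>A_k\<close>-module on the words of length k in the letters 1, ..., n+1,
  the word \<open>[i_1, ..., i_k]\<close> being \<open>e_{i_1} \<otimes> ... \<otimes> e_{i_k}\<close>. The space \<open>V\<^sup>\<otimes>\<^sup>k\<close>, identified
  with \<open>V\<^sup>\<otimes>\<^sup>k \<otimes> 1\<close>, consists of the tensors with constant coefficients.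
\<close>

type_synonym tens = "nat list \<Rightarrow>\<^sub>0 cpoly"

definition words :: "nat \<Rightarrow> nat \<Rightarrow> nat list set" where
  "words k n = {w. length w = k \<and> set w \<subseteq> {1..n+1}}"

definition VA :: "nat \<Rightarrow> nat \<Rightarrow> tens set" where
  "VA k n = {u. Poly_Mapping.keys u \<subseteq> words k n \<and> (\<forall>w. Poly_Mapping.lookup u w \<in> polys k)}"

definition Vpow :: "nat \<Rightarrow> nat \<Rightarrow> tens set" where
  "Vpow k n = {u. Poly_Mapping.keys u \<subseteq> words k n \<and> (\<forall>w. Poly_Mapping.lookup u w \<in> range cst)}"

definition tscale :: "cpoly \<Rightarrow> tens \<Rightarrow> tens" where
  "tscale a u = Poly_Mapping.map ((*) a) u"

definition cscale :: "complex \<Rightarrow> tens \<Rightarrow> tens" where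
  "cscale c u = tscale (cst c) u"

text \<open>The diagonal action; note that \<open>permute_list \<sigma> w ! s = w ! \<sigma> s\<close>.\<close>

definition tens_act :: "(nat \<Rightarrow> nat) \<Rightarrow> tens \<Rightarrow> tens" where
  "tens_act \<sigma> u = (\<Sum>w \<in> Poly_Mapping.keys u.
     Poly_Mapping.single (permute_list \<sigma> w) (poly_act \<sigma> (Poly_Mapping.lookup u w)))"

definition W :: "nat \<Rightarrow> nat \<Rightarrow> tens set" where
  "W k n = {u \<in> VA k n. \<forall>\<sigma>. \<sigma> permutes {..<k} \<longrightarrow> tens_act \<sigma> u = u}"

definition form :: "tens \<Rightarrow> tens \<Rightarrow> cpoly" where
  "form u v = (\<Sum>w \<in> Poly_Mapping.keys u. Poly_Mapping.lookup u w * Poly_Mapping.lookup v w)"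

text \<open>
  A matrix x acts on V by \<open>x e_b = (\<Sum>a. x a b e_a)\<close> and on tensor powers as a derivation. Only
  the entries with indices in \<open>{1..n+1}\<close> matter.
\<close>

definition lie_act :: "nat \<Rightarrow> (nat \<Rightarrow> nat \<Rightarrow> complex) \<Rightarrow> tens \<Rightarrow> tens" where
  "lie_act n x u = (\<Sum>w \<in> Poly_Mapping.keys u. \<Sum>s<length w. \<Sum>a=1..n+1.
     Poly_Mapping.single (w[s := a]) (cst (x a (w ! s)) * Poly_Mapping.lookup u w))"

definition strictly_upper :: "(nat \<Rightarrow> nat \<Rightarrow> complex) \<Rightarrow> bool" where
  "strictly_upper x \<longleftrightarrow> (\<forall>a b. \<not> a < b \<longrightarrow> x a b = 0)"

definition mat_unit :: "nat \<Rightarrow> nat \<Rightarrow> nat \<Rightarrow> nat \<Rightarrow> complex" where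
  "mat_unit i j a b = (if a = i \<and> b = j then 1 else 0)"

definition cartan :: "nat \<Rightarrow> nat \<Rightarrow> nat \<Rightarrow> complex" where
  "cartan i a b = mat_unit i i a b - mat_unit (i + 1) (i + 1) a b"

definition highest_weight :: "nat \<Rightarrow> (nat \<Rightarrow> nat) \<Rightarrow> tens set \<Rightarrow> tens set" where
  "highest_weight n \<xi> U = {u \<in> U. (\<forall>x. strictly_upper x \<longrightarrow> lie_act n x u = 0) \<and>
     (\<forall>i\<in>{1..n}. lie_act n (cartan i) u = cscale (of_nat (\<xi> i) - of_nat (\<xi> (i + 1))) u)}"


section \<open>The vector \<open>e(\<xi>)\<close>\<close>

definition mult :: "nat \<Rightarrow> (nat \<Rightarrow> nat) \<Rightarrow> nat \<Rightarrow> nat" where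
  "mult n \<xi> l = (if l \<le> n then \<xi> l - \<xi> (l + 1) else \<xi> l)"

definition wedge :: "nat \<Rightarrow> tens" where
  "wedge l = (\<Sum>\<tau> | \<tau> permutes {1..l}. Poly_Mapping.single (map \<tau> [1..<l+1]) (of_int (sign \<tau>)))"

definition tensor :: "tens \<Rightarrow> tens \<Rightarrow> tens" where
  "tensor u v = (\<Sum>w \<in> Poly_Mapping.keys u. \<Sum>w' \<in> Poly_Mapping.keys v.
     Poly_Mapping.single (w @ w') (Poly_Mapping.lookup u w * Poly_Mapping.lookup v w'))"

definition evec :: "nat \<Rightarrow> (nat \<Rightarrow> nat) \<Rightarrow> tens" where
  "evec n \<xi> = foldr tensor (concat (map (\<lambda>l. replicate (mult n \<xi> l) (wedge l)) [1..<n+2]))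
     (Poly_Mapping.single [] 1)"

definition stabilizer :: "nat \<Rightarrow> tens \<Rightarrow> (nat \<Rightarrow> nat) set" where
  "stabilizer k u = {\<tau>. \<tau> permutes {..<k} \<and> tens_act \<tau> u = u}"


section \<open>Modules over subrings and \<open>S_k\<close>-modules\<close>

definition submod :: "'r set \<Rightarrow> ('r \<Rightarrow> 'm \<Rightarrow> 'm) \<Rightarrow> 'm::comm_monoid_add set \<Rightarrow> bool" where
  "submod R sc U \<longleftrightarrow> 0 \<in> U \<and> (\<forall>u\<in>U. \<forall>v\<in>U. u + v \<in> U) \<and> (\<forall>a\<in>R. \<forall>u\<in>U. sc a u \<in> U)"

definition module_iso :: "'r set \<Rightarrow> ('r \<Rightarrow> 'm \<Rightarrow> 'm) \<Rightarrow> ('r \<Rightarrow> 'l \<Rightarrow> 'l) \<Rightarrow>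
    'm::comm_monoid_add set \<Rightarrow> 'l::comm_monoid_add set \<Rightarrow> ('m \<Rightarrow> 'l) \<Rightarrow> bool" where
  "module_iso R sc sc' U U' \<phi> \<longleftrightarrow> submod R sc U \<and> submod R sc' U' \<and> bij_betw \<phi> U U' \<and>
     (\<forall>u\<in>U. \<forall>v\<in>U. \<phi> (u + v) = \<phi> u + \<phi> v) \<and> (\<forall>a\<in>R. \<forall>u\<in>U. \<phi> (sc a u) = sc' a (\<phi> u))"

definition perm_stable :: "nat \<Rightarrow> cpoly set \<Rightarrow> bool" where
  "perm_stable k U \<longleftrightarrow> (\<forall>\<sigma>. \<sigma> permutes {..<k} \<longrightarrow> poly_act \<sigma> ` U \<subseteq> U)"

text \<open>
  \<open>isomorphic R k U U'\<close>: one map is an isomorphism both of \<open>S_k\<close>-modules and of \<open>R\<close>-modules. For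
  \<open>R = range cst\<close> this is isomorphism of complex representations of \<open>S_k\<close>.
\<close>

definition isomorphic :: "cpoly set \<Rightarrow> nat \<Rightarrow> cpoly set \<Rightarrow> cpoly set \<Rightarrow> bool" where
  "isomorphic R k U U' \<longleftrightarrow> perm_stable k U \<and> perm_stable k U' \<and>
     (\<exists>\<phi>. module_iso R (*) (*) U U' \<phi> \<and>
       (\<forall>\<sigma>. \<sigma> permutes {..<k} \<longrightarrow> (\<forall>u\<in>U. \<phi> (poly_act \<sigma> u) = poly_act \<sigma> (\<phi> u))))"

definition sum_space :: "'i set \<Rightarrow> ('i \<Rightarrow> cpoly set) \<Rightarrow> cpoly set" where
  "sum_space I U = {\<Sum>i\<in>I. u i | u. \<forall>i\<in>I. u i \<in> U i}"

definition sum_is_direct :: "'i set \<Rightarrow> ('i \<Rightarrow> cpoly set) \<Rightarrow> bool" where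
  "sum_is_direct I U \<longleftrightarrow>
     (\<forall>u. (\<forall>i\<in>I. u i \<in> U i) \<and> (\<Sum>i\<in>I. u i) = 0 \<longrightarrow> (\<forall>i\<in>I. u i = 0))"


section \<open>The irreducible representation \<open>\<xi>\<close> and isotypical components\<close>

text \<open>
  The irreducible representation of \<open>S_k\<close> indexed by \<open>\<xi>\<close> is realised as the Specht module, spanned
  by the Specht polynomials: for a tableau \<open>T\<close>, a bijective filling of the Young diagram (rows of
  lengths \<open>\<xi> 1, \<xi> 2, ...\<close>), the product over the columns of the Vandermonde products in the
  variables indexed by the entries. The partition \<open>(k)\<close> gives the trivial representation.
\<close>

definition young_diagram :: "nat \<Rightarrow> (nat \<Rightarrow> nat) \<Rightarrow> (nat \<times> nat) set" where
  "young_diagram n \<xi> = {(i, j). i \<in> {1..n+1} \<and> j \<in> {1..\<xi> i}}"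

definition specht_poly :: "nat \<Rightarrow> (nat \<Rightarrow> nat) \<Rightarrow> (nat \<times> nat \<Rightarrow> nat) \<Rightarrow> cpoly" where
  "specht_poly n \<xi> T = (\<Prod>j\<in>{1..\<xi> 1}.
     \<Prod>(a, b) \<in> {(a, b). a < b \<and> (a, j) \<in> young_diagram n \<xi> \<and> (b, j) \<in> young_diagram n \<xi>}.
       var (T (a, j)) - var (T (b, j)))"

definition specht_module :: "nat \<Rightarrow> nat \<Rightarrow> (nat \<Rightarrow> nat) \<Rightarrow> cpoly set" where
  "specht_module k n \<xi> =
     module.span pscale {specht_poly n \<xi> T | T. bij_betw T (young_diagram n \<xi>) {..<k}}"

definition specht_dim :: "nat \<Rightarrow> nat \<Rightarrow> (nat \<Rightarrow> nat) \<Rightarrow> nat" where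
  "specht_dim k n \<xi> = vector_space.dim pscale (specht_module k n \<xi>)"

definition isotypical :: "nat \<Rightarrow> nat \<Rightarrow> (nat \<Rightarrow> nat) \<Rightarrow> cpoly set" where
  "isotypical k n \<xi> = module.span pscale
     (\<Union>{U. U \<subseteq> polys k \<and> isomorphic (range cst) k (specht_module k n \<xi>) U})"


section \<open>The module \<open>M\<^bsub>k,\<xi>\<^esub>\<close>\<close>

text \<open>An array \<open>r\<close> has entries \<open>r j i\<close> for \<open>j \<in> {2..n+1}\<close>, \<open>i \<in> {1..\<xi> j}\<close>; other values are ignored.\<close>

definition Phi :: "(nat \<Rightarrow> nat) \<Rightarrow> nat \<Rightarrow> nat \<Rightarrow> (nat \<Rightarrow> nat \<Rightarrow> nat) \<Rightarrow> nat list" where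
  "Phi \<xi> l s r = map (\<lambda>j. r j (\<xi> j - \<xi> l + s)) [2..<l+1]"

definition apoly :: "nat list \<Rightarrow> cpoly" where
  "apoly rs = (\<Sum>\<tau> | \<tau> permutes {..<length rs + 1}.
     of_int (sign \<tau>) * (\<Prod>i<length rs. var (\<tau> i) ^ (rs ! i)))"

text \<open>
  In a list of blocks, \<open>(l, p)\<close> stands for a tensor factor \<open>p \<in> A_l\<close>; the product of the list is
  taken in the polynomial ring in all the variables, those of later blocks being shifted.
\<close>

definition block_tensor :: "(nat \<times> cpoly) list \<Rightarrow> cpoly" where
  "block_tensor bs = foldr (\<lambda>(l, p) q. p * rename_vars (\<lambda>i. l + i) q) bs 1"

definition bpoly :: "nat \<Rightarrow> (nat \<Rightarrow> nat) \<Rightarrow> (nat \<Rightarrow> nat \<Rightarrow> nat) \<Rightarrow> cpoly" where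
  "bpoly n \<xi> r = block_tensor (replicate (mult n \<xi> 1) (1, 1) @
     concat (map (\<lambda>l. map (\<lambda>s. (l, apoly (Phi \<xi> l s r))) [1..<mult n \<xi> l + 1]) [2..<n+2]))"

definition ppoly :: "nat \<Rightarrow> (nat \<Rightarrow> nat) \<Rightarrow> (nat \<Rightarrow> nat \<Rightarrow> nat) \<Rightarrow> cpoly" where
  "ppoly n \<xi> r = (\<Sum>\<sigma> \<in> (\<Pi>\<^sub>E j\<in>{2..n+1}. {\<tau>. \<tau> permutes {1..\<xi> j}}).
     bpoly n \<xi> (\<lambda>j i. r j (\<sigma> j i)))"

definition M :: "nat \<Rightarrow> nat \<Rightarrow> (nat \<Rightarrow> nat) \<Rightarrow> cpoly set" where
  "M k n \<xi> = submod (sym_polys k) (*) hull (range (ppoly n \<xi>))"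


section \<open>Basic facts\<close>

lemma cst_add: "cst (a + b) = cst a + cst b"
  by (simp add: cst_def single_add)

lemma cst_mult: "cst (a * b) = cst a * cst b"
  by (simp add: cst_def mult_single)

lemma cst_1: "cst 1 = 1"
  by (simp add: cst_def)

text \<open>
  \<open>module.span\<close>, \<open>module.dependent\<close> and \<open>vector_space.dim\<close> have their intended meaning for
  \<open>pscale\<close> and \<open>cscale\<close>.
\<close>

lemma vector_space_pscale: "vector_space pscale"
  by unfold_locales (simp_all add: pscale_def cst_add cst_mult cst_1 algebra_simps)

lemma lookup_tscale: "Poly_Mapping.lookup (tscale a u) w = a * Poly_Mapping.lookup u w"
  by (simp add: tscale_def map.rep_eq when_def)

lemma vector_space_cscale: "vector_space cscale"
  by unfold_locales
    (auto intro!: poly_mapping_eqI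
      simp: cscale_def lookup_tscale lookup_add cst_add cst_mult cst_1 algebra_simps)

lemma rename_vars_var: "rename_vars g (var i) = var (g i)"
  by (simp add: rename_vars_def var_def cst_def flip: single_one)

lemma poly_act_var: "poly_act \<sigma> (var i) = var (inv \<sigma> i)"
  by (simp add: poly_act_def rename_vars_var)

lemma tens_act_single:
  "tens_act \<sigma> (Poly_Mapping.single w p) = Poly_Mapping.single (permute_list \<sigma> w) (poly_act \<sigma> p)"
  by (simp add: tens_act_def poly_act_def rename_vars_def)

lemma form_single:
  "form (Poly_Mapping.single v p) (Poly_Mapping.single w q) = (if v = w then p * q else 0)"
  by (auto simp: form_def lookup_single when_def)

end

theory Submission
  imports Defs "HOL-Computational_Algebra.Polynomial"
begin

text \<open>
  Write \<open>e\<close> for \<open>e(\<xi>)\<close> and \<open>H\<close> for the highest weight space of weight \<open>\<xi>\<close> in \<open>V\<^sup>\<otimes>\<^sup>k\<close>, and let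
  \<open>C\<close> be the group of the permutations that preserve each block of \<open>e\<close>, the blocks being the columns
  of the Young diagram. Then \<open>e\<close> is the alternating sum over \<open>C\<close> of the translates of the word
  \<open>w0\<close> that has the letters 1, ..., l in a block of length l. Everything rests on one rank one formula:
  on \<open>H\<close> the alternating sum over \<open>C\<close> is the operator \<open>h \<mapsto> (h, e) e\<close>. Indeed a word of weight
  \<open>\<xi>\<close> either repeats a letter in a block, and is killed, or is a rearrangement of \<open>w0\<close> by
  \<open>C\<close> (\<open>column_alt_word\<close>, \<open>column_alt_H\<close>).

  The formula replaces Schur's lemma and complete reducibility. The operator
  \<open>u \<mapsto> \<Sum>\<sigma>. (u, e\<sigma>) e\<sigma>\<close>, called \<open>frame\<close>, commutes with \<open>S_k\<close> and so with the alternating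
  sum over \<open>C\<close>; hence \<open>e\<close> is an eigenvector, with positive eigenvalue since \<open>e\<close> has integral
  coordinates. As \<open>H\<close> is spanned by translates of \<open>e\<close>, the operator is scalar on \<open>H\<close>, and,
  comparing coefficients of monomials, on highest weight vectors with polynomial coefficients
  (\<open>frame_eigen\<close>). So an invariant highest weight vector w is determined by \<open>\<langle>w, e\<rangle>\<close>, and
  every equivariant linear map from \<open>H\<close> to polynomials has the form \<open>\<langle>w, _\<rangle>\<close> with w obtained by
  averaging (\<open>equivariant_map_represented\<close>).

  For the image of \<open>w \<mapsto> \<langle>w, e\<rangle>\<close>, note that \<open>\<langle>w, e\<rangle>\<close> is the alternating sum over \<open>C\<close> of
  the coefficient g of w at \<open>w0\<close>, and that g is invariant under the permutations preserving the rows.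
  Power sums in the variables of the first row are symmetric power sums minus power sums in the
  other variables; therefore g is a combination, with symmetric coefficients, of polynomials in the
  variables of the lower rows (\<open>symmetric_mixed\<close>), which may be averaged over the permutations of these
  rows. The alternating sums of the averaged monomials are the generators \<open>p(r)\<close> up to sign
  (\<open>ppoly_eq\<close>), and \<open>M\<close> results (\<open>M_eq_image\<close>).

  If \<open>\<Sum>s. \<langle>w_s, e\<sigma>_s\<rangle> = 0\<close>, then translating and applying the alternating sum over \<open>C\<close> turns this
  relation into \<open>\<Sum>s. (e\<sigma>_s, e\<rho>) \<langle>w_s, e\<rangle> = 0\<close> for all \<open>\<rho>\<close> (\<open>isolate\<close>), so all summands vanish
  because the \<open>e\<sigma>_s\<close> form a basis. Finally, by Vandermonde's formula a Specht polynomial is up to sign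
  \<open>b(r)\<close> for the exponents \<open>0, 1, 2, ...\<close> in each column, so it lies in \<open>M\<close>, and the Specht module
  is \<open>\<langle>w, H\<rangle>\<close> for some w. The submodules isomorphic to it are then exactly the nonzero spaces
  \<open>\<langle>w, H\<rangle>\<close>, whose sum is the isotypical component.
\<close>

section \<open>Additive maps given on basis elements\<close>

abbreviation "lookup \<equiv> Poly_Mapping.lookup"
abbreviation "keys \<equiv> Poly_Mapping.keys"
abbreviation "single \<equiv> Poly_Mapping.single"

text \<open>
  Renaming of variables, the actions of permutations and matrices, the form and the tensor product
  are all sums of this shape over the support, and inherit additivity from it.
\<close>

definition extend :: "('a \<Rightarrow> 'b \<Rightarrow> 'c) \<Rightarrow> ('a \<Rightarrow>\<^sub>0 'b::ab_group_add) \<Rightarrow> 'c::ab_group_add" where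
  "extend F u = (\<Sum>w\<in>keys u. F w (lookup u w))"

lemma additive_zero: "(\<And>a b. f (a + b) = f a + f b) \<Longrightarrow> f (0::'a::ab_group_add) = (0::'b::ab_group_add)"
  by (metis add_cancel_right_left add_0)

lemma additive_sum:
  fixes f :: "'a::ab_group_add \<Rightarrow> 'b::ab_group_add"
  assumes "\<And>a b. f (a + b) = f a + f b"
  shows "f (\<Sum>i\<in>I. g i) = (\<Sum>i\<in>I. f (g i))"
  by (induction I rule: infinite_finite_induct) (auto simp: assms additive_zero[of f, OF assms])

lemma extend_add:
  assumes "\<And>w a b. F w (a + b) = F w a + F w b"
  shows "extend F (u + v) = extend F u + extend F v"
  unfolding extend_def
  by (rule setsum_keys_plus_distrib) (auto simp: assms additive_zero[of "F w" for w])

lemma extend_single: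
  assumes "\<And>w a b. F w (a + b) = F w a + F w b"
  shows "extend F (single w p) = F w p"
  by (auto simp: extend_def additive_zero[of "F w" for w, OF assms])

lemma sum_singles: "(\<Sum>w\<in>keys u. single w (lookup u w)) = u"
  by (rule poly_mapping_eqI) (auto simp: lookup_sum lookup_single when_def in_keys_iff)

lemma poly_mapping_single_induct:
  fixes u :: "'a \<Rightarrow>\<^sub>0 'b::ab_group_add"
  assumes "P 0" "\<And>u v. P u \<Longrightarrow> P v \<Longrightarrow> P (u + v)" "\<And>w. w \<in> keys u \<Longrightarrow> P (single w (lookup u w))"
  shows "P u"
proof -
  have "P (\<Sum>w\<in>A. single w (lookup u w))" if "finite A" "A \<subseteq> keys u" for A
    using that by induction (auto intro: assms)
  from this[of "keys u"] show ?thesis by (simp add: sum_singles)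
qed

text \<open>
  With additivity in place, an identity between such maps is checked on single terms. Only the terms
  of the element at hand matter, so its support may be restricted.
\<close>

lemma additive_eqI:
  fixes u :: "'a \<Rightarrow>\<^sub>0 'b::ab_group_add" and f g :: "_ \<Rightarrow> 'c::ab_group_add"
  assumes "\<And>u v. f (u + v) = f u + f v" "\<And>u v. g (u + v) = g u + g v"
    "\<And>w. w \<in> keys u \<Longrightarrow> f (single w (lookup u w)) = g (single w (lookup u w))"
  shows "f u = g u"
  by (rule poly_mapping_single_induct[where P = "\<lambda>u. f u = g u"])
    (use assms in \<open>auto simp: additive_zero[of f] additive_zero[of g]\<close>)

section \<open>Renaming of variables\<close>

definition monomial_in :: "(nat \<Rightarrow> nat) \<Rightarrow> (nat \<Rightarrow>\<^sub>0 nat) \<Rightarrow> cpoly" where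
  "monomial_in g m = (\<Prod>i\<in>keys m. var (g i) ^ lookup m i)"

lemma monomial_in_superset:
  assumes "finite A" "keys m \<subseteq> A"
  shows "monomial_in g m = (\<Prod>i\<in>A. var (g i) ^ lookup m i)"
  unfolding monomial_in_def
  by (rule prod.mono_neutral_left) (use assms in \<open>auto simp: in_keys_iff\<close>)

lemma monomial_in_add: "monomial_in g (m + m') = monomial_in g m * monomial_in g m'"
proof -
  let ?A = "keys m \<union> keys m'"
  have "keys (m + m') \<subseteq> ?A" by (rule keys_add)
  then have "monomial_in g (m + m') = (\<Prod>i\<in>?A. var (g i) ^ lookup (m + m') i)"
    by (intro monomial_in_superset) auto
  also have "\<dots> = monomial_in g m * monomial_in g m'"
    by (simp add: lookup_add power_add prod.distrib monomial_in_superset[of ?A])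
  finally show ?thesis .
qed

lemma rename_vars_extend: "rename_vars g = extend (\<lambda>m c. cst c * monomial_in g m)"
  by (rule ext) (simp add: rename_vars_def extend_def monomial_in_def)

lemma rename_vars_add: "rename_vars g (p + q) = rename_vars g p + rename_vars g q"
  unfolding rename_vars_extend by (rule extend_add) (simp add: cst_add algebra_simps)

lemma rename_vars_single: "rename_vars g (single m c) = cst c * monomial_in g m"
  unfolding rename_vars_extend by (rule extend_single) (simp add: cst_add algebra_simps)

lemma rename_vars_mult: "rename_vars g (p * q) = rename_vars g p * rename_vars g q"
proof (rule additive_eqI[of "\<lambda>p. rename_vars g (p * q)" "\<lambda>p. rename_vars g p * rename_vars g q"])
  fix m assume "m \<in> keys p"
  show "rename_vars g (single m (lookup p m) * q) = rename_vars g (single m (lookup p m)) * rename_vars g q"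
    by (rule additive_eqI[of "\<lambda>q. rename_vars g (single m (lookup p m) * q)"])
      (simp_all add: rename_vars_add distrib_left mult_single rename_vars_single cst_mult
        monomial_in_add mult.assoc mult.left_commute[of "monomial_in g m"])
qed (simp_all add: rename_vars_add distrib_right)

lemma rename_vars_cst [simp]: "rename_vars g (cst c) = cst c"
  by (simp add: cst_def rename_vars_single monomial_in_def)

lemma cst_0 [simp]: "cst 0 = 0" by (simp add: cst_def)
lemma cst_uminus: "cst (- c) = - cst c" by (simp add: cst_def single_uminus)
lemma cst_of_int: "cst (of_int c) = of_int c" by (simp add: cst_def)
lemma cst_of_nat: "cst (of_nat c) = of_nat c" by (simp add: cst_def)
lemma cst_sum: "cst (\<Sum>i\<in>I. f i) = (\<Sum>i\<in>I. cst (f i))"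
  by (rule additive_sum) (rule cst_add)
lemma cst_eq_iff [simp]: "cst a = cst b \<longleftrightarrow> a = b" 
  by (metis cst_def lookup_single_eq)
lemma cst_eq_0_iff [simp]: "cst a = 0 \<longleftrightarrow> a = 0"
  using cst_eq_iff[of a 0] by (simp del: cst_eq_iff)

lemma rename_vars_0 [simp]: "rename_vars g 0 = 0" by (simp add: rename_vars_def)
lemma rename_vars_1 [simp]: "rename_vars g 1 = 1" using rename_vars_cst[of g 1] by (simp add: cst_1)
lemma rename_vars_of_int [simp]: "rename_vars g (of_int c) = of_int c"
  using rename_vars_cst[of g "of_int c"] by (simp add: cst_of_int)
lemma rename_vars_uminus: "rename_vars g (- p) = - rename_vars g p"
  by (metis add.inverse_unique add.right_inverse rename_vars_0 rename_vars_add)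
lemma rename_vars_diff: "rename_vars g (p - q) = rename_vars g p - rename_vars g q"
  by (metis add_uminus_conv_diff rename_vars_add rename_vars_uminus)
lemma rename_vars_sum: "rename_vars g (\<Sum>i\<in>I. f i) = (\<Sum>i\<in>I. rename_vars g (f i))"
  by (rule additive_sum) (rule rename_vars_add)
lemma rename_vars_prod: "rename_vars g (\<Prod>i\<in>I. f i) = (\<Prod>i\<in>I. rename_vars g (f i))"
  by (induction I rule: infinite_finite_induct) (auto simp: rename_vars_mult)
lemma rename_vars_power: "rename_vars g (p ^ a) = rename_vars g p ^ a"
  by (induction a) (auto simp: rename_vars_mult)

lemma sum_nat_singles: "(\<Sum>i\<in>keys m. single i (lookup m i)) = (m :: nat \<Rightarrow>\<^sub>0 nat)"
  by (rule poly_mapping_eqI) (auto simp: lookup_sum lookup_single when_def in_keys_iff)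

lemma var_power: "var i ^ a = single (single i a) 1"
  by (induction a) (auto simp: var_def mult_single simp flip: single_add single_one)

lemma monomial_in_id: "monomial_in (\<lambda>i. i) m = single m 1"
proof -
  have "(\<Prod>i\<in>A. var i ^ lookup m i) = single (\<Sum>i\<in>A. single i (lookup m i)) 1" for A
    by (induction A rule: infinite_finite_induct)
      (auto simp: var_power mult_single simp flip: single_one)
  from this[of "keys m"] show ?thesis
    by (simp add: monomial_in_def sum_nat_singles)
qed

lemma rename_vars_id [simp]: "rename_vars (\<lambda>i. i) p = p"
  by (simp add: rename_vars_extend monomial_in_id extend_def cst_def mult_single sum_singles)

lemma poly_expand: "p = (\<Sum>m\<in>keys p. cst (lookup p m) * (\<Prod>i\<in>keys m. var i ^ lookup m i))"
  using rename_vars_id[of p] unfolding rename_vars_def by (rule sym)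

lemma rename_vars_comp: "rename_vars g (rename_vars h p) = rename_vars (\<lambda>i. g (h i)) p"
proof (rule additive_eqI[of "\<lambda>p. rename_vars g (rename_vars h p)"])
  show "rename_vars g (rename_vars h (single m (lookup p m))) = rename_vars (\<lambda>i. g (h i)) (single m (lookup p m))" for m
    by (simp add: rename_vars_single rename_vars_mult monomial_in_def rename_vars_prod
        rename_vars_power rename_vars_var)
qed (simp_all add: rename_vars_add)

lemma poly_act_add: "poly_act \<sigma> (p + q) = poly_act \<sigma> p + poly_act \<sigma> q"
  by (simp add: poly_act_def rename_vars_add)
lemma poly_act_mult: "poly_act \<sigma> (p * q) = poly_act \<sigma> p * poly_act \<sigma> q"
  by (simp add: poly_act_def rename_vars_mult)
lemma poly_act_sum: "poly_act \<sigma> (\<Sum>i\<in>I. f i) = (\<Sum>i\<in>I. poly_act \<sigma> (f i))"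
  by (simp add: poly_act_def rename_vars_sum)
lemma poly_act_prod: "poly_act \<sigma> (\<Prod>i\<in>I. f i) = (\<Prod>i\<in>I. poly_act \<sigma> (f i))"
  by (simp add: poly_act_def rename_vars_prod)
lemma poly_act_power: "poly_act \<sigma> (p ^ a) = poly_act \<sigma> p ^ a"
  by (simp add: poly_act_def rename_vars_power)
lemma poly_act_cst [simp]: "poly_act \<sigma> (cst c) = cst c" by (simp add: poly_act_def)
lemma poly_act_of_int [simp]: "poly_act \<sigma> (of_int c) = of_int c" by (simp add: poly_act_def)
lemma poly_act_0 [simp]: "poly_act \<sigma> 0 = 0" by (simp add: poly_act_def)
lemma poly_act_1 [simp]: "poly_act \<sigma> 1 = 1" by (simp add: poly_act_def)
lemma poly_act_id [simp]: "poly_act id p = p" by (simp add: poly_act_def id_def inv_id[unfolded id_def])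

lemma poly_act_comp:
  assumes "\<sigma> permutes S" "\<tau> permutes S"
  shows "poly_act \<sigma> (poly_act \<tau> p) = poly_act (\<tau> \<circ> \<sigma>) p"
proof -
  have "inv (\<tau> \<circ> \<sigma>) = inv \<sigma> \<circ> inv \<tau>"
    using assms by (metis o_inv_distrib permutes_bij)
  then show ?thesis by (simp add: poly_act_def rename_vars_comp comp_def)
qed

section \<open>Polynomials in given variables\<close>

definition polys_on :: "nat set \<Rightarrow> cpoly set" where
  "polys_on X = {p. \<forall>m\<in>keys p. keys m \<subseteq> X}"

lemma polys_eq: "polys k = polys_on {..<k}"
  by (simp add: polys_def polys_on_def)

lemma polys_on_add: "p \<in> polys_on X \<Longrightarrow> q \<in> polys_on X \<Longrightarrow> p + q \<in> polys_on X"
  using keys_add[of p q] by (fastforce simp: polys_on_def)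

lemma polys_on_mult: "p \<in> polys_on X \<Longrightarrow> q \<in> polys_on X \<Longrightarrow> p * q \<in> polys_on X"
  using keys_mult[of p q] keys_add unfolding polys_on_def by (fastforce dest!: subsetD)

lemma polys_on_cst [simp]: "cst c \<in> polys_on X"
  by (simp add: polys_on_def cst_def)
lemma polys_on_0 [simp]: "0 \<in> polys_on X" by (simp add: polys_on_def)
lemma polys_on_1 [simp]: "1 \<in> polys_on X" using polys_on_cst[of 1] by (simp only: cst_1)
lemma polys_on_of_int [simp]: "of_int c \<in> polys_on X" using polys_on_cst[of "of_int c"] by (simp add: cst_of_int)
lemma polys_on_var: "i \<in> X \<Longrightarrow> var i \<in> polys_on X"
  by (simp add: polys_on_def var_def)
lemma polys_on_uminus: "p \<in> polys_on X \<Longrightarrow> - p \<in> polys_on X"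
  using polys_on_mult[OF polys_on_cst, of p X "-1"] by (simp add: cst_uminus cst_1)
lemma polys_on_diff: "p \<in> polys_on X \<Longrightarrow> q \<in> polys_on X \<Longrightarrow> p - q \<in> polys_on X"
  using polys_on_add[of p X "-q"] polys_on_uminus by simp
lemma polys_on_sum: "(\<And>i. i \<in> I \<Longrightarrow> f i \<in> polys_on X) \<Longrightarrow> (\<Sum>i\<in>I. f i) \<in> polys_on X"
  by (induction I rule: infinite_finite_induct) (auto intro: polys_on_add)
lemma polys_on_prod: "(\<And>i. i \<in> I \<Longrightarrow> f i \<in> polys_on X) \<Longrightarrow> (\<Prod>i\<in>I. f i) \<in> polys_on X"
  by (induction I rule: infinite_finite_induct) (auto intro: polys_on_mult)
lemma polys_on_power: "p \<in> polys_on X \<Longrightarrow> p ^ a \<in> polys_on X"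
  by (induction a) (auto intro: polys_on_mult)

lemmas polys_on_intros = polys_on_add polys_on_mult polys_on_sum polys_on_prod polys_on_power
  polys_on_var polys_on_diff polys_on_cst polys_on_of_int

lemma polys_on_rename:
  assumes "p \<in> polys_on X" "\<And>i. i \<in> X \<Longrightarrow> g i \<in> Y"
  shows "rename_vars g p \<in> polys_on Y"
  unfolding rename_vars_def
  by (intro polys_on_intros assms(2)) (use assms(1) in \<open>auto simp: polys_on_def\<close>)

lemma polys_on_expand:
  assumes "p \<in> polys_on X" "finite X"
  shows "p = (\<Sum>m\<in>keys p. cst (lookup p m) * (\<Prod>i\<in>X. var i ^ lookup m i))"
proof -
  have "p = (\<Sum>m\<in>keys p. cst (lookup p m) * monomial_in (\<lambda>i. i) m)"
    using poly_expand[of p] by (simp add: monomial_in_def)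
  also have "\<dots> = (\<Sum>m\<in>keys p. cst (lookup p m) * (\<Prod>i\<in>X. var i ^ lookup m i))"
    by (rule sum.cong) (use assms in \<open>auto simp: polys_on_def monomial_in_superset[of X]\<close>)
  finally show ?thesis .
qed

lemma poly_act_polys: "\<sigma> permutes {..<k} \<Longrightarrow> p \<in> polys k \<Longrightarrow> poly_act \<sigma> p \<in> polys k"
  unfolding poly_act_def polys_eq by (erule polys_on_rename) (metis permutes_in_image permutes_inv)

lemma sym_polys_mult: "a \<in> sym_polys k \<Longrightarrow> b \<in> sym_polys k \<Longrightarrow> a * b \<in> sym_polys k"
  by (auto simp: sym_polys_def polys_eq polys_on_mult poly_act_mult)
lemma sym_polys_cst [simp]: "cst c \<in> sym_polys k"
  by (auto simp: sym_polys_def polys_eq)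

section \<open>Tensors with polynomial coefficients\<close>

lemma sum_lookup_superset:
  assumes "finite A" "keys u \<subseteq> A" "\<And>w. F w 0 = 0"
  shows "(\<Sum>w\<in>keys u. F w (lookup u w)) = (\<Sum>w\<in>A. F w (lookup u w))"
  by (rule sum.mono_neutral_left) (use assms in \<open>auto simp: in_keys_iff\<close>)

lemma tscale_add: "tscale a (u + v) = tscale a u + tscale a v"
  by (rule poly_mapping_eqI) (simp add: lookup_tscale lookup_add algebra_simps)
lemma tscale_sum: "tscale a (\<Sum>i\<in>I. u i) = (\<Sum>i\<in>I. tscale a (u i))"
  by (rule additive_sum) (rule tscale_add)
lemma tscale_add_left: "tscale (a + b) u = tscale a u + tscale b u"
  by (rule poly_mapping_eqI) (simp add: lookup_tscale lookup_add algebra_simps)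
lemma tscale_sum_left: "tscale (\<Sum>i\<in>I. a i) u = (\<Sum>i\<in>I. tscale (a i) u)"
  by (rule additive_sum[of "\<lambda>a. tscale a u"]) (rule tscale_add_left)
lemma tscale_tscale [simp]: "tscale a (tscale b u) = tscale (a * b) u"
  by (rule poly_mapping_eqI) (simp add: lookup_tscale algebra_simps)
lemma tscale_single [simp]: "tscale a (single w p) = single w (a * p)"
  by (rule poly_mapping_eqI) (simp add: lookup_tscale lookup_single when_def)
lemma tscale_1 [simp]: "tscale 1 u = u"
  by (rule poly_mapping_eqI) (simp add: lookup_tscale)
lemma tscale_0 [simp]: "tscale 0 u = 0" "tscale a 0 = 0"
  by (rule poly_mapping_eqI, simp add: lookup_tscale)+
lemma tscale_uminus: "tscale (- a) u = - tscale a u"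
  by (rule poly_mapping_eqI) (simp add: lookup_tscale)
lemma keys_tscale: "keys (tscale a u) \<subseteq> keys u"
  by (auto simp: in_keys_iff lookup_tscale)

lemma tens_act_extend:
  "tens_act \<sigma> = extend (\<lambda>w p. single (permute_list \<sigma> w) (poly_act \<sigma> p))"
  by (rule ext) (simp add: tens_act_def extend_def)
lemma tens_act_add: "tens_act \<sigma> (u + v) = tens_act \<sigma> u + tens_act \<sigma> v"
  unfolding tens_act_extend by (rule extend_add) (simp add: poly_act_add single_add)
lemma tens_act_sum: "tens_act \<sigma> (\<Sum>i\<in>I. u i) = (\<Sum>i\<in>I. tens_act \<sigma> (u i))"
  by (rule additive_sum) (rule tens_act_add)
lemma tens_act_tscale: "tens_act \<sigma> (tscale a u) = tscale (poly_act \<sigma> a) (tens_act \<sigma> u)"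
  by (rule additive_eqI[of "\<lambda>u. tens_act \<sigma> (tscale a u)"])
    (simp_all add: tens_act_add tscale_add tens_act_single poly_act_mult)
lemma tens_act_id [simp]: "tens_act id u = u"
  by (simp add: tens_act_def sum_singles)
lemma keys_tens_act: "keys (tens_act \<sigma> u) \<subseteq> permute_list \<sigma> ` keys u"
  unfolding tens_act_def by (rule order.trans[OF keys_sum]) (auto split: if_splits)

text \<open>The length of the words is all that the group laws of \<open>tens_act\<close> need.\<close>

definition tensors :: "nat \<Rightarrow> tens set" where
  "tensors k = {u. \<forall>w\<in>keys u. length w = k}"

lemma tensors_add: "u \<in> tensors k \<Longrightarrow> v \<in> tensors k \<Longrightarrow> u + v \<in> tensors k"
  using keys_add[of u v] by (auto simp: tensors_def)
lemma tensors_0 [simp]: "0 \<in> tensors k" by (simp add: tensors_def)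
lemma tensors_sum: "(\<And>i. i \<in> I \<Longrightarrow> u i \<in> tensors k) \<Longrightarrow> (\<Sum>i\<in>I. u i) \<in> tensors k"
  by (induction I rule: infinite_finite_induct) (auto intro: tensors_add)
lemma tensors_tscale: "u \<in> tensors k \<Longrightarrow> tscale a u \<in> tensors k"
  using keys_tscale[of a u] by (auto simp: tensors_def)
lemma tensors_single: "length w = k \<Longrightarrow> single w p \<in> tensors k"
  by (simp add: tensors_def)
lemma tensors_act: "u \<in> tensors k \<Longrightarrow> tens_act \<sigma> u \<in> tensors k"
  using keys_tens_act[of \<sigma> u] by (fastforce simp: tensors_def)

lemma tens_act_comp:
  assumes "\<sigma> permutes {..<k}" "\<tau> permutes {..<k}" "u \<in> tensors k"
  shows "tens_act \<sigma> (tens_act \<tau> u) = tens_act (\<tau> \<circ> \<sigma>) u"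
proof (rule additive_eqI[of "\<lambda>u. tens_act \<sigma> (tens_act \<tau> u)"])
  fix w assume "w \<in> keys u"
  then have "length w = k" using assms by (auto simp: tensors_def)
  then show "tens_act \<sigma> (tens_act \<tau> (single w (lookup u w))) = tens_act (\<tau> \<circ> \<sigma>) (single w (lookup u w))"
    using assms by (simp add: tens_act_single poly_act_comp permute_list_compose)
qed (simp_all add: tens_act_add)

lemma tens_act_inv:
  assumes "\<sigma> permutes {..<k}" "u \<in> tensors k"
  shows "tens_act (inv \<sigma>) (tens_act \<sigma> u) = u" "tens_act \<sigma> (tens_act (inv \<sigma>) u) = u"
  using assms tens_act_comp[of "inv \<sigma>" k \<sigma> u] tens_act_comp[of \<sigma> k "inv \<sigma>" u] permutes_inv[of \<sigma>]
    permutes_inv_o[of \<sigma>] by auto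

lemma permute_list_inj:
  assumes "\<sigma> permutes {..<k}" "length v = k" "length w = k" "permute_list \<sigma> v = permute_list \<sigma> w"
  shows "v = w"
proof -
  have "permute_list (inv \<sigma>) (permute_list \<sigma> u) = u" if "length u = k" for u :: "'a list"
    using permute_list_compose[of "inv \<sigma>" u \<sigma>] permutes_inv_o[OF assms(1)] permutes_inv[OF assms(1)] that
    by simp
  then show ?thesis using assms by metis
qed

lemma lookup_tens_act:
  assumes "\<sigma> permutes {..<k}" "length w = k" "u \<in> tensors k"
  shows "lookup (tens_act \<sigma> u) (permute_list \<sigma> w) = poly_act \<sigma> (lookup u w)"
proof (rule additive_eqI[of "\<lambda>u. lookup (tens_act \<sigma> u) (permute_list \<sigma> w)" "\<lambda>u. poly_act \<sigma> (lookup u w)"])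
  fix v assume "v \<in> keys u"
  then have "length v = k" using assms by (auto simp: tensors_def)
  then show "lookup (tens_act \<sigma> (single v (lookup u v))) (permute_list \<sigma> w) =
      poly_act \<sigma> (lookup (single v (lookup u v)) w)"
    using assms permute_list_inj[of \<sigma> k v w] by (auto simp: tens_act_single lookup_single when_def)
qed (simp_all add: tens_act_add lookup_add poly_act_add)

lemma form_extend: "form u v = extend (\<lambda>w p. p * lookup v w) u"
  by (simp add: form_def extend_def)
lemma form_add_left: "form (u + u') v = form u v + form u' v"
  unfolding form_extend by (rule extend_add) (simp add: algebra_simps)
lemma form_superset:
  assumes "finite A" "keys u \<subseteq> A"
  shows "form u v = (\<Sum>w\<in>A. lookup u w * lookup v w)"
  unfolding form_def by (rule sum_lookup_superset) (use assms in auto)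
lemma form_commute: "form u v = form v u"
  using form_superset[of "keys u \<union> keys v" u v] form_superset[of "keys u \<union> keys v" v u]
  by (simp add: mult.commute)
lemma form_add_right: "form u (v + v') = form u v + form u v'"
  using form_add_left[of v v' u] by (simp add: form_commute)
lemma form_sum_left: "form (\<Sum>i\<in>I. u i) v = (\<Sum>i\<in>I. form (u i) v)"
  by (rule additive_sum[of "\<lambda>u. form u v"]) (rule form_add_left)
lemma form_sum_right: "form v (\<Sum>i\<in>I. u i) = (\<Sum>i\<in>I. form v (u i))"
  by (rule additive_sum[of "\<lambda>u. form v u"]) (rule form_add_right)
lemma form_tscale_left: "form (tscale a u) v = a * form u v"
proof -
  have "form (tscale a u) v = (\<Sum>w\<in>keys u. lookup (tscale a u) w * lookup v w)"
    by (rule form_superset) (auto simp: keys_tscale[THEN subsetD])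
  then show ?thesis by (simp add: form_def lookup_tscale sum_distrib_left mult.assoc)
qed
lemma form_tscale_right: "form u (tscale a v) = a * form u v"
  using form_tscale_left[of a v u] by (simp add: form_commute)
lemma form_single_left: "form (single w p) v = p * lookup v w"
  by (cases "p = 0") (simp_all add: form_def)
lemma form_single_right: "form v (single w p) = lookup v w * p"
  using form_single_left[of w p v] by (simp add: form_commute mult.commute)
lemma form_0 [simp]: "form 0 v = 0" "form u 0 = 0"
  by (simp_all add: form_def)

lemma form_tens_act:
  assumes "\<sigma> permutes {..<k}" "u \<in> tensors k" "v \<in> tensors k"
  shows "form (tens_act \<sigma> u) (tens_act \<sigma> v) = poly_act \<sigma> (form u v)"
proof (rule additive_eqI[of "\<lambda>u. form (tens_act \<sigma> u) (tens_act \<sigma> v)" "\<lambda>u. poly_act \<sigma> (form u v)"])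
  fix w assume "w \<in> keys u"
  then have "length w = k" using assms by (auto simp: tensors_def)
  then show "form (tens_act \<sigma> (single w (lookup u w))) (tens_act \<sigma> v) = poly_act \<sigma> (form (single w (lookup u w)) v)"
    using assms by (simp add: tens_act_single form_single_left lookup_tens_act poly_act_mult)
qed (simp_all add: tens_act_add form_add_left poly_act_add)

lemma form_polys:
  assumes "\<And>w. lookup u w \<in> polys k" "\<And>w. lookup v w \<in> polys k"
  shows "form u v \<in> polys k"
  using assms unfolding form_def polys_eq by (intro polys_on_intros) auto

section \<open>The Lie algebra action\<close>

definition lie_word :: "nat \<Rightarrow> (nat \<Rightarrow> nat \<Rightarrow> complex) \<Rightarrow> nat list \<Rightarrow> cpoly \<Rightarrow> tens" where
  "lie_word n x w p = (\<Sum>s<length w. \<Sum>a=1..n+1. single (w[s := a]) (cst (x a (w ! s)) * p))"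

lemma lie_word_add: "lie_word n x w (p + q) = lie_word n x w p + lie_word n x w q"
  by (simp add: lie_word_def single_add distrib_left sum.distrib)
lemma lie_act_extend: "lie_act n x = extend (lie_word n x)"
  by (rule ext) (simp add: lie_act_def extend_def lie_word_def)
lemma lie_act_add: "lie_act n x (u + v) = lie_act n x u + lie_act n x v"
  unfolding lie_act_extend by (rule extend_add) (rule lie_word_add)
lemma lie_act_single: "lie_act n x (single w p) = lie_word n x w p"
  unfolding lie_act_extend by (rule extend_single) (rule lie_word_add)
lemma lie_act_sum: "lie_act n x (\<Sum>i\<in>I. u i) = (\<Sum>i\<in>I. lie_act n x (u i))"
  by (rule additive_sum) (rule lie_act_add)
lemma lie_act_0 [simp]: "lie_act n x 0 = 0" by (simp add: lie_act_def)
lemma lie_act_tscale: "lie_act n x (tscale a u) = tscale a (lie_act n x u)"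
  by (rule additive_eqI[of "\<lambda>u. lie_act n x (tscale a u)"])
    (simp_all add: lie_act_add tscale_add lie_act_single lie_word_def tscale_sum mult.left_commute)

lemma permute_list_update:
  assumes "\<sigma> permutes {..<length w}" "s < length w"
  shows "permute_list \<sigma> (w[\<sigma> s := a]) = (permute_list \<sigma> w)[s := a]"
proof (rule nth_equalityI)
  fix i assume "i < length (permute_list \<sigma> (w[\<sigma> s := a]))"
  moreover have "\<sigma> i = \<sigma> s \<longleftrightarrow> i = s" using permutes_inj[OF assms(1)] by (auto dest: injD)
  moreover have "\<sigma> s < length w" using assms permutes_in_image[OF assms(1), of s] by simp
  ultimately show "permute_list \<sigma> (w[\<sigma> s := a]) ! i = (permute_list \<sigma> w)[s := a] ! i"
    using assms by (auto simp: permute_list_nth nth_list_update)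
qed simp

lemma lie_act_tens_act:
  assumes "\<sigma> permutes {..<k}" "u \<in> tensors k"
  shows "lie_act n x (tens_act \<sigma> u) = tens_act \<sigma> (lie_act n x u)"
proof (rule additive_eqI[of "\<lambda>u. lie_act n x (tens_act \<sigma> u)"])
  fix w assume "w \<in> keys u"
  then have w: "length w = k" using assms by (auto simp: tensors_def)
  let ?p = "lookup u w"
  have "lie_act n x (tens_act \<sigma> (single w ?p)) = (\<Sum>s<k. \<Sum>a=1..n+1.
      single (permute_list \<sigma> (w[\<sigma> s := a])) (cst (x a (w ! \<sigma> s)) * poly_act \<sigma> ?p))"
    using assms w
    by (auto simp: tens_act_single lie_act_single lie_word_def permute_list_nth permute_list_update
        intro!: sum.cong)
  also have "\<dots> = (\<Sum>s<k. \<Sum>a=1..n+1.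
      single (permute_list \<sigma> (w[s := a])) (cst (x a (w ! s)) * poly_act \<sigma> ?p))"
    using sum.permute[OF assms(1), of "\<lambda>s. \<Sum>a=1..n+1.
      single (permute_list \<sigma> (w[s := a])) (cst (x a (w ! s)) * poly_act \<sigma> ?p)"]
    by (simp add: comp_def)
  also have "\<dots> = tens_act \<sigma> (lie_act n x (single w ?p))"
    by (simp add: w lie_act_single lie_word_def tens_act_sum tens_act_single poly_act_mult
        del: sum.cl_ivl_Suc)
  finally show "lie_act n x (tens_act \<sigma> (single w ?p)) = tens_act \<sigma> (lie_act n x (single w ?p))" .
qed (simp_all add: tens_act_add lie_act_add)

lemma lie_act_cartan_single:
  assumes "set w \<subseteq> {1..n+1}" "i \<in> {1..n}"
  shows "lie_act n (cartan i) (single w p) =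
    single w (cst (of_nat (count_list w i) - of_nat (count_list w (i + 1))) * p)"
proof -
  have "(\<Sum>a=1..n+1. single (w[s := a]) (cst (cartan i a (w ! s)) * p)) =
      single w (cst (cartan i (w ! s) (w ! s)) * p)" if "s < length w" for s
  proof -
    have "(\<Sum>a=1..n+1. single (w[s := a]) (cst (cartan i a (w ! s)) * p)) =
      (\<Sum>a=1..n+1. if a = w ! s then single w (cst (cartan i (w ! s) (w ! s)) * p) else 0)"
      by (rule sum.cong) (auto simp: cartan_def mat_unit_def)
    also have "w ! s \<in> {1..n+1}" using assms that nth_mem by blast
    then have "(\<Sum>a=1..n+1. if a = w ! s then single w (cst (cartan i (w ! s) (w ! s)) * p) else 0) =
      single w (cst (cartan i (w ! s) (w ! s)) * p)" by (subst sum.delta) auto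
    finally show ?thesis .
  qed
  then have "lie_act n (cartan i) (single w p) = (\<Sum>s<length w. single w (cst (cartan i (w ! s) (w ! s)) * p))"
    by (simp add: lie_act_single lie_word_def)
  also have "\<dots> = single w (cst (\<Sum>s<length w. cartan i (w ! s) (w ! s)) * p)"
    using additive_sum[of "single w" "\<lambda>s. cst (cartan i (w ! s) (w ! s)) * p" "{..<length w}"]
    by (simp only: single_add cst_sum sum_distrib_right)
  also have "(\<Sum>s<length w. cartan i (w ! s) (w ! s)) =
      of_nat (count_list w i) - of_nat (count_list w (i + 1))"
  proof -
    have "(\<Sum>s<length w. cartan i (w ! s) (w ! s)) = (\<Sum>a\<leftarrow>w. cartan i a a)"
      by (simp add: sum_list_sum_nth atLeast0LessThan)
    also have "(\<Sum>a\<leftarrow>w. cartan i a a) = of_nat (count_list w i) - of_nat (count_list w (i + 1))"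
      by (induction w) (auto simp: cartan_def mat_unit_def)
    finally show ?thesis .
  qed
  finally show ?thesis .
qed

section \<open>Highest weight vectors\<close>

definition is_hw :: "nat \<Rightarrow> (nat \<Rightarrow> nat) \<Rightarrow> tens \<Rightarrow> bool" where
  "is_hw n \<xi> u \<longleftrightarrow> (\<forall>x. strictly_upper x \<longrightarrow> lie_act n x u = 0) \<and>
     (\<forall>i\<in>{1..n}. lie_act n (cartan i) u = cscale (of_nat (\<xi> i) - of_nat (\<xi> (i + 1))) u)"

lemma highest_weight_eq: "highest_weight n \<xi> U = {u \<in> U. is_hw n \<xi> u}"
  by (simp add: highest_weight_def is_hw_def)

lemma is_hw_0 [simp]: "is_hw n \<xi> 0"
  by (simp add: is_hw_def cscale_def)
lemma is_hw_add: "is_hw n \<xi> u \<Longrightarrow> is_hw n \<xi> v \<Longrightarrow> is_hw n \<xi> (u + v)"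
  by (simp add: is_hw_def cscale_def lie_act_add tscale_add)
lemma is_hw_sum: "(\<And>i. i \<in> I \<Longrightarrow> is_hw n \<xi> (u i)) \<Longrightarrow> is_hw n \<xi> (\<Sum>i\<in>I. u i)"
  by (induction I rule: infinite_finite_induct) (auto intro: is_hw_add)
lemma is_hw_tscale: "is_hw n \<xi> u \<Longrightarrow> is_hw n \<xi> (tscale a u)"
  by (simp add: is_hw_def cscale_def lie_act_tscale mult.commute)
lemma is_hw_tens_act:
  "\<sigma> permutes {..<k} \<Longrightarrow> u \<in> tensors k \<Longrightarrow> is_hw n \<xi> u \<Longrightarrow> is_hw n \<xi> (tens_act \<sigma> u)"
  by (simp add: is_hw_def cscale_def lie_act_tens_act tens_act_tscale)
    (simp add: tens_act_def)

lemma words_permute: "\<sigma> permutes {..<k} \<Longrightarrow> w \<in> words k n \<Longrightarrow> permute_list \<sigma> w \<in> words k n"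
  by (auto simp: words_def)

lemma VA_tensors: "u \<in> VA k n \<Longrightarrow> u \<in> tensors k"
  by (auto simp: VA_def tensors_def words_def)
lemma Vpow_VA: "Vpow k n \<subseteq> VA k n"
proof
  fix u assume u: "u \<in> Vpow k n"
  have "lookup u w \<in> polys k" for w
  proof -
    obtain c where "lookup u w = cst c" using u by (auto simp: Vpow_def)
    then show ?thesis by (simp add: polys_eq)
  qed
  then show "u \<in> VA k n" using u by (simp add: VA_def Vpow_def)
qed
lemma W_VA: "W k n \<subseteq> VA k n"
  by (auto simp: W_def)

lemma VA_0 [simp]: "0 \<in> VA k n" by (simp add: VA_def polys_eq)
lemma VA_add: "u \<in> VA k n \<Longrightarrow> v \<in> VA k n \<Longrightarrow> u + v \<in> VA k n"
  using keys_add[of u v] by (auto simp: VA_def lookup_add polys_eq polys_on_add)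
lemma VA_sum: "(\<And>i. i \<in> I \<Longrightarrow> u i \<in> VA k n) \<Longrightarrow> (\<Sum>i\<in>I. u i) \<in> VA k n"
  by (induction I rule: infinite_finite_induct) (auto intro: VA_add)
lemma VA_tscale: "u \<in> VA k n \<Longrightarrow> a \<in> polys k \<Longrightarrow> tscale a u \<in> VA k n"
  using keys_tscale[of a u] by (auto simp: VA_def lookup_tscale polys_eq polys_on_mult)
lemma VA_single: "w \<in> words k n \<Longrightarrow> p \<in> polys k \<Longrightarrow> single w p \<in> VA k n"
  by (auto simp: VA_def lookup_single when_def polys_eq)
lemma VA_act:
  assumes "\<sigma> permutes {..<k}" "u \<in> VA k n"
  shows "tens_act \<sigma> u \<in> VA k n"
  unfolding tens_act_def using assms
  by (intro VA_sum VA_single words_permute poly_act_polys) (auto simp: VA_def)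

lemma Vpow_0 [simp]: "0 \<in> Vpow k n" 
  using rangeI[of cst 0] by (simp add: Vpow_def)
lemma cst_closed:
  "p \<in> range cst \<Longrightarrow> q \<in> range cst \<Longrightarrow> p + q \<in> range cst"
  "p \<in> range cst \<Longrightarrow> q \<in> range cst \<Longrightarrow> p * q \<in> range cst"
  by (auto simp flip: cst_add cst_mult)
lemma Vpow_add: "u \<in> Vpow k n \<Longrightarrow> v \<in> Vpow k n \<Longrightarrow> u + v \<in> Vpow k n"
  using keys_add[of u v] cst_closed(1) by (auto simp: Vpow_def lookup_add)
lemma Vpow_sum: "(\<And>i. i \<in> I \<Longrightarrow> u i \<in> Vpow k n) \<Longrightarrow> (\<Sum>i\<in>I. u i) \<in> Vpow k n"
  by (induction I rule: infinite_finite_induct) (auto intro: Vpow_add)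
lemma Vpow_cscale: "u \<in> Vpow k n \<Longrightarrow> tscale (cst c) u \<in> Vpow k n"
  using keys_tscale[of "cst c" u] cst_closed(2)[OF rangeI] by (auto simp: Vpow_def lookup_tscale)
lemma Vpow_single: "w \<in> words k n \<Longrightarrow> single w (cst c) \<in> Vpow k n"
  using rangeI[of cst 0] by (auto simp: Vpow_def lookup_single when_def)
lemma Vpow_act:
  assumes "\<sigma> permutes {..<k}" "u \<in> Vpow k n"
  shows "tens_act \<sigma> u \<in> Vpow k n"
  unfolding tens_act_def
proof (rule Vpow_sum)
  fix w assume "w \<in> keys u"
  moreover obtain c where "lookup u w = cst c" using assms by (auto simp: Vpow_def)
  moreover have "w \<in> words k n" using \<open>w \<in> keys u\<close> assms by (auto simp: Vpow_def)
  ultimately show "single (permute_list \<sigma> w) (poly_act \<sigma> (lookup u w)) \<in> Vpow k n"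
    using assms by (simp add: Vpow_single words_permute)
qed

section \<open>Coefficients of monomials\<close>

text \<open>
  The matrices act on \<open>V\<^sup>\<otimes>\<^sup>k\<close> alone, so a tensor with polynomial coefficients is a highest weight
  vector if and only if all the constant tensors formed by the coefficients of one monomial are. This
  reduces \<open>V\<^sup>\<otimes>\<^sup>k \<otimes> A_k\<close> to \<open>V\<^sup>\<otimes>\<^sup>k\<close>.
\<close>

definition mcoeff :: "(nat \<Rightarrow>\<^sub>0 nat) \<Rightarrow> tens \<Rightarrow> tens" where
  "mcoeff m = extend (\<lambda>w p. single w (cst (lookup p m)))"

lemma mcoeff_add: "mcoeff m (u + v) = mcoeff m u + mcoeff m v"
  unfolding mcoeff_def by (rule extend_add) (simp add: lookup_add cst_add single_add)
lemma mcoeff_single: "mcoeff m (single w p) = single w (cst (lookup p m))"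
  unfolding mcoeff_def by (rule extend_single) (simp add: lookup_add cst_add single_add)
lemma mcoeff_sum: "mcoeff m (\<Sum>i\<in>I. u i) = (\<Sum>i\<in>I. mcoeff m (u i))"
  by (rule additive_sum) (rule mcoeff_add)
lemma mcoeff_0 [simp]: "mcoeff m 0 = 0" by (simp add: mcoeff_def extend_def)

lemma lookup_cst_mult: "lookup (cst c * p) m = c * lookup p m"
  by (simp add: cst_def lookup_frag_cmul flip: mult_map_scale_conv_mult)
    (simp add: map.rep_eq when_def)

lemma lookup_mcoeff: "lookup (mcoeff m u) w = cst (lookup (lookup u w) m)"
  by (rule additive_eqI[of "\<lambda>u. lookup (mcoeff m u) w" "\<lambda>u. cst (lookup (lookup u w) m)"])
    (simp_all add: mcoeff_add lookup_add cst_add mcoeff_single lookup_single when_def)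

lemma mcoeff_cscale: "mcoeff m (tscale (cst c) u) = tscale (cst c) (mcoeff m u)"
  by (rule poly_mapping_eqI) (simp add: lookup_mcoeff lookup_tscale lookup_cst_mult cst_mult)

lemma lie_act_mcoeff: "lie_act n x (mcoeff m u) = mcoeff m (lie_act n x u)"
  by (rule additive_eqI[of "\<lambda>u. lie_act n x (mcoeff m u)"])
    (simp_all add: lie_act_add mcoeff_add mcoeff_single lie_act_single lie_word_def mcoeff_sum
      lookup_cst_mult cst_mult)

lemma is_hw_mcoeff: "is_hw n \<xi> u \<Longrightarrow> is_hw n \<xi> (mcoeff m u)"
  by (simp add: is_hw_def cscale_def lie_act_mcoeff mcoeff_cscale)

lemma mcoeff_Vpow: "u \<in> VA k n \<Longrightarrow> mcoeff m u \<in> Vpow k n"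
  by (auto simp: VA_def Vpow_def lookup_mcoeff in_keys_iff subset_iff) (metis lookup_zero)

lemma mcoeff_expand: "\<exists>F. finite F \<and> u = (\<Sum>m\<in>F. tscale (single m 1) (mcoeff m u))"
proof (intro exI conjI)
  let ?F = "\<Union>w\<in>keys u. keys (lookup u w)"
  show "finite ?F" by simp
  show "u = (\<Sum>m\<in>?F. tscale (single m 1) (mcoeff m u))"
  proof (rule poly_mapping_eqI)
    fix w
    have "lookup u w = (\<Sum>m\<in>keys (lookup u w). single m (lookup (lookup u w) m))"
      by (simp add: sum_singles)
    also have "\<dots> = (\<Sum>m\<in>?F. single m (lookup (lookup u w) m))"
    proof (cases "w \<in> keys u")
      case True
      then show ?thesis by (intro sum_lookup_superset) auto
    qed (simp add: in_keys_iff)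
    finally show "lookup u w = lookup (\<Sum>m\<in>?F. tscale (single m 1) (mcoeff m u)) w"
      by (simp add: lookup_sum lookup_tscale lookup_mcoeff cst_def mult_single)
  qed
qed

section \<open>Words and positions cut into blocks\<close>

text \<open>
  The positions are cut into consecutive blocks of lengths \<open>ls\<close>, the columns of a diagram. The functions
  \<open>block_of\<close> and \<open>inner_pos\<close> return the number of the block of a position and its place in the block.
\<close>

fun block_of :: "nat list \<Rightarrow> nat \<Rightarrow> nat" where
  "block_of [] p = 0"
| "block_of (l # ls) p = (if p < l then 0 else Suc (block_of ls (p - l)))"

fun inner_pos :: "nat list \<Rightarrow> nat \<Rightarrow> nat" where
  "inner_pos [] p = p"
| "inner_pos (l # ls) p = (if p < l then p else inner_pos ls (p - l))"

definition offset :: "nat list \<Rightarrow> nat \<Rightarrow> nat" where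
  "offset ls b = sum_list (take b ls)"

lemma block_position:
  assumes "p < sum_list ls"
  shows "block_of ls p < length ls" "inner_pos ls p < ls ! block_of ls p"
    "offset ls (block_of ls p) + inner_pos ls p = p"
proof -
  have "block_of ls p < length ls \<and> inner_pos ls p < ls ! block_of ls p \<and>
    offset ls (block_of ls p) + inner_pos ls p = p"
    using assms
  proof (induction ls p rule: block_of.induct)
    case (2 l ls p)
    show ?case
    proof (cases "p < l")
      case False
      then have "p - l < sum_list ls" using 2 by simp
      moreover have "l \<le> p" using False by simp
      ultimately show ?thesis using 2 False by (simp add: offset_def add.assoc)
    qed (simp add: offset_def)
  qed simp
  then show "block_of ls p < length ls" "inner_pos ls p < ls ! block_of ls p"
    "offset ls (block_of ls p) + inner_pos ls p = p" by auto
qed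

lemma position_of_block:
  assumes "b < length ls" "i < ls ! b"
  shows "offset ls b + i < sum_list ls" "block_of ls (offset ls b + i) = b"
    "inner_pos ls (offset ls b + i) = i"
  using assms by (induction ls arbitrary: b) (auto simp: offset_def nth_Cons split: nat.splits)

lemma nth_concat_block:
  assumes "p < sum_list (map length xss)"
  shows "concat xss ! p = xss ! block_of (map length xss) p ! inner_pos (map length xss) p"
  using assms by (induction xss arbitrary: p) (auto simp: nth_append)

lemma block_of_eqD:
  assumes "p < sum_list ls" "q < sum_list ls" "block_of ls p = block_of ls q" "inner_pos ls p = inner_pos ls q"
  shows "p = q"
  by (metis block_position(3) assms)

section \<open>The column group\<close>

text \<open>
  The column group is the product of the symmetric groups of the blocks. It is described by the
  blocks it preserves, which makes transpositions and rearrangements of words easy to recognise; sums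
  over it are split off block by block through \<open>join_perms\<close>.
\<close>

definition column_group :: "nat list \<Rightarrow> (nat \<Rightarrow> nat) set" where
  "column_group ls = {c. c permutes {..<sum_list ls} \<and> (\<forall>p<sum_list ls. block_of ls (c p) = block_of ls p)}"

definition join_perms :: "nat \<Rightarrow> (nat \<Rightarrow> nat) \<Rightarrow> (nat \<Rightarrow> nat) \<Rightarrow> nat \<Rightarrow> nat" where
  "join_perms l a d = (\<lambda>p. if p < l then a p else l + d (p - l))"

lemma join_perms_eq:
  assumes "a permutes {..<l}" "d permutes {..<m}"
  shows "join_perms l a d = map_permutation {..<m} ((+) l) d \<circ> a"
proof
  fix p
  have inj: "inj_on ((+) l) {..<m}" by (simp add: inj_on_def)
  show "join_perms l a d p = (map_permutation {..<m} ((+) l) d \<circ> a) p"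
  proof (cases "p < l")
    case True
    then have "a p < l" using assms permutes_in_image by fastforce
    then show ?thesis using True by (auto simp: join_perms_def map_permutation_def restrict_id_def)
  next
    case False
    then have a: "a p = p" using assms by (auto dest: permutes_not_in)
    show ?thesis
    proof (cases "p - l < m")
      case True
      then show ?thesis using False a map_permutation_apply[OF inj, of "p - l" d] by (simp add: join_perms_def)
    next
      case p: False
      then have "d (p - l) = p - l" using assms by (auto dest: permutes_not_in)
      moreover have "p \<notin> (+) l ` {..<m}" using p by auto
      ultimately show ?thesis using False a by (simp add: join_perms_def map_permutation_def restrict_id_def)
    qed
  qed
qed

lemma shift_bij: "bij_betw ((+) l) {..<m} {l..<l + (m::nat)}"
  by (rule bij_betw_byWitness[where f' = "\<lambda>x. x - l"]) auto

lemma join_perms_permutes: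
  assumes "a permutes {..<l}" "d permutes {..<m}"
  shows "join_perms l a d permutes {..<l + m}"
proof -
  have "map_permutation {..<m} ((+) l) d permutes {l..<l + m}"
    by (rule map_permutation_permutes[OF shift_bij assms(2)])
  then have "map_permutation {..<m} ((+) l) d permutes {..<l + m}" by (rule permutes_subset) auto
  moreover have "a permutes {..<l + m}" using assms(1) by (rule permutes_subset) auto
  ultimately show ?thesis unfolding join_perms_eq[OF assms] by (intro permutes_compose)
qed

lemma sign_join_perms:
  assumes "a permutes {..<l}" "d permutes {..<m}"
  shows "sign (join_perms l a d) = sign a * sign d"
proof -
  have inj: "inj_on ((+) l) {..<m}" by (simp add: inj_on_def)
  have "map_permutation {..<m} ((+) l) d permutes {l..<l + m}"
    by (rule map_permutation_permutes[OF shift_bij assms(2)])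
  then have "permutation (map_permutation {..<m} ((+) l) d)" by (rule permutes_imp_permutation[rotated]) simp
  moreover have "permutation a" using assms(1) by (rule permutes_imp_permutation[rotated]) simp
  ultimately show ?thesis
    unfolding join_perms_eq[OF assms] by (simp add: sign_compose sign_map_permutation[OF inj assms(2)])
qed

lemma permute_list_join:
  assumes "length xs = l" "a permutes {..<l}" "d permutes {..<length ys}"
  shows "permute_list (join_perms l a d) (xs @ ys) = permute_list a xs @ permute_list d ys"
proof (rule nth_equalityI)
  fix p assume "p < length (permute_list (join_perms l a d) (xs @ ys))"
  then have p: "p < l + length ys" using assms by simp
  have "a p < l" if "p < l" using that permutes_in_image[OF assms(2), of p] by simp
  then show "permute_list (join_perms l a d) (xs @ ys) ! p = (permute_list a xs @ permute_list d ys) ! p"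
    using p assms join_perms_permutes[OF assms(2,3)]
    by (auto simp: permute_list_nth nth_append join_perms_def)
qed (simp add: assms)

lemma column_group_Nil [simp]: "column_group [] = {id}"
  by (auto simp: column_group_def)

lemma column_group_Cons_bij:
  "bij_betw (\<lambda>(a, d). join_perms l a d) ({a. a permutes {..<l}} \<times> column_group ls) (column_group (l # ls))"
proof (rule bij_betw_imageI)
  let ?m = "sum_list ls"
  show "inj_on (\<lambda>(a, d). join_perms l a d) ({a. a permutes {..<l}} \<times> column_group ls)"
  proof (rule inj_onI, clarify)
    fix a d a' d'
    assume a: "a permutes {..<l}" "a' permutes {..<l}" and eq: "join_perms l a d = join_perms l a' d'"
    have "a p = a' p" for p
      using fun_cong[OF eq, of p] permutes_not_in[OF a(1), of p] permutes_not_in[OF a(2), of p]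
      by (cases "p < l") (auto simp: join_perms_def)
    moreover have "d p = d' p" for p
      using fun_cong[OF eq, of "l + p"] by (simp add: join_perms_def)
    ultimately show "a = a' \<and> d = d'" by auto
  qed
  show "(\<lambda>(a, d). join_perms l a d) ` ({a. a permutes {..<l}} \<times> column_group ls) = column_group (l # ls)"
  proof (intro equalityI subsetI)
    fix c assume "c \<in> (\<lambda>(a, d). join_perms l a d) ` ({a. a permutes {..<l}} \<times> column_group ls)"
    then obtain a d where c: "c = join_perms l a d" and a: "a permutes {..<l}" and d: "d \<in> column_group ls"
      by auto
    have "a p < l" if "p < l" for p using that permutes_in_image[OF a, of p] by simp
    then show "c \<in> column_group (l # ls)"
      using d join_perms_permutes[OF a, of d ?m] by (auto simp: column_group_def c) (auto simp: join_perms_def)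
  next
    fix c assume c: "c \<in> column_group (l # ls)"
    then have perm: "c permutes {..<l + ?m}"
      and blk: "\<And>p. p < l + ?m \<Longrightarrow> block_of (l # ls) (c p) = block_of (l # ls) p"
      by (auto simp: column_group_def)
    have lt: "c p < l \<longleftrightarrow> p < l" for p
    proof (cases "p < l + ?m")
      case True
      show ?thesis using blk[OF True] by (simp split: if_splits)
    next
      case False
      then show ?thesis using perm by (auto dest: permutes_not_in)
    qed
    define a where "a = (\<lambda>p. if p < l then c p else p)"
    define d where "d = (\<lambda>p. c (l + p) - l)"
    have inj: "c p = c q \<longleftrightarrow> p = q" for p q using permutes_inj[OF perm] by (auto dest: injD)
    have "a permutes {..<l}"
    proof (rule inj_imp_permutes)
      show "inj_on a {..<l}" by (auto simp: a_def inj_on_def inj)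
      show "\<And>x. x \<in> {..<l} \<Longrightarrow> a x \<in> {..<l}" using lt by (simp add: a_def)
    qed (auto simp: a_def)
    moreover have "d permutes {..<?m}"
    proof (rule inj_imp_permutes)
      show "inj_on d {..<?m}"
      proof (rule inj_onI)
        fix x y assume "d x = d y"
        moreover have "l \<le> c (l + x)" "l \<le> c (l + y)" using lt[of "l + x"] lt[of "l + y"] by auto
        ultimately have "c (l + x) = c (l + y)" unfolding d_def by linarith
        then show "x = y" by (simp add: inj)
      qed
      show "d x \<in> {..<?m}" if "x \<in> {..<?m}" for x
        using permutes_in_image[OF perm, of "l + x"] that lt[of "l + x"] by (auto simp: d_def)
      show "d x = x" if "x \<notin> {..<?m}" for x
        using permutes_not_in[OF perm, of "l + x"] that by (simp add: d_def)
    qed simp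
    moreover have "block_of ls (d p) = block_of ls p" if "p < ?m" for p
      using blk[of "l + p"] that lt[of "l + p"] by (simp add: d_def)
    moreover have "c = join_perms l a d"
    proof
      fix p show "c p = join_perms l a d p"
        using lt[of p] by (auto simp: join_perms_def a_def d_def)
    qed
    ultimately show "c \<in> (\<lambda>(a, d). join_perms l a d) ` ({a. a permutes {..<l}} \<times> column_group ls)"
      by (auto simp: column_group_def intro!: image_eqI[of _ _ "(a, d)"])
  qed
qed

lemma column_group_permutes: "c \<in> column_group ls \<Longrightarrow> c permutes {..<sum_list ls}"
  by (simp add: column_group_def)

lemma finite_column_group [simp]: "finite (column_group ls)"
  by (rule finite_subset[OF _ finite_permutations[of "{..<sum_list ls}"]]) (auto simp: column_group_def)

lemma sum_column_group_Cons:
  "(\<Sum>c\<in>column_group (l # ls). F c) =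
    (\<Sum>a | a permutes {..<l}. \<Sum>d\<in>column_group ls. F (join_perms l a d))"
  using sum.reindex_bij_betw[OF column_group_Cons_bij, of F l ls, symmetric]
  by (simp add: sum.cartesian_product case_prod_beta)

section \<open>The vector e and the polynomials b as alternating sums\<close>

definition row_word :: "nat list \<Rightarrow> nat list" where
  "row_word ls = concat (map (\<lambda>l. [1..<l+1]) ls)"

lemma tensor_extend: "tensor u v = extend (\<lambda>w p. extend (\<lambda>w' q. single (w @ w') (p * q)) v) u"
  by (simp add: tensor_def extend_def)

lemma tensor_add_right: "tensor u (v + v') = tensor u v + tensor u v'"
proof -
  have "extend (\<lambda>w' q. single (w @ w') (p * q)) (v + v') =
    extend (\<lambda>w' q. single (w @ w') (p * q)) v + extend (\<lambda>w' q. single (w @ w') (p * q)) v'" for w p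
    by (rule extend_add) (simp add: distrib_left single_add)
  then show ?thesis by (simp add: tensor_extend) (simp add: extend_def sum.distrib)
qed

lemma tensor_add_left: "tensor (u + u') v = tensor u v + tensor u' v"
  unfolding tensor_extend
  by (rule extend_add) (simp add: extend_def distrib_right single_add sum.distrib)

lemma tensor_single: "tensor (single w p) (single w' q) = single (w @ w') (p * q)"
  by (auto simp: tensor_def)

lemma tensor_sum: "tensor (\<Sum>i\<in>I. u i) (\<Sum>j\<in>J. v j) = (\<Sum>i\<in>I. \<Sum>j\<in>J. tensor (u i) (v j))"
  by (subst additive_sum[of "\<lambda>u. tensor u (\<Sum>j\<in>J. v j)"], rule tensor_add_left)
    (rule sum.cong[OF refl], rule additive_sum, rule tensor_add_right)

text \<open>
  The letters 1, ..., l occupy the positions 0, ..., l - 1, and permuting letters is the same as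
  permuting these positions, with the same sign.
\<close>

lemma wedge_eq:
  "wedge l = (\<Sum>a | a permutes {..<l}. single (permute_list a [1..<l+1]) (of_int (sign a)))"
proof -
  have inj: "inj_on Suc {..<l}" by simp
  have img: "Suc ` {..<l} = {1..l}" by (auto simp: image_iff) (metis Suc_le_D Suc_le_lessD lessThan_iff)
  then have bij: "bij_betw Suc {..<l} {1..l}" by (simp add: bij_betw_def)
  have "bij_betw (map_permutation {..<l} Suc) {a. a permutes {..<l}} {t. t permutes {1..l}}"
  proof -
    have "bij_betw (\<lambda>\<pi> x. if x \<in> {1..l} then Suc (\<pi> (inv_into {..<l} Suc x)) else x)
      {a. a permutes {..<l}} {t. t permutes {1..l}}"
      by (rule bij_betw_permutations[OF bij])
    moreover have "map_permutation {..<l} Suc =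
        (\<lambda>\<pi> x. if x \<in> {1..l} then Suc (\<pi> (inv_into {..<l} Suc x)) else x)"
      by (intro ext) (simp add: map_permutation_def restrict_id_def img)
    ultimately show ?thesis by simp
  qed
  then have "wedge l = (\<Sum>a | a permutes {..<l}. single (map (map_permutation {..<l} Suc a) [1..<l+1])
      (of_int (sign (map_permutation {..<l} Suc a))))"
    unfolding wedge_def by (rule sum.reindex_bij_betw[symmetric])
  also have "\<dots> = (\<Sum>a | a permutes {..<l}. single (permute_list a [1..<l+1]) (of_int (sign a)))"
  proof (rule sum.cong[OF refl], clarify)
    fix a assume a: "a permutes {..<l}"
    have "map (map_permutation {..<l} Suc a) [1..<l+1] = permute_list a [1..<l+1]"
    proof (rule nth_equalityI)
      fix i assume "i < length (map (map_permutation {..<l} Suc a) [1..<l+1])"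
      then have i: "i < l" by (simp del: upt_Suc)
      moreover have "a i < l" using i permutes_in_image[OF a, of i] by simp
      ultimately show "map (map_permutation {..<l} Suc a) [1..<l+1] ! i = permute_list a [1..<l+1] ! i"
        using map_permutation_apply[OF inj, of i a] a by (simp add: permute_list_nth del: upt_Suc)
    qed simp
    then show "single (map (map_permutation {..<l} Suc a) [1..<l+1]) (of_int (sign (map_permutation {..<l} Suc a)))
      = single (permute_list a [1..<l+1]) (of_int (sign a))"
      by (simp add: sign_map_permutation[OF inj a])
  qed
  finally show ?thesis .
qed

lemma length_row_word: "length (row_word ls) = sum_list ls"
  by (simp add: row_word_def length_concat comp_def del: upt_Suc)

text \<open>
  A product of alternating sums over the blocks is one alternating sum over the column group. Here
  and in \<open>block_tensor_alternant\<close> the induction splits off the first block.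
\<close>

lemma foldr_tensor_wedge:
  "foldr tensor (map wedge ls) (single [] 1) =
    (\<Sum>c\<in>column_group ls. single (permute_list c (row_word ls)) (of_int (sign c)))"
proof (induction ls)
  case (Cons l ls)
  have "foldr tensor (map wedge (l # ls)) (single [] 1) =
    (\<Sum>a | a permutes {..<l}. \<Sum>d\<in>column_group ls. single (permute_list a [1..<l+1] @ permute_list d (row_word ls))
      (of_int (sign a) * of_int (sign d)))"
    by (simp only: list.map foldr.simps comp_def Cons.IH) (simp only: wedge_eq tensor_sum tensor_single)
  also have "\<dots> = (\<Sum>a | a permutes {..<l}. \<Sum>d\<in>column_group ls.
      single (permute_list (join_perms l a d) (row_word (l # ls))) (of_int (sign (join_perms l a d))))"
  proof (intro sum.cong refl)
    fix a d assume "a \<in> {a. a permutes {..<l}}" "d \<in> column_group ls"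
    then have a: "a permutes {..<l}" and d: "d permutes {..<sum_list ls}"
      by (auto simp: column_group_permutes)
    have "row_word (l # ls) = [1..<l+1] @ row_word ls" by (simp only: row_word_def list.map concat.simps)
    moreover have "d permutes {..<length (row_word ls)}" by (simp add: length_row_word d)
    ultimately have "permute_list (join_perms l a d) (row_word (l # ls)) = permute_list a [1..<l+1] @ permute_list d (row_word ls)"
      using a by (simp add: permute_list_join del: upt_Suc)
    then show "single (permute_list a [1..<l+1] @ permute_list d (row_word ls)) (of_int (sign a) * of_int (sign d)) =
      single (permute_list (join_perms l a d) (row_word (l # ls))) (of_int (sign (join_perms l a d)))"
      using sign_join_perms[OF a d] by simp
  qed
  finally show ?case by (simp only: sum_column_group_Cons)
qed (simp add: row_word_def)

text \<open>
  The alternating polynomial with an exponent for each of the variables. The polynomials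
  \<open>a(r_1, ..., r_l)\<close> have one exponent less than variables.
\<close>

definition alternant :: "nat list \<Rightarrow> cpoly" where
  "alternant es = (\<Sum>a | a permutes {..<length es}. of_int (sign a) * (\<Prod>i<length es. var (a i) ^ (es ! i)))"

lemma prod_lessThan_add: "(\<Prod>p<l + (m::nat). F p) = (\<Prod>p<l. F p) * (\<Prod>p<m. F (l + p))"
  by (induction m) (simp_all add: mult.assoc)

lemma block_tensor_alternant:
  "block_tensor (map (\<lambda>es. (length es, alternant es)) ess) =
    (\<Sum>c\<in>column_group (map length ess). of_int (sign c) *
      (\<Prod>p<sum_list (map length ess). var (c p) ^ (concat ess ! p)))"
proof (induction ess)
  case Nil
  show ?case by (simp add: block_tensor_def)
next
  case (Cons es ess)
  let ?l = "length es" and ?ls = "map length ess" let ?m = "sum_list ?ls"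
  have "block_tensor (map (\<lambda>es. (length es, alternant es)) (es # ess)) =
    alternant es * rename_vars (\<lambda>i. ?l + i) (block_tensor (map (\<lambda>es. (length es, alternant es)) ess))"
    by (simp add: block_tensor_def)
  also have "\<dots> = (\<Sum>a | a permutes {..<?l}. \<Sum>d\<in>column_group ?ls.
      (of_int (sign a) * (\<Prod>i<?l. var (a i) ^ (es ! i))) *
      (of_int (sign d) * (\<Prod>p<?m. var (?l + d p) ^ (concat ess ! p))))"
    unfolding Cons.IH alternant_def[of es]
    by (simp add: sum_product rename_vars_sum rename_vars_mult rename_vars_prod rename_vars_power rename_vars_var)
  also have "\<dots> = (\<Sum>a | a permutes {..<?l}. \<Sum>d\<in>column_group ?ls. of_int (sign (join_perms ?l a d)) *
      (\<Prod>p<?l + ?m. var (join_perms ?l a d p) ^ (concat (es # ess) ! p)))"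
  proof (intro sum.cong refl)
    fix a d assume "a \<in> {a. a permutes {..<?l}}" "d \<in> column_group ?ls"
    then have s: "sign (join_perms ?l a d) = sign a * sign d"
      by (metis mem_Collect_eq sign_join_perms column_group_permutes)
    have "(\<Prod>p<?l + ?m. var (join_perms ?l a d p) ^ (concat (es # ess) ! p)) =
      (\<Prod>i<?l. var (a i) ^ (es ! i)) * (\<Prod>p<?m. var (?l + d p) ^ (concat ess ! p))"
      unfolding prod_lessThan_add by (intro arg_cong2[of _ _ _ _ "(*)"] prod.cong refl)
        (auto simp: join_perms_def nth_append)
    then show "(of_int (sign a) * (\<Prod>i<?l. var (a i) ^ (es ! i))) *
      (of_int (sign d) * (\<Prod>p<?m. var (?l + d p) ^ (concat ess ! p))) = of_int (sign (join_perms ?l a d)) *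
      (\<Prod>p<?l + ?m. var (join_perms ?l a d p) ^ (concat (es # ess) ! p))"
      by (simp add: s mult_ac)
  qed
  finally show ?case by (simp only: sum_column_group_Cons list.map sum_list.Cons)
qed

definition cycle_perm :: "nat \<Rightarrow> nat \<Rightarrow> nat" where
  "cycle_perm l i = (if i < l then Suc i mod l else i)"

lemma cycle_perm_permutes: "cycle_perm l permutes {..<l}"
proof (rule inj_imp_permutes)
  have "i = j" if "cycle_perm l i = cycle_perm l j" for i j
  proof (cases "i < l \<and> j < l")
    case True
    then have "Suc i mod l = (if Suc i = l then 0 else Suc i)" "Suc j mod l = (if Suc j = l then 0 else Suc j)"
      by auto
    then show ?thesis using that True by (auto simp: cycle_perm_def split: if_splits)
  next
    case False
    have "Suc i mod l < l" if "i < l" for i using that by (intro mod_less_divisor) simp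
    then show ?thesis using that False by (auto simp: cycle_perm_def split: if_splits)
  qed
  then show "inj_on (cycle_perm l) {..<l}" by (auto simp: inj_on_def)
qed (auto simp: cycle_perm_def)

text \<open>
  In \<open>apoly\<close> the missing exponent 0 belongs to the last variable. Moving it to the first one rotates
  the variables cyclically; afterwards the i-th exponent of a block belongs to the i-th letter of
  the wedge product, that is, to the i-th row of the diagram.
\<close>

lemma apoly_alternant: "apoly rs = of_int (sign (cycle_perm (length rs + 1))) * alternant (0 # rs)"
proof -
  let ?l = "length rs + 1" let ?c = "cycle_perm ?l"
  have "alternant (0 # rs) = (\<Sum>a | a permutes {..<?l}. of_int (sign a) * (\<Prod>i<length rs. var (a (Suc i)) ^ (rs ! i)))"
    by (simp add: alternant_def prod.lessThan_Suc_shift del: prod.lessThan_Suc)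
  also have "\<dots> = (\<Sum>a | a permutes {..<?l}. of_int (sign ?c) * (of_int (sign (a \<circ> ?c)) * (\<Prod>i<length rs. var ((a \<circ> ?c) i) ^ (rs ! i))))"
  proof (rule sum.cong[OF refl], clarify)
    fix a assume a: "a permutes {..<?l}"
    have "permutation a" "permutation ?c" using a cycle_perm_permutes
      by (meson finite_lessThan permutes_imp_permutation)+
    then have "sign a = sign ?c * sign (a \<circ> ?c)" by (simp add: sign_compose)
    moreover have "?c i = Suc i" if "i < length rs" for i using that by (simp add: cycle_perm_def)
    ultimately show "of_int (sign a) * (\<Prod>i<length rs. var (a (Suc i)) ^ (rs ! i)) =
      of_int (sign ?c) * (of_int (sign (a \<circ> ?c)) * (\<Prod>i<length rs. var ((a \<circ> ?c) i) ^ (rs ! i)))"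
      by (simp flip: mult.assoc)
  qed
  also have "\<dots> = of_int (sign ?c) * apoly rs"
    unfolding apoly_def sum_distrib_left[symmetric]
    using sum_permutations_compose_right[OF cycle_perm_permutes[of ?l], of "\<lambda>a. of_int (sign a) * (\<Prod>i<length rs. var (a i) ^ (rs ! i))"]
    by simp
  finally show ?thesis by (simp flip: mult.assoc of_int_mult)
qed

lemma block_tensor_apoly:
  "block_tensor (map (\<lambda>rs. (length rs + 1, apoly rs)) rss) =
    of_int (\<Prod>rs\<leftarrow>rss. sign (cycle_perm (length rs + 1))) *
      block_tensor (map (\<lambda>es. (length es, alternant es)) (map ((#) 0) rss))"
  by (induction rss) (simp_all add: block_tensor_def apoly_alternant rename_vars_mult mult_ac)

section \<open>The column antisymmetriser on words\<close>

lemma column_group_comp: "c \<in> column_group ls \<Longrightarrow> d \<in> column_group ls \<Longrightarrow> c \<circ> d \<in> column_group ls"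
  unfolding column_group_def
  by (auto intro: permutes_compose) (metis lessThan_iff permutes_in_image)

lemma column_group_inv:
  assumes "c \<in> column_group ls"
  shows "inv c \<in> column_group ls"
proof -
  have perm: "c permutes {..<sum_list ls}" using assms by (simp add: column_group_def)
  have "block_of ls (inv c p) = block_of ls p" if "p < sum_list ls" for p
  proof -
    have "inv c p < sum_list ls" using permutes_in_image[OF permutes_inv[OF perm], of p] that by simp
    then have "block_of ls (c (inv c p)) = block_of ls (inv c p)" using assms by (simp add: column_group_def)
    then show ?thesis by (simp add: permutes_inverses[OF perm])
  qed
  then show ?thesis using permutes_inv[OF perm] by (simp add: column_group_def)
qed

lemma column_group_permutation: "c \<in> column_group ls \<Longrightarrow> permutation c"
  using column_group_permutes permutes_imp_permutation finite_lessThan by blast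

lemma sum_column_group_inv: "(\<Sum>c\<in>column_group ls. F (inv c)) = (\<Sum>c\<in>column_group ls. F c)"
  by (rule sum.reindex_bij_witness[of _ inv inv])
    (auto simp: column_group_inv permutes_inv_inv[OF column_group_permutes])

lemma sum_column_group_left:
  assumes "d \<in> column_group ls"
  shows "(\<Sum>c\<in>column_group ls. F (d \<circ> c)) = (\<Sum>c\<in>column_group ls. F c)"
proof (rule sum.reindex_bij_witness[of _ "\<lambda>c. inv d \<circ> c" "\<lambda>c. d \<circ> c"])
  have "d \<circ> inv d = id" "inv d \<circ> d = id" using permutes_inv_o[OF column_group_permutes[OF assms]] by auto
  then show "\<And>c. inv d \<circ> (d \<circ> c) = c" "\<And>c. d \<circ> (inv d \<circ> c) = c"
    by (simp_all add: comp_assoc[symmetric])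
qed (use assms in \<open>auto simp: column_group_comp column_group_inv\<close>)

lemma sum_column_group_right:
  assumes "d \<in> column_group ls"
  shows "(\<Sum>c\<in>column_group ls. F (c \<circ> d)) = (\<Sum>c\<in>column_group ls. F c)"
proof (rule sum.reindex_bij_witness[of _ "\<lambda>c. c \<circ> inv d" "\<lambda>c. c \<circ> d"])
  have "d \<circ> inv d = id" "inv d \<circ> d = id" using permutes_inv_o[OF column_group_permutes[OF assms]] by auto
  then show "\<And>c. c \<circ> d \<circ> inv d = c" "\<And>c. c \<circ> inv d \<circ> d = c"
    by (simp_all add: comp_assoc)
qed (use assms in \<open>auto simp: column_group_comp column_group_inv\<close>)

text \<open>
  The column antisymmetriser of the group algebra; it makes \<open>e(\<xi>)\<close> out of a single word.
\<close>

definition column_alt :: "nat list \<Rightarrow> tens \<Rightarrow> tens" where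
  "column_alt ls u = (\<Sum>c\<in>column_group ls. tscale (of_int (sign c)) (tens_act c u))"

lemma column_alt_add: "column_alt ls (u + v) = column_alt ls u + column_alt ls v"
  by (simp add: column_alt_def tens_act_add tscale_add sum.distrib)
lemma column_alt_sum: "column_alt ls (\<Sum>i\<in>I. u i) = (\<Sum>i\<in>I. column_alt ls (u i))"
  by (rule additive_sum) (rule column_alt_add)
lemma column_alt_cscale: "column_alt ls (tscale (cst a) u) = tscale (cst a) (column_alt ls u)"
  by (simp add: column_alt_def tens_act_tscale tscale_sum mult.commute)

lemma of_int_sign_square [simp]: "of_int (sign p) * (of_int (sign p) :: cpoly) = 1"
  by (simp flip: of_int_mult)

lemma column_alt_absorb:
  assumes "d \<in> column_group ls" "u \<in> tensors (sum_list ls)"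
  shows "column_alt ls (tens_act d u) = tscale (of_int (sign d)) (column_alt ls u)"
    "tens_act d (column_alt ls u) = tscale (of_int (sign d)) (column_alt ls u)"
proof -
  have s: "of_int (sign (d \<circ> c)) = of_int (sign d) * (of_int (sign c) :: cpoly)"
    "of_int (sign (c \<circ> d)) = of_int (sign d) * (of_int (sign c) :: cpoly)" if "c \<in> column_group ls" for c
    using that assms by (auto simp: sign_compose column_group_permutation)
  have "column_alt ls u = (\<Sum>c\<in>column_group ls. tscale (of_int (sign (d \<circ> c))) (tens_act (d \<circ> c) u))"
    unfolding column_alt_def
    by (rule sum_column_group_left[OF assms(1), of "\<lambda>c. tscale (of_int (sign c)) (tens_act c u)", symmetric])
  also have "\<dots> = tscale (of_int (sign d)) (column_alt ls (tens_act d u))"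
    unfolding column_alt_def tscale_sum tscale_tscale
    by (rule sum.cong)
      (use assms column_group_permutes tens_act_comp[OF _ _ assms(2), symmetric] in \<open>auto simp: s\<close>)
  finally show "column_alt ls (tens_act d u) = tscale (of_int (sign d)) (column_alt ls u)" by simp
  have "column_alt ls u = (\<Sum>c\<in>column_group ls. tscale (of_int (sign (c \<circ> d))) (tens_act (c \<circ> d) u))"
    unfolding column_alt_def
    by (rule sum_column_group_right[OF assms(1), of "\<lambda>c. tscale (of_int (sign c)) (tens_act c u)", symmetric])
  also have "\<dots> = tscale (of_int (sign d)) (tens_act d (column_alt ls u))"
    unfolding column_alt_def tscale_sum tens_act_sum tscale_tscale tens_act_tscale
    by (rule sum.cong)
      (use assms column_group_permutes tens_act_comp[OF _ _ assms(2), symmetric] in \<open>auto simp: s\<close>)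
  finally show "tens_act d (column_alt ls u) = tscale (of_int (sign d)) (column_alt ls u)"
    by (metis of_int_sign_square tscale_1 tscale_tscale)
qed

text \<open>A word with a letter repeated in a column is fixed by an odd column permutation.\<close>

lemma column_alt_repeated:
  assumes "length w = sum_list ls" "p < sum_list ls" "q < sum_list ls" "p \<noteq> q"
    "block_of ls p = block_of ls q" "w ! p = w ! q"
  shows "column_alt ls (single w 1) = 0"
proof -
  let ?t = "transpose p q"
  have t: "?t permutes {..<sum_list ls}" using assms by (intro permutes_swap_id) auto
  then have "?t \<in> column_group ls" using assms by (auto simp: column_group_def transpose_def)
  moreover have "permute_list ?t w = w"
    by (rule nth_equalityI) (use assms t in \<open>auto simp: permute_list_nth transpose_def\<close>)
  ultimately have "column_alt ls (single w 1) = - column_alt ls (single w 1)"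
    using column_alt_absorb(1)[of ?t ls "single w 1"] assms
    by (simp add: tens_act_single tensors_single sign_swap_id tscale_uminus)
  then have "lookup (column_alt ls (single w 1)) v = - lookup (column_alt ls (single w 1)) v" for v
    using lookup_uminus by metis
  then have "2 * lookup (column_alt ls (single w 1)) v = 0" for v
    unfolding mult_2 eq_neg_iff_add_eq_0 .
  then have "lookup (column_alt ls (single w 1)) v = 0" for v
    using mult_eq_0_iff zero_neq_numeral by metis
  then show ?thesis by (intro poly_mapping_eqI) simp
qed

lemma nth_row_word: "p < sum_list ls \<Longrightarrow> row_word ls ! p = Suc (inner_pos ls p)"
proof -
  assume p: "p < sum_list ls"
  let ?xss = "map (\<lambda>l. [1..<l+1]) ls"
  have ls: "map length ?xss = ls" by (simp add: comp_def del: upt_Suc)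
  have "concat ?xss ! p = ?xss ! block_of ls p ! inner_pos ls p"
    using nth_concat_block[of p ?xss] p by (simp only: ls)
  then show ?thesis using block_position[OF p] by (simp add: row_word_def del: upt_Suc)
qed

lemma column_group_row_word_id:
  assumes "c \<in> column_group ls" "permute_list c (row_word ls) = row_word ls"
  shows "c = id"
proof
  fix p show "c p = id p"
  proof (cases "p < sum_list ls")
    case True
    have perm: "c permutes {..<sum_list ls}" using assms by (simp add: column_group_permutes)
    have cp: "c p < sum_list ls" using permutes_in_image[OF perm, of p] True by simp
    have "row_word ls ! c p = row_word ls ! p"
      using arg_cong[OF assms(2), of "\<lambda>w. w ! p"] perm True by (simp add: permute_list_nth length_row_word)
    then have "inner_pos ls (c p) = inner_pos ls p" using True cp by (simp add: nth_row_word)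
    moreover have "block_of ls (c p) = block_of ls p" using assms True by (simp add: column_group_def)
    ultimately show ?thesis using block_of_eqD cp True by auto
  next
    case False
    then show ?thesis using assms by (auto simp: column_group_def dest: permutes_not_in)
  qed
qed

lemma sum_positions:
  "(\<Sum>p<sum_list ls. F p) = (\<Sum>b<length ls. \<Sum>i<ls ! b. F (offset ls b + i))"
proof -
  have "(\<Sum>(b, i)\<in>(SIGMA b:{..<length ls}. {..<ls ! b}). F (offset ls b + i)) = (\<Sum>p<sum_list ls. F p)"
    by (rule sum.reindex_bij_witness[of _ "\<lambda>p. (block_of ls p, inner_pos ls p)" "\<lambda>(b, i). offset ls b + i"])
      (auto simp: position_of_block block_position)
  then show ?thesis by (simp add: sum.Sigma)
qed

text \<open>
  This extremal property turns the total of all letters of a word into information on each column.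
\<close>

lemma sum_positive_set:
  assumes "finite S" "0 \<notin> S" "card S = l"
  shows "\<Sum>{1..l} \<le> \<Sum>S" "\<Sum>S = \<Sum>{1..l} \<Longrightarrow> S = {1..l::nat}"
proof -
  have "\<Sum>{1..l} \<le> \<Sum>S \<and> (\<Sum>S = \<Sum>{1..l} \<longrightarrow> S = {1..l})"
    using assms
  proof (induction l arbitrary: S)
    case (Suc l)
    have ne: "S \<noteq> {}" using Suc.prems(3) by auto
    let ?m = "Max S" let ?T = "S - {?m}"
    have m: "?m \<in> S" using Suc ne by simp
    have "S \<subseteq> {1..?m}" using Suc.prems by (auto simp: Suc_le_eq intro!: gr0I)
    then have "Suc l \<le> ?m" using Suc.prems card_mono[of "{1..?m}" S] by simp
    moreover have "card ?T = l" using Suc.prems m by simp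
    moreover have "\<Sum>S = ?m + \<Sum>?T" using Suc.prems m by (simp add: sum.remove)
    moreover have "\<Sum>{1..l} \<le> \<Sum>?T \<and> (\<Sum>?T = \<Sum>{1..l} \<longrightarrow> ?T = {1..l})"
      using Suc.prems \<open>card ?T = l\<close> by (intro Suc.IH) auto
    moreover have "\<Sum>{1..Suc l} = Suc l + \<Sum>{1..l}" by simp
    ultimately show ?case
    proof (intro conjI impI)
      assume eq: "\<Sum>S = \<Sum>{1..Suc l}"
      then have "?m = Suc l" "?T = {1..l}" using \<open>Suc l \<le> ?m\<close> \<open>\<Sum>S = ?m + \<Sum>?T\<close>
          \<open>\<Sum>{1..l} \<le> \<Sum>?T \<and> (\<Sum>?T = \<Sum>{1..l} \<longrightarrow> ?T = {1..l})\<close> \<open>\<Sum>{1..Suc l} = Suc l + \<Sum>{1..l}\<close>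
        by linarith+
      then have "S = insert (Suc l) {1..l}" using m by (metis insert_Diff)
      then show "S = {1..Suc l}" by (simp add: atLeastAtMostSuc_conv)
    qed linarith
  qed simp
  then show "\<Sum>{1..l} \<le> \<Sum>S" "\<Sum>S = \<Sum>{1..l} \<Longrightarrow> S = {1..l}" by auto
qed

lemma sum_list_row_word: "sum_list (row_word ls) = (\<Sum>b<length ls. \<Sum>{1..ls ! b})"
proof -
  have "sum_list (row_word ls) = (\<Sum>p<sum_list ls. row_word ls ! p)"
    by (simp add: sum_list_sum_nth atLeast0LessThan length_row_word)
  also have "\<dots> = (\<Sum>b<length ls. \<Sum>i<ls ! b. Suc i)"
    unfolding sum_positions by (intro sum.cong refl) (simp add: nth_row_word position_of_block)
  also have "\<dots> = (\<Sum>b<length ls. \<Sum>{1..ls ! b})"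
    by (rule sum.cong) (simp_all add: sum.atLeast1_atMost_eq)
  finally show ?thesis .
qed

text \<open>
  Distinct positive letters in a column of length l add up to at least \<open>1 + ... + l\<close>. If the grand total
  is that of the row word, no column can exceed its minimum, so each column of length l consists of
  1, ..., l in some order.
\<close>

lemma column_rearrangement:
  assumes "length w = sum_list ls" "0 \<notin> set w" "sum_list w = sum_list (row_word ls)"
    and distinct: "\<And>p q. p < sum_list ls \<Longrightarrow> q < sum_list ls \<Longrightarrow> p \<noteq> q \<Longrightarrow> block_of ls p = block_of ls q
      \<Longrightarrow> w ! p \<noteq> w ! q"
  obtains c where "c \<in> column_group ls" "w = permute_list c (row_word ls)"
proof -
  define S where "S b = (\<lambda>i. w ! (offset ls b + i)) ` {..<ls ! b}" for b
  have inj: "inj_on (\<lambda>i. w ! (offset ls b + i)) {..<ls ! b}" if b: "b < length ls" for b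
  proof (rule inj_onI)
    fix i j assume ij: "i \<in> {..<ls ! b}" "j \<in> {..<ls ! b}" "w ! (offset ls b + i) = w ! (offset ls b + j)"
    then show "i = j" using distinct[of "offset ls b + i" "offset ls b + j"] b by (auto simp: position_of_block)
  qed
  have S: "finite (S b)" "0 \<notin> S b" "card (S b) = ls ! b" if b: "b < length ls" for b
  proof -
    have "w ! (offset ls b + i) \<in> set w" if "i < ls ! b" for i
      using b that assms(1) position_of_block(1) by (intro nth_mem) simp
    then show "0 \<notin> S b" using assms(2) by (auto simp: S_def) (metis)
  qed (auto simp: S_def card_image inj b)
  have "sum_list w = (\<Sum>p<sum_list ls. w ! p)"
    using assms(1) by (simp add: sum_list_sum_nth atLeast0LessThan)
  also have "\<dots> = (\<Sum>b<length ls. \<Sum>(S b))"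
    unfolding sum_positions S_def by (rule sum.cong) (simp_all add: sum.reindex inj)
  finally have total: "(\<Sum>b<length ls. \<Sum>(S b)) = (\<Sum>b<length ls. \<Sum>{1..ls ! b})"
    using assms(3) by (simp add: sum_list_row_word)
  have Sb: "S b = {1..ls ! b}" if b: "b < length ls" for b
  proof -
    have "\<Sum>(S b) = \<Sum>{1..ls ! b}"
    proof (rule ccontr)
      assume "\<Sum>(S b) \<noteq> \<Sum>{1..ls ! b}"
      then have "\<Sum>{1..ls ! b} < \<Sum>(S b)" using sum_positive_set(1)[OF S[OF b]] by simp
      then have "(\<Sum>b<length ls. \<Sum>{1..ls ! b}) < (\<Sum>b<length ls. \<Sum>(S b))"
        using b by (intro sum_strict_mono_ex1 ballI bexI[of _ b]) (simp_all add: sum_positive_set(1)[OF S] del: One_nat_def)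
      then show False using total by simp
    qed
    then show ?thesis using sum_positive_set(2)[OF S[OF b]] by simp
  qed
  \<comment> \<open>The place of the letter \<open>w ! p\<close> in the same column of the row word.\<close>
  define c where "c p = (if p < sum_list ls then offset ls (block_of ls p) + (w ! p - 1) else p)" for p
  have wp: "w ! p \<in> {1..ls ! block_of ls p}" if p: "p < sum_list ls" for p
  proof -
    have "w ! p \<in> S (block_of ls p)"
      unfolding S_def using block_position[OF p] by (intro image_eqI[of _ _ "inner_pos ls p"]) auto
    then show ?thesis using Sb[OF block_position(1)[OF p]] by simp
  qed
  have cp: "c p < sum_list ls" "block_of ls (c p) = block_of ls p" "inner_pos ls (c p) = w ! p - 1"
    if p: "p < sum_list ls" for p
  proof -
    have "w ! p - 1 < ls ! block_of ls p" using wp[OF p] by auto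
    then show "c p < sum_list ls" "block_of ls (c p) = block_of ls p" "inner_pos ls (c p) = w ! p - 1"
      using p block_position(1)[OF p] by (simp_all add: c_def position_of_block)
  qed
  have "c permutes {..<sum_list ls}"
  proof (rule inj_imp_permutes)
    show "inj_on c {..<sum_list ls}"
    proof (rule inj_onI)
      fix p q assume pq: "p \<in> {..<sum_list ls}" "q \<in> {..<sum_list ls}" and eq: "c p = c q"
      then have "block_of ls p = block_of ls q" "w ! p - 1 = w ! q - 1" using cp[of p] cp[of q] by auto
      moreover have "w ! p \<ge> 1" "w ! q \<ge> 1" using wp pq by fastforce+
      ultimately show "p = q" using distinct[of p q] pq by fastforce
    qed
  qed (auto simp: cp, simp add: c_def)
  then have c: "c \<in> column_group ls" by (simp add: column_group_def cp)
  have "w = permute_list c (row_word ls)"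
  proof (rule nth_equalityI)
    fix p assume "p < length w"
    then have p: "p < sum_list ls" using assms by simp
    then show "w ! p = permute_list c (row_word ls) ! p"
      using cp[OF p] wp[OF p] column_group_permutes[OF c] by (simp add: permute_list_nth length_row_word nth_row_word)
  qed (simp add: assms length_row_word)
  with c show ?thesis by (rule that)
qed

definition wedge_vector :: "nat list \<Rightarrow> tens" where
  "wedge_vector ls = column_alt ls (single (row_word ls) 1)"

lemma wedge_vector_eq:
  "wedge_vector ls = (\<Sum>c\<in>column_group ls. single (permute_list c (row_word ls)) (of_int (sign c)))"
  by (simp add: wedge_vector_def column_alt_def tens_act_single)

lemma wedge_vector_tensors: "wedge_vector ls \<in> tensors (sum_list ls)"
  unfolding wedge_vector_eq by (intro tensors_sum tensors_single) (simp add: length_row_word)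

lemma wedge_vector_act:
  "c \<in> column_group ls \<Longrightarrow> tens_act c (wedge_vector ls) = tscale (of_int (sign c)) (wedge_vector ls)"
  unfolding wedge_vector_def by (rule column_alt_absorb) (auto simp: tensors_single length_row_word)

lemma lookup_wedge_vector_row_word: "lookup (wedge_vector ls) (row_word ls) = 1"
proof -
  have id: "id \<in> column_group ls" by (simp add: column_group_def)
  have "lookup (wedge_vector ls) (row_word ls) = (\<Sum>c\<in>column_group ls. if c = id then 1 else 0)"
    unfolding wedge_vector_eq lookup_sum
    by (intro sum.cong refl) (auto simp: lookup_single when_def dest: column_group_row_word_id)
  then show ?thesis using id by (simp add: sum.delta)
qed

lemma lookup_wedge_vector_permute:
  assumes "c \<in> column_group ls"
  shows "lookup (wedge_vector ls) (permute_list c (row_word ls)) = of_int (sign c)"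
proof -
  have "of_int (sign c) * lookup (wedge_vector ls) (permute_list c (row_word ls)) = 1"
    using lookup_tens_act[OF column_group_permutes[OF assms] length_row_word wedge_vector_tensors] assms
    by (simp add: wedge_vector_act lookup_tscale lookup_wedge_vector_row_word)
  then have "of_int (sign c) * (of_int (sign c) * lookup (wedge_vector ls) (permute_list c (row_word ls))) = of_int (sign c)"
    by simp
  then show ?thesis by (simp flip: mult.assoc)
qed

lemma lookup_wedge_vector_int: "\<exists>z. lookup (wedge_vector ls) w = of_int z"
proof -
  have "lookup (wedge_vector ls) w = (\<Sum>c\<in>column_group ls. of_int (if permute_list c (row_word ls) = w then sign c else 0))"
    unfolding wedge_vector_eq lookup_sum by (intro sum.cong refl) (simp add: lookup_single when_def)
  then show ?thesis unfolding of_int_sum[symmetric] by blast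
qed

text \<open>
  Either a letter is repeated in a column and both sides vanish, or the word is a column
  rearrangement of the row word. By linearity the column antisymmetriser becomes the rank one operator
  \<open>v \<mapsto> (v, e) e\<close>, first on words and then on all tensors with such words.
\<close>

lemma column_alt_word:
  assumes "length w = sum_list ls" "0 \<notin> set w" "sum_list w = sum_list (row_word ls)"
  shows "column_alt ls (single w 1) = tscale (lookup (wedge_vector ls) w) (wedge_vector ls)"
proof (cases "\<exists>c\<in>column_group ls. w = permute_list c (row_word ls)")
  case True
  then obtain c where c: "c \<in> column_group ls" "w = permute_list c (row_word ls)" by auto
  have "column_alt ls (tens_act c (single (row_word ls) 1)) = tscale (of_int (sign c)) (wedge_vector ls)"
    unfolding wedge_vector_def by (rule column_alt_absorb(1)[OF c(1)]) (simp add: tensors_single length_row_word)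
  then show ?thesis using c by (simp add: tens_act_single lookup_wedge_vector_permute)
next
  case False
  then have "lookup (wedge_vector ls) w = 0"
    unfolding wedge_vector_eq lookup_sum by (intro sum.neutral) (auto simp: lookup_single when_def)
  moreover obtain p q where "p < sum_list ls" "q < sum_list ls" "p \<noteq> q" "block_of ls p = block_of ls q" "w ! p = w ! q"
    using column_rearrangement[OF assms] False by metis
  ultimately show ?thesis using column_alt_repeated[OF assms(1)] by simp
qed

lemma column_alt_rank_one:
  assumes "\<And>w. w \<in> keys v \<Longrightarrow> length w = sum_list ls \<and> 0 \<notin> set w \<and> sum_list w = sum_list (row_word ls)"
    "\<And>w. lookup v w \<in> range cst"
  shows "column_alt ls v = tscale (form v (wedge_vector ls)) (wedge_vector ls)"
proof (rule additive_eqI[of "column_alt ls" "\<lambda>v. tscale (form v (wedge_vector ls)) (wedge_vector ls)"])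
  fix w assume w: "w \<in> keys v"
  obtain a where a: "lookup v w = cst a" using assms(2)[of w] by auto
  have "column_alt ls (single w (lookup v w)) = tscale (cst a) (column_alt ls (single w 1))"
    using column_alt_cscale[of ls a "single w 1"] by (simp add: a)
  also have "\<dots> = tscale (form (single w (lookup v w)) (wedge_vector ls)) (wedge_vector ls)"
    using assms(1)[OF w] by (simp add: column_alt_word form_single_left a)
  finally show "column_alt ls (single w (lookup v w)) =
    tscale (form (single w (lookup v w)) (wedge_vector ls)) (wedge_vector ls)" .
qed (simp_all add: column_alt_add form_add_left tscale_add_left)

section \<open>The Young diagram\<close>

definition block_sizes :: "nat \<Rightarrow> (nat \<Rightarrow> nat) \<Rightarrow> nat list" where
  "block_sizes n \<xi> = concat (map (\<lambda>l. replicate (mult n \<xi> l) l) [1..<n+2])"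

text \<open>
  The blocks of \<open>e(\<xi>)\<close> are the columns of the Young diagram in the order of increasing length. Hence
  row j occupies the last \<open>\<xi> j\<close> of the \<open>\<xi> 1\<close> columns, as in the right-justified array of the
  definition of \<open>Phi\<close>; \<open>nth_block_sizes\<close> below expresses this.
\<close>

locale young_shape =
  fixes k n :: nat and \<xi> :: "nat \<Rightarrow> nat"
  assumes decreasing: "\<And>i. i \<in> {1..n} \<Longrightarrow> \<xi> (i + 1) \<le> \<xi> i"
    and size: "(\<Sum>i=1..n+1. \<xi> i) = k"
begin

abbreviation "ls \<equiv> block_sizes n \<xi>"
abbreviation "w0 \<equiv> row_word ls"
abbreviation "C \<equiv> column_group ls"
abbreviation "e \<equiv> wedge_vector ls"

lemma \<xi>_le: "1 \<le> i \<Longrightarrow> i \<le> j \<Longrightarrow> j \<le> n + 1 \<Longrightarrow> \<xi> j \<le> \<xi> i"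
proof (induction j rule: nat_induct)
  case (Suc j)
  then show ?case using decreasing[of j] by (cases "i = Suc j") (auto intro: order.trans)
qed simp

lemma length_small_blocks:
  assumes "1 \<le> j" "j \<le> n + 1"
  shows "length (concat (map (\<lambda>l. replicate (mult n \<xi> l) l) [1..<j])) = \<xi> 1 - \<xi> j"
  using assms
proof (induction j rule: nat_induct)
  case (Suc j)
  show ?case
  proof (cases "j = 0")
    case False
    then have "\<xi> (Suc j) \<le> \<xi> j" "\<xi> j \<le> \<xi> 1" using Suc.prems decreasing[of j] \<xi>_le[of 1 j] by auto
    then show ?thesis using Suc False by (simp add: mult_def)
  qed simp
qed simp

lemma evec_eq: "evec n \<xi> = e"
  unfolding evec_def wedge_vector_eq foldr_tensor_wedge[symmetric] block_sizes_def
  by (simp add: map_concat comp_def del: upt_Suc)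

lemma length_block_sizes: "length ls = \<xi> 1"
proof -
  have "[1..<n+2] = [1..<n+1] @ [n+1]" by simp
  then have "length ls = (\<xi> 1 - \<xi> (n+1)) + \<xi> (n+1)"
    unfolding block_sizes_def using length_small_blocks[of "n+1"]
    by (simp add: mult_def del: upt_Suc)
  then show ?thesis using \<xi>_le[of 1 "n+1"] by simp
qed

lemma nth_block_sizes:
  assumes "b < \<xi> 1"
  shows "ls ! b \<in> {1..n+1}" "j \<in> {1..n+1} \<Longrightarrow> j \<le> ls ! b \<longleftrightarrow> \<xi> 1 - \<xi> j \<le> b"
proof -
  have "ls ! b \<in> set ls" using assms by (simp add: length_block_sizes)
  then show "ls ! b \<in> {1..n+1}" by (auto simp: block_sizes_def)
next
  assume j: "j \<in> {1..n+1}"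
  let ?f = "\<lambda>l. replicate (mult n \<xi> l) l"
  have "[1..<n+2] = [1..<j] @ [j..<n+2]"
    using j upt_add_eq_append[of 1 j "n + 2 - j"] by (simp del: upt_Suc)
  then have split: "ls = concat (map ?f [1..<j]) @ concat (map ?f [j..<n+2])"
    unfolding block_sizes_def by (simp del: upt_Suc)
  have len: "length (concat (map ?f [1..<j])) = \<xi> 1 - \<xi> j"
    using j by (intro length_small_blocks) auto
  show "j \<le> ls ! b \<longleftrightarrow> \<xi> 1 - \<xi> j \<le> b"
  proof (cases "\<xi> 1 - \<xi> j \<le> b")
    case True
    let ?u = "concat (map ?f [j..<n+2])"
    have "length ls = length (concat (map ?f [1..<j])) + length ?u" by (simp only: split length_append)
    then have "b - (\<xi> 1 - \<xi> j) < length ?u" using assms True length_block_sizes len by linarith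
    then have "?u ! (b - (\<xi> 1 - \<xi> j)) \<in> set ?u" by (rule nth_mem)
    moreover have "ls ! b = ?u ! (b - (\<xi> 1 - \<xi> j))"
      unfolding split nth_append len using True by (simp del: upt_Suc)
    ultimately have "ls ! b \<in> set ?u" by (simp only:)
    then show ?thesis using True by auto
  next
    case False
    then have "ls ! b \<in> set (concat (map ?f [1..<j]))"
      unfolding split nth_append by (subst if_P) (auto simp only: len intro!: nth_mem)
    then show ?thesis using False by auto
  qed
qed

text \<open>Counting the cells of the diagram by columns or by rows yields the size and the content of \<open>w0\<close>.\<close>

lemma row_length:
  assumes "j \<in> {1..n+1}"
  shows "card {b. b < \<xi> 1 \<and> j \<le> ls ! b} = \<xi> j"
proof -
  have "{b. b < \<xi> 1 \<and> j \<le> ls ! b} = {\<xi> 1 - \<xi> j..<\<xi> 1}"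
    using nth_block_sizes(2)[OF _ assms] by auto
  then show ?thesis using \<xi>_le[of 1 j] assms by simp
qed

lemma sum_block_sizes: "sum_list ls = k"
proof -
  have "sum_list ls = (\<Sum>b<\<xi> 1. ls ! b)"
    by (simp add: sum_list_sum_nth length_block_sizes atLeast0LessThan)
  also have "\<dots> = (\<Sum>b<\<xi> 1. \<Sum>j=1..n+1. if j \<le> ls ! b then 1 else 0)"
  proof (rule sum.cong[OF refl])
    fix b assume "b \<in> {..<\<xi> 1}"
    then have "{1..n+1} \<inter> {j. j \<le> ls ! b} = {1..ls ! b}" using nth_block_sizes(1)[of b] by auto
    then show "ls ! b = (\<Sum>j=1..n+1. if j \<le> ls ! b then 1 else 0)"
      by (simp add: sum.If_cases del: sum.cl_ivl_Suc)
  qed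
  also have "\<dots> = (\<Sum>j=1..n+1. \<Sum>b<\<xi> 1. if j \<le> ls ! b then 1 else 0)" by (rule sum.swap)
  also have "\<dots> = (\<Sum>j=1..n+1. \<xi> j)"
  proof (rule sum.cong[OF refl])
    fix j assume j: "j \<in> {1..n+1}"
    have "{..<\<xi> 1} \<inter> {b. j \<le> ls ! b} = {b. b < \<xi> 1 \<and> j \<le> ls ! b}" by auto
    then show "(\<Sum>b<\<xi> 1. if j \<le> ls ! b then 1 else 0) = \<xi> j"
      using row_length[OF j] by (simp add: sum.If_cases)
  qed
  finally show ?thesis using size by simp
qed

lemma length_w0: "length w0 = k"
  by (simp add: length_row_word sum_block_sizes)

lemma w0_words: "w0 \<in> words k n"
proof -
  have "x \<in> {1..n+1}" if x: "x \<in> set w0" for x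
  proof -
    obtain p where p: "p < sum_list ls" "x = w0 ! p" using x by (auto simp: in_set_conv_nth length_row_word)
    then have "x = Suc (inner_pos ls p)" "inner_pos ls p < ls ! block_of ls p" "block_of ls p < \<xi> 1"
      using block_position[OF p(1)] by (auto simp: nth_row_word length_block_sizes)
    then show ?thesis using nth_block_sizes(1)[of "block_of ls p"] by auto
  qed
  then show ?thesis by (auto simp: words_def length_w0)
qed

lemma count_w0:
  assumes "j \<in> {1..n+1}"
  shows "count_list w0 j = \<xi> j"
proof -
  have "count_list w0 j = (\<Sum>l\<leftarrow>ls. if j \<le> l then 1 else 0)" 
  proof -
    have "count_list (concat xss) j = (\<Sum>xs\<leftarrow>xss. count_list xs j)" for xss
      by (induction xss) auto
    moreover have "count_list [1..<l+1] j = (if j \<le> l then 1 else 0)" for l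
      using assms by (induction l) auto
    ultimately show ?thesis by (simp add: row_word_def comp_def del: upt_Suc)
  qed
  also have "\<dots> = (\<Sum>b<\<xi> 1. if j \<le> ls ! b then 1 else 0)"
    by (simp add: sum_list_sum_nth length_block_sizes atLeast0LessThan)
  also have "\<dots> = \<xi> j"
  proof -
    have "{..<\<xi> 1} \<inter> {b. j \<le> ls ! b} = {b. b < \<xi> 1 \<and> j \<le> ls ! b}" by auto
    then show ?thesis using row_length[OF assms] by (simp add: sum.If_cases)
  qed
  finally show ?thesis .
qed

lemma C_permutes: "c \<in> C \<Longrightarrow> c permutes {..<k}"
  using column_group_permutes[of c ls] by (simp add: sum_block_sizes)

lemma e_tensors: "e \<in> tensors k"
  using wedge_vector_tensors[of ls] by (simp add: sum_block_sizes)

lemma e_Vpow: "e \<in> Vpow k n"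
proof -
  have "single (permute_list c w0) (of_int (sign c)) \<in> Vpow k n" if "c \<in> C" for c
    using Vpow_single[OF words_permute[OF C_permutes[OF that] w0_words], of "of_int (sign c)"]
    by (simp add: cst_of_int)
  then show ?thesis unfolding wedge_vector_eq by (intro Vpow_sum)
qed

lemma keys_e: "w \<in> keys e \<Longrightarrow> \<exists>c\<in>C. w = permute_list c w0"
  using keys_sum[of "\<lambda>c. single (permute_list c w0) (of_int (sign c))" C] unfolding wedge_vector_eq
  by (auto split: if_splits)

section \<open>The vector e is a highest weight vector\<close>

text \<open>
  A raising operator changes one letter of the row word into a smaller one, which already occurs in
  the same column, so the antisymmetriser kills the result.
\<close>

lemma e_hw: "is_hw n \<xi> e"
  unfolding is_hw_def
proof (intro conjI allI impI ballI)
  fix x assume x: "strictly_upper x"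
  have "lie_act n x e = (\<Sum>c\<in>C. tscale (of_int (sign c)) (tens_act c (lie_act n x (single w0 1))))"
    unfolding wedge_vector_def column_alt_def lie_act_sum lie_act_tscale
    by (rule sum.cong) (auto simp: lie_act_tens_act[OF C_permutes] tensors_single length_w0)
  also have "\<dots> = column_alt ls (lie_act n x (single w0 1))"
    by (simp add: column_alt_def)
  also have "\<dots> = (\<Sum>s<k. \<Sum>a=1..n+1. column_alt ls (single (w0[s := a]) (cst (x a (w0 ! s)))))"
    by (simp add: lie_act_single lie_word_def length_w0 column_alt_sum del: sum.cl_ivl_Suc)
  also have "\<dots> = 0"
  proof (intro sum.neutral ballI)
    fix s a assume s: "s \<in> {..<k}" and a: "a \<in> {1..n+1}"
    show "column_alt ls (single (w0[s := a]) (cst (x a (w0 ! s)))) = 0"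
    proof (cases "a < w0 ! s")
      case False
      then show ?thesis using x by (simp add: strictly_upper_def column_alt_def tens_act_def)
    next
      case True
      have s': "s < sum_list ls" using s by (simp add: sum_block_sizes)
      let ?b = "block_of ls s" let ?q = "offset ls ?b + (a - 1)"
      have "a - 1 < inner_pos ls s" using True a nth_row_word[OF s'] by (cases a) auto
      then have q: "?q < sum_list ls" "block_of ls ?q = ?b" "inner_pos ls ?q = a - 1" "s \<noteq> ?q"
        using block_position[OF s'] position_of_block[of ?b ls "a - 1"] by auto
      have "w0 ! ?q = a" using nth_row_word[OF q(1)] q(3) a by simp
      then have "column_alt ls (single (w0[s := a]) 1) = 0"
        using q s' by (intro column_alt_repeated[of _ _ s ?q]) (simp_all add: length_row_word)
      then show ?thesis
        using column_alt_cscale[of ls "x a (w0 ! s)" "single (w0[s := a]) 1"] by simp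
    qed
  qed
  finally show "lie_act n x e = 0" .
next
  fix i assume i: "i \<in> {1..n}"
  show "lie_act n (cartan i) e = cscale (of_nat (\<xi> i) - of_nat (\<xi> (i + 1))) e"
  proof (rule additive_eqI[of "lie_act n (cartan i)"])
    fix w assume "w \<in> keys e"
    then obtain c where c: "c \<in> C" "w = permute_list c w0" using keys_e by blast
    have "mset w = mset w0" using c C_permutes by (simp add: length_w0)
    then have "count_list w j = count_list w0 j" for j by (metis count_mset)
    moreover have "w \<in> words k n" using c C_permutes w0_words words_permute by auto
    ultimately show "lie_act n (cartan i) (single w (lookup e w)) =
        cscale (of_nat (\<xi> i) - of_nat (\<xi> (i + 1))) (single w (lookup e w))"
      using i by (subst lie_act_cartan_single) (auto simp: words_def cscale_def count_w0)
  qed (simp_all add: lie_act_add cscale_def tscale_add)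
qed

abbreviation "H \<equiv> highest_weight n \<xi> (Vpow k n)"
abbreviation "WH \<equiv> highest_weight n \<xi> (W k n)"

lemma e_H: "e \<in> H"
  using e_hw e_Vpow by (simp add: highest_weight_eq)

lemma H_act: "\<tau> permutes {..<k} \<Longrightarrow> h \<in> H \<Longrightarrow> tens_act \<tau> h \<in> H"
  using Vpow_VA[of k n] by (auto simp: highest_weight_eq intro!: Vpow_act is_hw_tens_act VA_tensors)

lemma H_add: "h \<in> H \<Longrightarrow> h' \<in> H \<Longrightarrow> h + h' \<in> H"
  by (auto simp: highest_weight_eq intro: Vpow_add is_hw_add)
lemma H_sum: "(\<And>i. i \<in> I \<Longrightarrow> h i \<in> H) \<Longrightarrow> (\<Sum>i\<in>I. h i) \<in> H"
  by (auto simp: highest_weight_eq intro!: Vpow_sum is_hw_sum)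
lemma H_cscale: "h \<in> H \<Longrightarrow> tscale (cst a) h \<in> H"
  by (auto simp: highest_weight_eq intro: Vpow_cscale is_hw_tscale)
lemma H_VA: "h \<in> H \<Longrightarrow> h \<in> VA k n"
  using Vpow_VA by (auto simp: highest_weight_eq)
lemma H_tensors: "h \<in> H \<Longrightarrow> h \<in> tensors k"
  using H_VA VA_tensors by auto
lemma H_form_const: "h \<in> H \<Longrightarrow> h' \<in> H \<Longrightarrow> \<exists>a. form h h' = cst a"
proof -
  assume "h \<in> H" "h' \<in> H"
  then have "\<exists>a. lookup h w = cst a" "\<exists>a. lookup h' w = cst a" for w
    by (auto simp: highest_weight_eq Vpow_def)
  then obtain f g where "lookup h w = cst (f w)" "lookup h' w = cst (g w)" for w by metis
  then have "form h h' = cst (\<Sum>w\<in>keys h. f w * g w)" by (simp add: form_def cst_sum cst_mult)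
  then show ?thesis by blast
qed

text \<open>The differences of the weight and the degree determine the numbers of the letters.\<close>

lemma weight_content:
  assumes "is_hw n \<xi> u" "u \<in> VA k n" "w \<in> keys u"
  shows "sum_list w = sum_list w0"
proof -
  have w: "w \<in> words k n" using assms by (auto simp: VA_def)
  have diff: "int (count_list w i) - int (\<xi> i) = int (count_list w (i + 1)) - int (\<xi> (i + 1))"
    if i: "i \<in> {1..n}" for i
  proof -
    let ?g = "\<lambda>v. of_nat (count_list v i) - of_nat (count_list v (i + 1)) :: complex"
    have "lookup (lie_act n (cartan i) u) w = cst (?g w) * lookup u w"
    proof (rule additive_eqI[of "\<lambda>u. lookup (lie_act n (cartan i) u) w"])
      fix v assume "v \<in> keys u"
      then have "set v \<subseteq> {1..n+1}" using assms(2) by (auto simp: VA_def words_def)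
      then show "lookup (lie_act n (cartan i) (single v (lookup u v))) w = cst (?g w) * lookup (single v (lookup u v)) w"
        using i by (simp add: lie_act_cartan_single lookup_single when_def)
    qed (simp_all add: lie_act_add lookup_add distrib_left)
    also have "lie_act n (cartan i) u = tscale (cst (of_nat (\<xi> i) - of_nat (\<xi> (i + 1)))) u"
      using assms(1) i by (simp add: is_hw_def cscale_def)
    finally have "cst (?g w) = cst (of_nat (\<xi> i) - of_nat (\<xi> (i + 1)))"
      using assms(3) by (simp add: lookup_tscale in_keys_iff)
    then have "?g w = of_nat (\<xi> i) - of_nat (\<xi> (i + 1))" by simp
    then have "(of_int (int (count_list w i) - int (count_list w (i + 1))) :: complex) = of_int (int (\<xi> i) - int (\<xi> (i + 1)))"
      by simp
    then show ?thesis unfolding of_int_eq_iff by simp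
  qed
  let ?D = "\<lambda>j. int (count_list w j) - int (\<xi> j)"
  \<comment> \<open>The excess \<open>?D\<close> of a letter is the same for all letters, and adds up to 0.\<close>
  have step: "?D (Suc j) = ?D 1" if "Suc j \<le> n + 1" for j
    using that
  proof (induction j)
    case (Suc j)
    then have "?D (Suc (Suc j)) = ?D (Suc j)" using diff[of "Suc j"] by simp
    then show ?case using Suc by simp
  qed simp
  have D: "?D j = ?D 1" if "j \<in> {1..n+1}" for j
    using step[of "j - 1"] that by (auto simp: Suc_diff_1)
  have "(\<Sum>j=1..n+1. ?D j) = int (\<Sum>j=1..n+1. count_list w j) - int (\<Sum>j=1..n+1. \<xi> j)"
    by (simp only: sum_subtractf of_nat_sum)
  also have "(\<Sum>j=1..n+1. count_list w j) = k"
    using w by (subst sum_count_set) (auto simp: words_def)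
  finally have "(\<Sum>j=1..n+1. ?D j) = 0" by (simp only: size diff_self)
  moreover have "(\<Sum>j=1..n+1. ?D j) = (\<Sum>j=1..n+1. ?D 1)"
    by (rule sum.cong[OF refl]) (rule D)
  ultimately have "int (n + 1) * ?D 1 = 0" by simp
  then have "?D 1 = 0" by simp
  then have count: "count_list w j = count_list w0 j" if "j \<in> {1..n+1}" for j
    using D[OF that] count_w0[OF that] by simp
  have "sum_list v = (\<Sum>j=1..n+1. count_list v j * j)" if "v \<in> words k n" for v
    using sum_list_map_eq_sum_count2[of v "{1..n+1}" "\<lambda>j. j"] that by (simp add: words_def)
  then show ?thesis using w w0_words count by simp
qed

text \<open>The rank one formula, from which irreducibility and multiplicity statements about \<open>H\<close> follow.\<close>

lemma column_alt_H:
  assumes "h \<in> H"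
  shows "column_alt ls h = tscale (form h e) e"
proof (rule column_alt_rank_one)
  fix w assume w: "w \<in> keys h"
  then have "w \<in> words k n" using assms by (auto simp: highest_weight_eq Vpow_def)
  moreover have "sum_list w = sum_list w0"
    using assms w by (intro weight_content[of h]) (auto simp: highest_weight_eq Vpow_VA[THEN subsetD])
  ultimately show "length w = sum_list ls \<and> 0 \<notin> set w \<and> sum_list w = sum_list w0"
    by (auto simp: words_def sum_block_sizes)
qed (use assms in \<open>auto simp: highest_weight_eq Vpow_def\<close>)

section \<open>Averaging over the symmetric group\<close>

abbreviation "S \<equiv> {\<tau>. \<tau> permutes {..<k}}"
abbreviation "et \<tau> \<equiv> tens_act \<tau> e"

lemma finite_S [simp]: "finite S" by (rule finite_permutations) simp

lemma sum_S_right: "\<tau> permutes {..<k} \<Longrightarrow> (\<Sum>\<sigma>\<in>S. F (\<sigma> \<circ> \<tau>)) = (\<Sum>\<sigma>\<in>S. F \<sigma>)"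
  by (rule sum_permutations_compose_right[symmetric])

lemma et_tensors: "et \<tau> \<in> tensors k" by (rule tensors_act) (rule e_tensors)
lemma et_H: "\<tau> permutes {..<k} \<Longrightarrow> et \<tau> \<in> H" by (rule H_act[OF _ e_H])
lemma act_et: "\<tau> permutes {..<k} \<Longrightarrow> \<sigma> permutes {..<k} \<Longrightarrow> tens_act \<tau> (et \<sigma>) = et (\<sigma> \<circ> \<tau>)"
  by (rule tens_act_comp) (auto simp: e_tensors)

text \<open>
  Up to a scalar, this turns out to be the orthogonal projection onto \<open>H\<close>, extended to polynomial
  coefficients. It recovers a highest weight vector u explicitly from the values \<open>\<langle>u, e\<sigma>\<rangle>\<close>.
\<close>

definition frame :: "tens \<Rightarrow> tens" where
  "frame u = (\<Sum>\<sigma>\<in>S. tscale (form u (et \<sigma>)) (et \<sigma>))"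

lemma frame_add: "frame (u + v) = frame u + frame v"
  by (simp add: frame_def form_add_left tscale_add_left sum.distrib)
lemma frame_sum: "frame (\<Sum>i\<in>I. u i) = (\<Sum>i\<in>I. frame (u i))"
  by (rule additive_sum) (rule frame_add)
lemma frame_tscale: "frame (tscale a u) = tscale a (frame u)"
  by (simp add: frame_def form_tscale_left tscale_sum)

lemma frame_act:
  assumes "\<tau> permutes {..<k}" "u \<in> tensors k"
  shows "frame (tens_act \<tau> u) = tens_act \<tau> (frame u)"
proof -
  have "frame (tens_act \<tau> u) = (\<Sum>\<sigma>\<in>S. tscale (form (tens_act \<tau> u) (et (\<sigma> \<circ> \<tau>))) (et (\<sigma> \<circ> \<tau>)))"
    unfolding frame_def by (rule sum_S_right[OF assms(1), symmetric])
  also have "\<dots> = tens_act \<tau> (frame u)"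
    unfolding frame_def tens_act_sum tens_act_tscale
    by (rule sum.cong) (use assms in \<open>auto simp: act_et form_tens_act[OF assms(1) assms(2) et_tensors, symmetric]\<close>)
  finally show ?thesis .
qed

lemma frame_H: "h \<in> H \<Longrightarrow> frame h \<in> H"
proof -
  assume h: "h \<in> H"
  have "tscale (form h (et \<sigma>)) (et \<sigma>) \<in> H" if "\<sigma> permutes {..<k}" for \<sigma>
    using H_form_const[OF h et_H[OF that]] H_cscale[OF et_H[OF that]] by auto
  then show ?thesis unfolding frame_def by (intro H_sum) auto
qed

text \<open>Integrality makes the sum of the squares \<open>(e, e\<sigma>)\<^sup>2\<close>, a positive multiple of the eigenvalue of e, positive.\<close>

lemma form_e_int: "\<exists>z. form e (et \<sigma>) = of_int z" if \<sigma>: "\<sigma> permutes {..<k}"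
proof -
  have "\<exists>z. lookup (et \<sigma>) w = of_int z" for w
  proof -
    obtain f where f: "\<And>w. lookup e w = of_int (f w)" using lookup_wedge_vector_int by metis
    have "lookup (et \<sigma>) w = (\<Sum>v\<in>keys e. of_int (if permute_list \<sigma> v = w then f v else 0))"
      unfolding tens_act_def lookup_sum
      by (rule sum.cong) (simp_all add: f lookup_single when_def)
    then show ?thesis unfolding of_int_sum[symmetric] by blast
  qed
  then obtain f g where "\<And>w. lookup (et \<sigma>) w = of_int (f w)" "\<And>w. lookup e w = of_int (g w)"
    using lookup_wedge_vector_int by metis
  then have "form e (et \<sigma>) = of_int (\<Sum>w\<in>keys e. g w * f w)" by (simp add: form_def)
  then show ?thesis by blast
qed

lemma form_e_e: "\<exists>z>0. form e e = of_int z"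
proof -
  obtain g where g: "\<And>w. lookup e w = of_int (g w)" using lookup_wedge_vector_int by metis
  have "form e e = of_int (\<Sum>w\<in>keys e. g w * g w)" by (simp add: form_def g)
  moreover have "w0 \<in> keys e" by (simp add: in_keys_iff lookup_wedge_vector_row_word)
  moreover have "g w0 = 1"
  proof -
    have "(of_int (g w0) :: cpoly) = of_int 1" using lookup_wedge_vector_row_word[of ls] g[of w0] by simp
    then show ?thesis by (simp only: of_int_eq_iff)
  qed
  ultimately show ?thesis by (intro exI[of _ "\<Sum>w\<in>keys e. g w * g w"] conjI sum_pos2[of _ w0]) auto
qed

text \<open>
  The operator \<open>frame\<close> commutes with \<open>S_k\<close>, and \<open>e\<close> is multiplied by \<open>sgn c\<close> under each column
  permutation c. Therefore the antisymmetriser multiplies \<open>frame e\<close> by the order of the column group;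
  by the rank one formula it also maps it to a multiple of \<open>e\<close>.
\<close>

lemma frame_e: "\<exists>c. c \<noteq> 0 \<and> frame e = tscale (cst c) e"
proof -
  have "id \<in> C" by (simp add: column_group_def)
  then have C0: "card C > 0" using finite_column_group[of ls] card_gt_0_iff by blast
  have "tscale (of_nat (card C)) (frame e) = column_alt ls (frame e)"
  proof -
    have "column_alt ls (frame e) = (\<Sum>c\<in>C. frame e)"
      unfolding column_alt_def
      by (rule sum.cong)
        (auto simp: frame_act[OF C_permutes e_tensors, symmetric] wedge_vector_act frame_tscale)
    also have "\<dots> = (\<Sum>c\<in>C. tscale 1 (frame e))" by simp
    also have "\<dots> = tscale (of_nat (card C)) (frame e)" by (simp only: tscale_sum_left[symmetric]) simp
    finally show ?thesis ..
  qed
  also have "\<dots> = tscale (form (frame e) e) e" by (rule column_alt_H) (rule frame_H, rule e_H)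
  finally have 1: "tscale (of_nat (card C)) (frame e) = tscale (form (frame e) e) e" .
  obtain z where z: "\<And>\<sigma>. \<sigma> \<in> S \<Longrightarrow> form e (et \<sigma>) = of_int (z \<sigma>)" using form_e_int by (metis mem_Collect_eq)
  have "form (frame e) e = of_int (\<Sum>\<sigma>\<in>S. z \<sigma> * z \<sigma>)"
    by (simp add: frame_def form_sum_left form_tscale_left form_commute[of "et _" e] z)
  moreover have "(\<Sum>\<sigma>\<in>S. z \<sigma> * z \<sigma>) > 0"
  proof -
    obtain z1 where z1: "z1 > 0" "form e e = of_int z1" using form_e_e by auto
    have id: "id \<in> S" by (simp add: permutes_id)
    then have "(of_int (z id) :: cpoly) = of_int z1" using z[of id] z1 by simp
    then have "z id = z1" by (simp only: of_int_eq_iff)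
    then show ?thesis using z1 id by (intro sum_pos2[of _ id]) auto
  qed
  ultimately obtain N where N: "form (frame e) e = of_int N" "N > 0" by blast
  have "C \<noteq> {}" using \<open>id \<in> C\<close> by auto
  then have "frame e = tscale (cst (1 / of_nat (card C))) (tscale (of_nat (card C)) (frame e))"
    using C0 by (simp add: cst_mult[symmetric] cst_of_nat[symmetric] cst_1)
  also have "\<dots> = tscale (cst (of_int N / of_nat (card C))) e"
    unfolding 1 N by (simp add: cst_mult[symmetric] cst_of_int[symmetric])
  finally show ?thesis using N C0 by (intro exI[of _ "of_int N / of_nat (card C)"]) auto
qed

end

section \<open>Polynomials symmetric in part of the variables\<close>

text \<open>
  The subring generated by the symmetric polynomials and the polynomials in the variables outside X.
\<close>

inductive_set mixed :: "nat \<Rightarrow> nat set \<Rightarrow> cpoly set" for k X where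
  mixed_mult: "a \<in> sym_polys k \<Longrightarrow> b \<in> polys_on ({..<k} - X) \<Longrightarrow> a * b \<in> mixed k X"
| mixed_add: "f \<in> mixed k X \<Longrightarrow> g \<in> mixed k X \<Longrightarrow> f + g \<in> mixed k X"

lemma mixed_sym: "a \<in> sym_polys k \<Longrightarrow> a \<in> mixed k X"
  using mixed_mult[of a k 1 X] by simp

lemma mixed_polys_on: "b \<in> polys_on ({..<k} - X) \<Longrightarrow> b \<in> mixed k X"
  using mixed_mult[of 1 k b X] sym_polys_cst[of 1 k] by (simp add: cst_1)

lemma mixed_times:
  assumes "f \<in> mixed k X" "g \<in> mixed k X"
  shows "f * g \<in> mixed k X"
  using assms
proof (induction f)
  case (mixed_mult a b)
  from mixed_mult(3) show ?case
  proof (induction g)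
    case (mixed_mult a' b')
    have "a * b * (a' * b') = (a * a') * (b * b')" by (simp add: mult_ac)
    moreover have "a * a' \<in> sym_polys k" "b * b' \<in> polys_on ({..<k} - X)"
      using mixed_mult \<open>a \<in> sym_polys k\<close> \<open>b \<in> polys_on ({..<k} - X)\<close> by (auto intro: sym_polys_mult polys_on_mult)
    ultimately show ?case by (metis mixed.mixed_mult)
  qed (simp add: distrib_left mixed_add)
qed (simp add: distrib_right mixed_add)

lemma mixed_cst [simp]: "cst c \<in> mixed k X" by (rule mixed_sym) simp
lemma mixed_0 [simp]: "0 \<in> mixed k X" using mixed_cst[of 0] by (simp del: mixed_cst)
lemma mixed_1 [simp]: "1 \<in> mixed k X" using mixed_cst[of 1] by (simp del: mixed_cst add: cst_1)
lemma mixed_uminus: "f \<in> mixed k X \<Longrightarrow> - f \<in> mixed k X"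
  using mixed_times[OF mixed_cst[of "-1"], of f k X] by (simp add: cst_uminus cst_1)
lemma mixed_diff: "f \<in> mixed k X \<Longrightarrow> g \<in> mixed k X \<Longrightarrow> f - g \<in> mixed k X"
  using mixed_add[of f k X "- g"] mixed_uminus[of g k X] by simp
lemma mixed_sum: "(\<And>i. i \<in> I \<Longrightarrow> f i \<in> mixed k X) \<Longrightarrow> (\<Sum>i\<in>I. f i) \<in> mixed k X"
  by (induction I rule: infinite_finite_induct) (auto intro: mixed_add)

lemma poly_act_var_power_sum:
  assumes "\<sigma> permutes X"
  shows "poly_act \<sigma> (\<Sum>i\<in>X. var i ^ a) = (\<Sum>i\<in>X. var i ^ a)"
  unfolding poly_act_sum poly_act_power poly_act_var
  by (rule sum.permute[OF permutes_inv[OF assms], of "\<lambda>i. var i ^ a", unfolded comp_def, symmetric])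

text \<open>A power sum over part of the variables is a symmetric power sum minus the rest.\<close>

lemma power_sum_mixed:
  assumes "X \<subseteq> {..<k}"
  shows "(\<Sum>i\<in>X. var i ^ a) \<in> mixed k X"
proof -
  have "(\<Sum>i<k. var i ^ a) = (\<Sum>i\<in>{..<k} - X. var i ^ a) + (\<Sum>i\<in>X. var i ^ a)"
    using assms by (intro sum.subset_diff) auto
  then have eq: "(\<Sum>i\<in>X. var i ^ a) = (\<Sum>i<k. var i ^ a) - (\<Sum>i\<in>{..<k} - X. var i ^ a)" by simp
  have "(\<Sum>i<k. var i ^ a) \<in> sym_polys k"
    by (auto simp: sym_polys_def poly_act_var_power_sum polys_eq intro!: polys_on_intros)
  moreover have "(\<Sum>i\<in>{..<k} - X. var i ^ a) \<in> polys_on ({..<k} - X)"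
    by (intro polys_on_intros)
  ultimately show ?thesis unfolding eq by (intro mixed_diff mixed_sym mixed_polys_on)
qed

definition injections :: "nat set \<Rightarrow> nat set \<Rightarrow> (nat \<Rightarrow> nat) set" where
  "injections T X = {f \<in> T \<rightarrow>\<^sub>E X. inj_on f T}"

lemma finite_injections: "finite T \<Longrightarrow> finite X \<Longrightarrow> finite (injections T X)"
  unfolding injections_def by (rule finite_subset[OF _ finite_PiE[of T "\<lambda>_. X"]]) auto

text \<open>
  The sums over injections are the augmented monomial symmetric functions, and this recursion expresses
  them by power sums: an injection of \<open>insert j T\<close> is an injection of T with a further value, and the
  product with a power sum counts also the values already taken, which amounts to adding two exponents.
\<close>

lemma injection_sum_insert:
  assumes "finite T" "finite X" "j \<notin> T"
  shows "(\<Sum>f\<in>injections (insert j T) X. \<Prod>i\<in>insert j T. var (f i) ^ a i) =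
    (\<Sum>x\<in>X. var x ^ a j) * (\<Sum>f\<in>injections T X. \<Prod>i\<in>T. var (f i) ^ a i) -
    (\<Sum>s\<in>T. \<Sum>f\<in>injections T X. \<Prod>i\<in>T. var (f i) ^ (a(s := a s + a j)) i)"
proof -
  let ?F = "\<lambda>f. \<Prod>i\<in>T. var (f i) ^ a i"
  have "(\<Sum>f\<in>injections (insert j T) X. \<Prod>i\<in>insert j T. var (f i) ^ a i) =
    (\<Sum>(f, x)\<in>(SIGMA f:injections T X. X - f ` T). ?F f * var x ^ a j)"
  proof (rule sum.reindex_bij_witness[of _ "\<lambda>(f, x). f(j := x)" "\<lambda>f. (f(j := undefined), f j)"])
    fix f assume f: "f \<in> injections (insert j T) X"
    then show "(case (f(j := undefined), f j) of (f, x) \<Rightarrow> f(j := x)) = f" by simp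
    have "f j \<notin> f ` T" using f assms by (auto simp: injections_def)
    moreover have restrict: "f(j := undefined) \<in> injections T X" "(f(j := undefined)) ` T = f ` T"
    proof -
      have "inj_on (f(j := undefined)) T" using f assms by (subst inj_on_cong[of T _ f]) (auto simp: injections_def)
      moreover have "f(j := undefined) \<in> T \<rightarrow>\<^sub>E X"
      proof (rule PiE_I)
        fix i
        have f: "f \<in> insert j T \<rightarrow>\<^sub>E X" using f by (simp add: injections_def)
        show "(f(j := undefined)) i \<in> X" if "i \<in> T"
          using PiE_mem[OF f, of i] that assms(3) by (simp split: if_splits) metis
        show "(f(j := undefined)) i = undefined" if "i \<notin> T"
          using PiE_arb[OF f, of i] that by simp
      qed
      ultimately show "f(j := undefined) \<in> injections T X" by (simp add: injections_def)
      show "(f(j := undefined)) ` T = f ` T" using assms by (intro image_cong) auto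
    qed
    ultimately show "(f(j := undefined), f j) \<in> (SIGMA f:injections T X. X - f ` T)"
      using restrict assms f by (auto simp: injections_def)
    have "(\<Prod>i\<in>T. var ((f(j := undefined)) i) ^ a i) = (\<Prod>i\<in>T. var (f i) ^ a i)"
      using assms by (intro prod.cong) auto
    then show "(case (f(j := undefined), f j) of (f, x) \<Rightarrow> ?F f * var x ^ a j) = (\<Prod>i\<in>insert j T. var (f i) ^ a i)"
      using assms by (simp add: mult.commute)
  next
    fix y assume "y \<in> (SIGMA f:injections T X. X - f ` T)"
    then obtain f x where y: "y = (f, x)" "f \<in> injections T X" "x \<in> X" "x \<notin> f ` T" by auto
    have "f j = undefined" using y assms by (auto simp: injections_def PiE_def extensional_def)
    then show "((case y of (f, x) \<Rightarrow> f(j := x))(j := undefined), (case y of (f, x) \<Rightarrow> f(j := x)) j) = y"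
      by (auto simp: y fun_eq_iff)
    have "f \<in> T \<rightarrow>\<^sub>E X" "inj_on f T" using y by (auto simp: injections_def)
    moreover have "inj_on (f(j := x)) T" using \<open>inj_on f T\<close> assms by (subst inj_on_cong[of T _ f]) auto
    moreover have "(f(j := x)) ` T = f ` T" using assms by (intro image_cong) auto
    ultimately show "(case y of (f, x) \<Rightarrow> f(j := x)) \<in> injections (insert j T) X"
      using y assms(3) by (auto simp: injections_def PiE_fun_upd)
  qed
  also have "\<dots> = (\<Sum>f\<in>injections T X. \<Sum>x\<in>X - f ` T. ?F f * var x ^ a j)"
    using assms by (intro sum.Sigma[symmetric]) (auto intro: finite_injections)
  also have "\<dots> = (\<Sum>f\<in>injections T X. ?F f * (\<Sum>x\<in>X. var x ^ a j) - (\<Sum>s\<in>T. ?F f * var (f s) ^ a j))"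
  proof (rule sum.cong[OF refl])
    fix f assume f: "f \<in> injections T X"
    then have sub: "f ` T \<subseteq> X" and inj: "inj_on f T" by (auto simp: injections_def)
    have "(\<Sum>x\<in>X. var x ^ a j) = (\<Sum>x\<in>X - f ` T. var x ^ a j) + (\<Sum>x\<in>f ` T. var x ^ a j)"
      by (rule sum.subset_diff[OF sub assms(2)])
    also have "(\<Sum>x\<in>f ` T. var x ^ a j) = (\<Sum>s\<in>T. var (f s) ^ a j)" by (simp add: sum.reindex[OF inj])
    finally show "(\<Sum>x\<in>X - f ` T. ?F f * var x ^ a j) =
        ?F f * (\<Sum>x\<in>X. var x ^ a j) - (\<Sum>s\<in>T. ?F f * var (f s) ^ a j)"
      by (simp add: sum_distrib_left[symmetric] distrib_left)
  qed
  also have "\<dots> = (\<Sum>x\<in>X. var x ^ a j) * (\<Sum>f\<in>injections T X. ?F f) -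
      (\<Sum>s\<in>T. \<Sum>f\<in>injections T X. ?F f * var (f s) ^ a j)"
    unfolding sum_subtractf sum_distrib_right[symmetric]
    by (subst (2) sum.swap) (simp add: sum_distrib_left mult.commute)
  also have "(\<Sum>s\<in>T. \<Sum>f\<in>injections T X. ?F f * var (f s) ^ a j) =
      (\<Sum>s\<in>T. \<Sum>f\<in>injections T X. \<Prod>i\<in>T. var (f i) ^ (a(s := a s + a j)) i)"
  proof (intro sum.cong refl)
    fix s f assume s: "s \<in> T"
    have "(\<Prod>i\<in>T. var (f i) ^ (a(s := a s + a j)) i) = (\<Prod>i\<in>T. var (f i) ^ a i * (if i = s then var (f s) ^ a j else 1))"
      by (intro prod.cong) (auto simp: power_add)
    also have "\<dots> = ?F f * var (f s) ^ a j"
      using s assms(1) by (simp add: prod.distrib prod.delta)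
    finally show "?F f * var (f s) ^ a j = (\<Prod>i\<in>T. var (f i) ^ (a(s := a s + a j)) i)" ..
  qed
  finally show ?thesis .
qed

lemma injection_sum_mixed:
  assumes "finite T" "X \<subseteq> {..<k}"
  shows "(\<Sum>f\<in>injections T X. \<Prod>i\<in>T. var (f i) ^ a i) \<in> mixed k X"
  using assms(1)
proof (induction T arbitrary: a)
  case empty
  have "injections {} X = {\<lambda>_. undefined}" by (auto simp: injections_def)
  then show ?case by simp
next
  case (insert j T)
  have "finite X" using assms(2) finite_subset by blast
  then show ?case
    unfolding injection_sum_insert[OF insert.hyps(1) \<open>finite X\<close> insert.hyps(2)]
    by (intro mixed_diff mixed_times mixed_sum power_sum_mixed insert.IH assms)
qed

text \<open>
  A polynomial symmetric in the variables in X is a combination of averages of monomials over the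
  permutations of X. Averaging a monomial leaves the variables outside X alone and gives a sum over injections, which
  the power sums in X generate.
\<close>

lemma symmetric_mixed:
  assumes X: "X \<subseteq> {..<k}" and g: "g \<in> polys k" and inv: "\<And>\<rho>. \<rho> permutes X \<Longrightarrow> poly_act \<rho> g = g"
  shows "g \<in> mixed k X"
proof -
  let ?P = "{\<rho>. \<rho> permutes X}"
  have fin: "finite X" using X finite_subset by blast
  then have finP: "finite ?P" by (rule finite_permutations)
  have sym: "(\<Sum>\<rho>\<in>?P. poly_act \<rho> (\<Prod>i<k. var i ^ a i)) \<in> mixed k X" for a
  proof -
    have "poly_act \<rho> (\<Prod>i<k. var i ^ a i) = (\<Prod>i\<in>{..<k} - X. var i ^ a i) * (\<Prod>i\<in>X. var (inv \<rho> i) ^ a i)"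
      if \<rho>: "\<rho> permutes X" for \<rho>
    proof -
      have "poly_act \<rho> (\<Prod>i<k. var i ^ a i) = (\<Prod>i<k. var (inv \<rho> i) ^ a i)"
        by (simp add: poly_act_prod poly_act_power poly_act_var)
      also have "\<dots> = (\<Prod>i\<in>{..<k} - X. var (inv \<rho> i) ^ a i) * (\<Prod>i\<in>X. var (inv \<rho> i) ^ a i)"
        using X by (intro prod.subset_diff) auto
      also have "(\<Prod>i\<in>{..<k} - X. var (inv \<rho> i) ^ a i) = (\<Prod>i\<in>{..<k} - X. var i ^ a i)"
        using permutes_inv[OF \<rho>] by (intro prod.cong) (auto simp: permutes_not_in)
      finally show ?thesis .
    qed
    then have "(\<Sum>\<rho>\<in>?P. poly_act \<rho> (\<Prod>i<k. var i ^ a i)) =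
      (\<Prod>i\<in>{..<k} - X. var i ^ a i) * (\<Sum>\<rho>\<in>?P. \<Prod>i\<in>X. var (inv \<rho> i) ^ a i)"
      by (simp add: sum_distrib_left)
    also have "(\<Sum>\<rho>\<in>?P. \<Prod>i\<in>X. var (inv \<rho> i) ^ a i) = (\<Sum>\<rho>\<in>?P. \<Prod>i\<in>X. var (\<rho> i) ^ a i)"
      by (rule sum_permutations_inverse[symmetric])
    also have "\<dots> = (\<Sum>f\<in>injections X X. \<Prod>i\<in>X. var (f i) ^ a i)"
    proof (rule sum.reindex_bij_witness[of _ "\<lambda>f i. if i \<in> X then f i else i" "\<lambda>\<rho>. restrict \<rho> X"])
      fix f assume f: "f \<in> injections X X"
      have "inj_on (\<lambda>i. if i \<in> X then f i else i) X" using f by (auto simp: injections_def inj_on_def)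
      then show "(\<lambda>i. if i \<in> X then f i else i) \<in> ?P"
        using f fin by (auto simp: injections_def intro!: inj_imp_permutes)
      show "restrict (\<lambda>i. if i \<in> X then f i else i) X = f"
        using f by (auto simp: injections_def PiE_def extensional_def restrict_def fun_eq_iff)
    next
      fix \<rho> assume "\<rho> \<in> ?P"
      then have \<rho>: "\<rho> permutes X" by simp
      show "(\<lambda>i. if i \<in> X then restrict \<rho> X i else i) = \<rho>"
        using \<rho> by (auto simp: fun_eq_iff permutes_not_in)
      show "restrict \<rho> X \<in> injections X X"
        using \<rho> permutes_inj_on[OF \<rho>, of X] permutes_in_image[OF \<rho>]
        by (auto simp: injections_def)
      show "(\<Prod>i\<in>X. var (restrict \<rho> X i) ^ a i) = (\<Prod>i\<in>X. var (\<rho> i) ^ a i)" by simp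
    qed
    also have "(\<Prod>i\<in>{..<k} - X. var i ^ a i) * \<dots> \<in> mixed k X"
      by (intro mixed_times mixed_polys_on injection_sum_mixed fin X polys_on_intros)
    finally show ?thesis .
  qed
  have "of_nat (card ?P) * g = (\<Sum>\<rho>\<in>?P. poly_act \<rho> g)" by (simp add: inv)
  also have "\<dots> = (\<Sum>\<rho>\<in>?P. \<Sum>m\<in>keys g. cst (lookup g m) * poly_act \<rho> (\<Prod>i<k. var i ^ lookup m i))"
  proof (rule sum.cong[OF refl])
    fix \<rho>
    have "poly_act \<rho> g = poly_act \<rho> (\<Sum>m\<in>keys g. cst (lookup g m) * (\<Prod>i<k. var i ^ lookup m i))"
      using polys_on_expand[of g "{..<k}"] g by (simp add: polys_eq)
    then show "poly_act \<rho> g = (\<Sum>m\<in>keys g. cst (lookup g m) * poly_act \<rho> (\<Prod>i<k. var i ^ lookup m i))"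
      by (simp add: poly_act_sum poly_act_mult)
  qed
  also have "\<dots> = (\<Sum>m\<in>keys g. cst (lookup g m) * (\<Sum>\<rho>\<in>?P. poly_act \<rho> (\<Prod>i<k. var i ^ lookup m i)))"
    by (subst sum.swap) (simp add: sum_distrib_left)
  also have "\<dots> \<in> mixed k X" by (intro mixed_sum mixed_times mixed_cst sym)
  finally have "cst (1 / of_nat (card ?P)) * (of_nat (card ?P) * g) \<in> mixed k X"
    by (rule mixed_times[OF mixed_cst])
  moreover have "cst (1 / of_nat (card ?P)) * (of_nat (card ?P) * g) = g"
  proof -
    have "id \<in> ?P" by (simp add: permutes_id)
    then have "card ?P \<noteq> 0" using finP by (metis card_0_eq empty_iff)
    then have "cst (1 / of_nat (card ?P)) * of_nat (card ?P) = 1"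
      by (simp add: cst_of_nat[symmetric] cst_mult[symmetric] cst_1)
    then show ?thesis by (simp flip: mult.assoc)
  qed
  ultimately show ?thesis by simp
qed

context young_shape
begin

section \<open>Rows of the diagram\<close>

text \<open>
  The coordinates of a position: its row, numbered from 1, and its place in the row, also numbered
  from 1. Row j starts in the column with number \<open>\<xi> 1 - \<xi> j\<close>, columns being numbered from 0; this
  is the offset in \<open>index_of\<close> and \<open>position\<close>.
\<close>

definition row_of :: "nat \<Rightarrow> nat" where
  "row_of p = Suc (inner_pos ls p)"

definition index_of :: "nat \<Rightarrow> nat" where
  "index_of p = block_of ls p + 1 - (\<xi> 1 - \<xi> (row_of p))"

definition position :: "nat \<Rightarrow> nat \<Rightarrow> nat" where
  "position j i = offset ls (i - 1 + (\<xi> 1 - \<xi> j)) + (j - 1)"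

lemma nth_w0: "p < k \<Longrightarrow> w0 ! p = row_of p"
  by (simp add: row_of_def nth_row_word sum_block_sizes)

lemma row_bounds:
  assumes "p < k"
  shows "row_of p \<in> {1..n+1}" "row_of p \<le> ls ! block_of ls p" "block_of ls p < \<xi> 1" "\<xi> 1 - \<xi> (row_of p) \<le> block_of ls p"
    "index_of p \<in> {1..\<xi> (row_of p)}" "position (row_of p) (index_of p) = p"
proof -
  have p: "p < sum_list ls" using assms by (simp add: sum_block_sizes)
  show b: "block_of ls p < \<xi> 1" using block_position(1)[OF p] by (simp add: length_block_sizes)
  show le: "row_of p \<le> ls ! block_of ls p" using block_position(2)[OF p] by (simp add: row_of_def Suc_le_eq)
  then show r: "row_of p \<in> {1..n+1}" using nth_block_sizes(1)[OF b] by (auto simp: row_of_def)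
  show i: "\<xi> 1 - \<xi> (row_of p) \<le> block_of ls p" using nth_block_sizes(2)[OF b r] le by simp
  show "index_of p \<in> {1..\<xi> (row_of p)}" using i b \<xi>_le[of 1 "row_of p"] r by (auto simp: index_of_def)
  have "index_of p - 1 + (\<xi> 1 - \<xi> (row_of p)) = block_of ls p" using i by (simp add: index_of_def)
  then show "position (row_of p) (index_of p) = p" using block_position(3)[OF p] by (simp add: position_def row_of_def)
qed

lemma position_props:
  assumes "j \<in> {1..n+1}" "i \<in> {1..\<xi> j}"
  shows "position j i < k" "row_of (position j i) = j" "index_of (position j i) = i"
proof -
  let ?b = "i - 1 + (\<xi> 1 - \<xi> j)"
  have b: "?b < \<xi> 1" using assms \<xi>_le[of 1 j] by auto
  then have "j \<le> ls ! ?b" using nth_block_sizes(2)[OF b assms(1)] by simp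
  then have *: "?b < length ls" "j - 1 < ls ! ?b" using b assms by (auto simp: length_block_sizes)
  show "position j i < k" using position_of_block(1)[OF *] by (simp add: position_def sum_block_sizes)
  show r: "row_of (position j i) = j" using position_of_block(3)[OF *] assms by (simp add: position_def row_of_def)
  show "index_of (position j i) = i"
    unfolding index_of_def r using position_of_block(2)[OF *] assms by (simp add: position_def)
qed

section \<open>The polynomials b and p\<close>

text \<open>
  The array r places exponents in the rows below the first one; the first row has exponent 0. Then
  \<open>b(r)\<close> is the column antisymmetrisation of \<open>row_monomial r\<close>, up to the sign \<open>orient\<close>, which comes
  from moving the exponent 0 to the front of each column and depends on the shape only.
\<close>

definition exponent :: "(nat \<Rightarrow> nat \<Rightarrow> nat) \<Rightarrow> nat \<Rightarrow> nat" where
  "exponent r p = (if row_of p = 1 then 0 else r (row_of p) (index_of p))"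

definition row_monomial :: "(nat \<Rightarrow> nat \<Rightarrow> nat) \<Rightarrow> cpoly" where
  "row_monomial r = (\<Prod>p<k. var p ^ exponent r p)"

definition poly_alt :: "cpoly \<Rightarrow> cpoly" where
  "poly_alt f = (\<Sum>c\<in>C. of_int (sign c) * poly_act c f)"

definition orient :: int where
  "orient = (\<Prod>l\<leftarrow>ls. sign (cycle_perm l))"

lemma orient_square: "of_int orient * of_int orient = (1 :: cpoly)"
proof -
  have "(\<Prod>l\<leftarrow>xs. sign (cycle_perm l)) * (\<Prod>l\<leftarrow>xs. sign (cycle_perm l)) = 1" for xs
  proof (induction xs)
    case (Cons l xs)
    let ?s = "sign (cycle_perm l)" let ?P = "\<Prod>l\<leftarrow>xs. sign (cycle_perm l)"
    have "?s * ?P * (?s * ?P) = (?s * ?s) * (?P * ?P)" by (simp only: mult_ac)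
    then show ?case using Cons.IH by simp
  qed simp
  then show ?thesis by (simp add: orient_def flip: of_int_mult)
qed

text \<open>
  The pairs (length of a block, number among the blocks of this length), in the order in which \<open>bpoly\<close>
  runs through them.
\<close>

definition blocks :: "(nat \<times> nat) list" where
  "blocks = concat (map (\<lambda>l. map (Pair l) [1..<mult n \<xi> l + 1]) [1..<n+2])"

lemma fst_blocks: "map fst blocks = ls"
  by (simp add: blocks_def block_sizes_def map_concat comp_def map_replicate_const del: upt_Suc)

lemma nth_blocks_aux:
  assumes "1 \<le> j" "j \<le> n + 2"
    "b < length (concat (map (\<lambda>l. map (Pair l) [1..<mult n \<xi> l + 1]) [1..<j]))"
    "concat (map (\<lambda>l. map (Pair l) [1..<mult n \<xi> l + 1]) [1..<j]) ! b = (l, s)"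
  shows "(\<xi> 1 - \<xi> l) + s = b + 1"
  using assms
proof (induction j rule: nat_induct)
  case (Suc j)
  show ?case
  proof (cases "j = 0")
    case False
    let ?g = "\<lambda>l. map (Pair l) [1..<mult n \<xi> l + 1]" let ?L = "concat (map ?g [1..<j])"
    have split: "concat (map ?g [1..<Suc j]) = ?L @ ?g j" using False by simp
    have "length ?L = length (concat (map (\<lambda>l. replicate (mult n \<xi> l) l) [1..<j]))"
      by (simp add: length_concat comp_def del: upt_Suc)
    then have len: "length ?L = \<xi> 1 - \<xi> j" 
      using length_small_blocks[of j] Suc.prems(2) False by (simp del: upt_Suc One_nat_def)
    show ?thesis
    proof (cases "b < length ?L")
      case True
      then show ?thesis using Suc.IH Suc.prems False unfolding split by (simp add: nth_append del: upt_Suc)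
    next
      case b: False
      have "?g j ! (b - length ?L) = (l, s)"
        using Suc.prems(4) b unfolding split nth_append by (simp only: if_False)
      moreover have "b < length ?L + mult n \<xi> j"
        using Suc.prems(3) unfolding split length_append by (simp del: upt_Suc)
      then have "b - length ?L < mult n \<xi> j" using b by linarith
      ultimately have "l = j" "s = b - length ?L + 1" by (auto simp del: upt_Suc)
      then show ?thesis using b by (simp only: len)
    qed
  qed (use Suc.prems in simp)
qed simp

lemma nth_blocks:
  assumes "b < \<xi> 1"
  shows "blocks ! b = (ls ! b, b + 1 - (\<xi> 1 - \<xi> (ls ! b)))"
proof -
  have len: "length blocks = \<xi> 1" using arg_cong[OF fst_blocks, of length] by (simp add: length_block_sizes)
  obtain l s where ls: "blocks ! b = (l, s)" by fastforce
  have "(\<xi> 1 - \<xi> l) + s = b + 1"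
    using nth_blocks_aux[of "n + 2" b l s] ls assms len unfolding blocks_def by (simp del: upt_Suc)
  moreover have "ls ! b = l" using ls assms len by (simp add: fst_blocks[symmetric])
  ultimately show ?thesis using ls by simp
qed

lemma bpoly_block_tensor:
  "bpoly n \<xi> r = block_tensor (map (\<lambda>rs. (length rs + 1, apoly rs)) (map (\<lambda>(l, s). Phi \<xi> l s r) blocks))"
proof -
  let ?F = "\<lambda>l. map (\<lambda>s. (l, apoly (Phi \<xi> l s r))) [1..<mult n \<xi> l + 1]"
  let ?G = "\<lambda>l. map (\<lambda>s. (length (Phi \<xi> l s r) + 1, apoly (Phi \<xi> l s r))) [1..<mult n \<xi> l + 1]"
  have "[1..<n+2] = 1 # [2..<n+2]" using upt_conv_Cons[of 1 "n + 2"] by (simp add: numeral_2_eq_2 del: upt_Suc)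
  then have "map (\<lambda>rs. (length rs + 1, apoly rs)) (map (\<lambda>(l, s). Phi \<xi> l s r) blocks) = ?G 1 @ concat (map ?G [2..<n+2])"
    by (simp add: blocks_def map_concat comp_def del: upt_Suc One_nat_def)
  also have "?G 1 = replicate (mult n \<xi> 1) (1, 1)"
  proof -
    have "Phi \<xi> 1 s r = []" for s by (simp add: Phi_def)
    moreover have "apoly [] = 1" by (simp add: apoly_def lessThan_Suc)
    ultimately show ?thesis by (simp add: map_replicate_const del: upt_Suc)
  qed
  also have "map ?G [2..<n+2] = map ?F [2..<n+2]"
    by (rule map_cong) (auto simp: Phi_def Suc_le_eq simp del: upt_Suc)
  finally show ?thesis unfolding bpoly_def by (simp only:)
qed

lemma bpoly_eq: "bpoly n \<xi> r = of_int orient * poly_alt (row_monomial r)"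
proof -
  let ?rss = "map (\<lambda>(l, s). Phi \<xi> l s r) blocks" let ?ess = "map ((#) 0) ?rss"
  have pos: "l \<ge> 1" if "(l, s) \<in> set blocks" for l s using that by (auto simp: blocks_def)
  have lens: "map length ?ess = ls"
  proof -
    have "map length ?ess = map fst blocks" by (auto simp: Phi_def Suc_le_eq dest!: pos simp del: upt_Suc)
    then show ?thesis by (simp only: fst_blocks)
  qed
  have sgn: "(\<Prod>rs\<leftarrow>?rss. sign (cycle_perm (length rs + 1))) = orient"
    unfolding orient_def lens[symmetric] by (simp add: comp_def)
  have nth: "concat ?ess ! p = exponent r p" if p: "p < k" for p
  proof -
    let ?b = "block_of ls p"
    have b: "?b < \<xi> 1" "?b < length blocks"
      using row_bounds(3)[OF p] arg_cong[OF fst_blocks, of length] by (simp_all add: length_block_sizes)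
    have le: "inner_pos ls p < ls ! ?b" using row_bounds(2)[OF p] by (simp add: row_of_def)
    have lb: "ls ! ?b \<in> {1..n+1}" "\<xi> 1 - \<xi> (ls ! ?b) \<le> ?b"
      using nth_block_sizes(1)[OF b(1)] nth_block_sizes(2)[OF b(1), of "ls ! ?b"] by auto
    have "concat ?ess ! p = ?ess ! ?b ! inner_pos ls p"
      using nth_concat_block[of p ?ess] p unfolding lens by (simp only: sum_block_sizes)
    also have "\<dots> = (0 # Phi \<xi> (ls ! ?b) (?b + 1 - (\<xi> 1 - \<xi> (ls ! ?b))) r) ! inner_pos ls p"
      using b by (simp add: nth_blocks)
    also have "\<dots> = exponent r p"
    proof (cases "inner_pos ls p")
      case (Suc i)
      then have row_of: "row_of p = i + 2" by (simp add: row_of_def)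
      have "\<xi> (ls ! ?b) \<le> \<xi> (row_of p)" "\<xi> (row_of p) \<le> \<xi> 1"
        using \<xi>_le[of "row_of p" "ls ! ?b"] \<xi>_le[of 1 "row_of p"] row_bounds(1,2)[OF p] lb by auto
      then have "\<xi> (row_of p) - \<xi> (ls ! ?b) + (?b + 1 - (\<xi> 1 - \<xi> (ls ! ?b))) = index_of p"
        using lb(2) row_bounds(4)[OF p] by (simp add: index_of_def)
      moreover have "[2..<ls ! ?b + 1] ! i = row_of p" using Suc le row_of by (simp del: upt_Suc)
      ultimately show ?thesis using Suc le row_of by (simp add: exponent_def Phi_def del: upt_Suc)
    qed (simp add: exponent_def row_of_def)
    finally show ?thesis .
  qed
  have "block_tensor (map (\<lambda>es. (length es, alternant es)) ?ess) =
    (\<Sum>c\<in>C. of_int (sign c) * (\<Prod>p<k. var (c p) ^ exponent r p))"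
    unfolding block_tensor_alternant lens sum_block_sizes
    by (intro sum.cong refl arg_cong2[of _ _ _ _ "(*)"] prod.cong) (simp only: nth lessThan_iff)
  also have "\<dots> = (\<Sum>c\<in>C. of_int (sign (inv c)) * (\<Prod>p<k. var (inv c p) ^ exponent r p))"
    by (rule sum_column_group_inv[symmetric])
  also have "\<dots> = poly_alt (row_monomial r)"
    unfolding poly_alt_def row_monomial_def
    by (rule sum.cong) (simp_all add: sign_inverse[OF column_group_permutation] poly_act_prod poly_act_power poly_act_var)
  finally show ?thesis
    unfolding bpoly_block_tensor block_tensor_apoly sgn by simp
qed

abbreviation "row_symmetries \<equiv> (\<Pi>\<^sub>E j\<in>{2..n+1}. {\<tau>. \<tau> permutes {1..\<xi> j}})"

definition row_sum :: "(nat \<Rightarrow> nat \<Rightarrow> nat) \<Rightarrow> cpoly" where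
  "row_sum r = (\<Sum>\<sigma>\<in>row_symmetries. row_monomial (\<lambda>j i. r j (\<sigma> j i)))"

lemma poly_alt_add: "poly_alt (f + g) = poly_alt f + poly_alt g"
  by (simp add: poly_alt_def poly_act_add distrib_left sum.distrib)
lemma poly_alt_sum: "poly_alt (\<Sum>i\<in>I. f i) = (\<Sum>i\<in>I. poly_alt (f i))"
  by (rule additive_sum) (rule poly_alt_add)
lemma poly_alt_sym: "a \<in> sym_polys k \<Longrightarrow> poly_alt (a * f) = a * poly_alt f"
  unfolding poly_alt_def sum_distrib_left
  by (rule sum.cong) (auto simp: poly_act_mult sym_polys_def C_permutes mult_ac)

lemma ppoly_eq: "ppoly n \<xi> r = of_int orient * poly_alt (row_sum r)"
  by (simp add: ppoly_def bpoly_eq row_sum_def poly_alt_sum sum_distrib_left)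

section \<open>Row symmetrisation\<close>

definition row_group :: "(nat \<Rightarrow> nat) set" where
  "row_group = {\<rho>. \<rho> permutes {..<k} \<and> (\<forall>p<k. row_of (\<rho> p) = row_of p)}"

text \<open>
  The product of the symmetric groups of the rows below the first one, over which \<open>p(r)\<close> averages. The
  row group acts through it on the monomials \<open>row_monomial r\<close>, whose variables belong to these rows.
\<close>

definition lower_group :: "(nat \<Rightarrow> nat) set" where
  "lower_group = {\<rho> \<in> row_group. \<forall>p<k. row_of p = 1 \<longrightarrow> \<rho> p = p}"

lemma row_group_iff: "\<rho> \<in> row_group \<longleftrightarrow> \<rho> permutes {..<k} \<and> permute_list \<rho> w0 = w0"
proof (cases "\<rho> permutes {..<k}")
  case True
  then have "permute_list \<rho> w0 = w0 \<longleftrightarrow> (\<forall>p<k. w0 ! \<rho> p = w0 ! p)"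
    by (auto simp: list_eq_iff_nth_eq length_w0 permute_list_nth)
  moreover have "\<rho> p < k \<longleftrightarrow> p < k" for p using permutes_in_image[OF True, of p] by simp
  ultimately show ?thesis using True by (auto simp: row_group_def nth_w0)
qed (simp add: row_group_def)

lemma lower_group_subset: "lower_group \<subseteq> row_group" by (auto simp: lower_group_def)

lemma finite_row_group [simp]: "finite row_group" "finite lower_group"
proof -
  show "finite row_group" by (rule finite_subset[OF _ finite_S]) (auto simp: row_group_def)
  then show "finite lower_group" using lower_group_subset finite_subset by blast
qed

lemma row_group_lt: "\<rho> \<in> row_group \<Longrightarrow> \<rho> p < k \<longleftrightarrow> p < k"
  using permutes_in_image[of \<rho> "{..<k}" p] by (simp add: row_group_def)

lemma lower_group_comp: "\<rho> \<in> lower_group \<Longrightarrow> \<rho>' \<in> lower_group \<Longrightarrow> \<rho> \<circ> \<rho>' \<in> lower_group"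
  using row_group_lt[of \<rho>] row_group_lt[of \<rho>'] unfolding lower_group_def
  by (auto simp: row_group_def intro: permutes_compose)

lemma lower_group_inv:
  assumes "\<rho> \<in> lower_group"
  shows "inv \<rho> \<in> lower_group"
proof -
  have \<rho>: "\<rho> permutes {..<k}" using assms by (simp add: lower_group_def row_group_def)
  have lt: "inv \<rho> p < k \<longleftrightarrow> p < k" for p using permutes_in_image[OF permutes_inv[OF \<rho>], of p] by simp
  have "row_of (inv \<rho> p) = row_of p" if "p < k" for p
  proof -
    have "row_of (\<rho> (inv \<rho> p)) = row_of (inv \<rho> p)" using assms that lt by (simp add: lower_group_def row_group_def)
    then show ?thesis by (simp add: permutes_inverses[OF \<rho>])
  qed
  moreover have "inv \<rho> p = p" if "p < k" "row_of p = 1" for p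
    using assms that permutes_inverses(2)[OF \<rho>, of p] by (simp add: lower_group_def)
  ultimately show ?thesis using permutes_inv[OF \<rho>] by (simp add: lower_group_def row_group_def)
qed

lemma poly_act_row_monomial:
  assumes "\<rho> permutes {..<k}"
  shows "poly_act \<rho> (row_monomial r) = (\<Prod>p<k. var p ^ exponent r (\<rho> p))"
proof -
  have "poly_act \<rho> (row_monomial r) = (\<Prod>p<k. var (inv \<rho> p) ^ exponent r p)"
    by (simp add: row_monomial_def poly_act_prod poly_act_power poly_act_var)
  also have "\<dots> = (\<Prod>p<k. var (inv \<rho> (\<rho> p)) ^ exponent r (\<rho> p))"
    using prod.permute[OF assms, of "\<lambda>p. var (inv \<rho> p) ^ exponent r p"] by (simp add: comp_def)
  finally show ?thesis by (simp add: permutes_inverses[OF assms])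
qed

text \<open>
  A family of permutations of the places in rows 2, ..., n+1 is the same as an element of \<open>lower_group\<close>,
  by the coordinates (row, place in the row); \<open>lift\<close> and \<open>drop\<close> are the two directions.
\<close>

lemma row_sum_lower_group: "row_sum r = (\<Sum>\<rho>\<in>lower_group. poly_act \<rho> (row_monomial r))"
proof -
  define lift where "lift \<sigma> = (\<lambda>p. if p < k \<and> row_of p \<noteq> 1 then position (row_of p) (\<sigma> (row_of p) (index_of p)) else p)"
    for \<sigma> :: "nat \<Rightarrow> nat \<Rightarrow> nat"
  define drop where "drop \<rho> = (\<lambda>j\<in>{2..n+1}. \<lambda>i. if i \<in> {1..\<xi> j} then index_of (\<rho> (position j i)) else i)"
    for \<rho> :: "nat \<Rightarrow> nat"
  have lift: "row_of (lift \<sigma> p) = row_of p" "lift \<sigma> p < k" "row_of p \<noteq> 1 \<Longrightarrow> index_of (lift \<sigma> p) = \<sigma> (row_of p) (index_of p)"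
    if \<sigma>: "\<sigma> \<in> row_symmetries" and p: "p < k" for \<sigma> p
  proof -
    have "position (row_of p) (\<sigma> (row_of p) (index_of p)) < k \<and> row_of (position (row_of p) (\<sigma> (row_of p) (index_of p))) = row_of p \<and>
      index_of (position (row_of p) (\<sigma> (row_of p) (index_of p))) = \<sigma> (row_of p) (index_of p)" if "row_of p \<noteq> 1"
    proof -
      have "row_of p \<in> {2..n+1}" using row_bounds(1)[OF p] that by auto
      then have "\<sigma> (row_of p) permutes {1..\<xi> (row_of p)}" using \<sigma> by auto
      then have "\<sigma> (row_of p) (index_of p) \<in> {1..\<xi> (row_of p)}" using row_bounds(5)[OF p] by (simp only: permutes_in_image)
      then show ?thesis using position_props row_bounds(1)[OF p] by auto
    qed
    then show "row_of (lift \<sigma> p) = row_of p" "lift \<sigma> p < k" "row_of p \<noteq> 1 \<Longrightarrow> index_of (lift \<sigma> p) = \<sigma> (row_of p) (index_of p)"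
      using p by (auto simp: lift_def)
  qed
  have lift_lower: "lift \<sigma> \<in> lower_group" if \<sigma>: "\<sigma> \<in> row_symmetries" for \<sigma>
  proof -
    have "inj_on (lift \<sigma>) {..<k}"
    proof (rule inj_onI)
      fix p q assume pq: "p \<in> {..<k}" "q \<in> {..<k}" "lift \<sigma> p = lift \<sigma> q"
      then have row_of: "row_of p = row_of q" using lift(1)[OF \<sigma>, of p] lift(1)[OF \<sigma>, of q] by simp
      show "p = q"
      proof (cases "row_of p = 1")
        case True
        then show ?thesis using pq row_of by (simp add: lift_def)
      next
        case False
        then have "row_of q \<in> {2..n+1}" using row_bounds(1)[of p] pq row_of by auto
        then have "\<sigma> (row_of q) permutes {1..\<xi> (row_of q)}" using \<sigma> by auto
        moreover have "\<sigma> (row_of q) (index_of p) = \<sigma> (row_of q) (index_of q)"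
          using lift(3)[OF \<sigma>, of p] lift(3)[OF \<sigma>, of q] False pq row_of by simp
        ultimately have "index_of p = index_of q" using permutes_inj[of "\<sigma> (row_of q)"] by (blast dest: injD)
        then have "position (row_of p) (index_of p) = position (row_of q) (index_of q)" by (simp only: row_of)
        then show ?thesis using row_bounds(6)[of p] row_bounds(6)[of q] pq by simp
      qed
    qed
    then have "lift \<sigma> permutes {..<k}"
      by (rule inj_imp_permutes) (use lift(2)[OF \<sigma>] in \<open>auto simp: lift_def[of \<sigma>]\<close>)
    then show ?thesis using lift(1)[OF \<sigma>] by (simp add: lower_group_def row_group_def) (simp add: lift_def)
  qed
  have lower: "row_of (\<rho> p) = row_of p" "\<rho> p < k" if "\<rho> \<in> lower_group" "p < k" for \<rho> p
    using that row_group_lt[of \<rho> p] by (auto simp: lower_group_def row_group_def)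
  show ?thesis unfolding row_sum_def
  proof (rule sum.reindex_bij_witness[of _ drop lift])
    fix \<sigma> assume \<sigma>: "\<sigma> \<in> row_symmetries"
    show "lift \<sigma> \<in> lower_group" by (rule lift_lower[OF \<sigma>])
    show "poly_act (lift \<sigma>) (row_monomial r) = row_monomial (\<lambda>j i. r j (\<sigma> j i))"
    proof -
      have "lift \<sigma> permutes {..<k}" using lift_lower[OF \<sigma>] by (simp add: lower_group_def row_group_def)
      then show ?thesis
        unfolding poly_act_row_monomial[OF \<open>lift \<sigma> permutes {..<k}\<close>] row_monomial_def[of "\<lambda>j i. r j (\<sigma> j i)"]
        by (intro prod.cong refl) (simp add: exponent_def lift[OF \<sigma>])
    qed
    show "drop (lift \<sigma>) = \<sigma>"
    proof (intro ext)
      fix j i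
      show "drop (lift \<sigma>) j i = \<sigma> j i"
      proof (cases "j \<in> {2..n+1}")
        case j: True
        then have perm: "\<sigma> j permutes {1..\<xi> j}" using \<sigma> by auto
        show ?thesis
        proof (cases "i \<in> {1..\<xi> j}")
          case True
          have "j \<in> {1..n+1}" "j \<noteq> 1" using j by auto
          then show ?thesis using position_props[of j i] True lift(3)[OF \<sigma>, of "position j i"] j by (simp add: drop_def)
        next
          case False
          then show ?thesis using j permutes_not_in[OF perm, of i] by (auto simp: drop_def)
        qed
      next
        case False
        then show ?thesis using \<sigma> PiE_arb[OF \<sigma> False] by (auto simp: drop_def)
      qed
    qed
  next
    fix \<rho> assume \<rho>: "\<rho> \<in> lower_group"
    have perm: "\<rho> permutes {..<k}" using \<rho> by (simp add: lower_group_def row_group_def)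
    show "drop \<rho> \<in> row_symmetries"
    proof (rule PiE_I)
      fix j assume j: "j \<in> {2..n+1}"
      then have j1: "j \<in> {1..n+1}" by auto
      have mem: "index_of (\<rho> (position j i)) \<in> {1..\<xi> j}" "\<rho> (position j i) < k" "row_of (\<rho> (position j i)) = j"
        if i: "i \<in> {1..\<xi> j}" for i
        using position_props[OF j1 i] lower[OF \<rho>, of "position j i"] row_bounds(5)[of "\<rho> (position j i)"] by auto
      have "drop \<rho> j permutes {1..\<xi> j}"
      proof (rule inj_imp_permutes)
        show "inj_on (drop \<rho> j) {1..\<xi> j}"
        proof (rule inj_onI)
          fix i i' assume i: "i \<in> {1..\<xi> j}" "i' \<in> {1..\<xi> j}" "drop \<rho> j i = drop \<rho> j i'"
          then have "index_of (\<rho> (position j i)) = index_of (\<rho> (position j i'))" using j by (simp add: drop_def)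
          then have "\<rho> (position j i) = \<rho> (position j i')"
            using row_bounds(6)[OF mem(2)[OF i(1)]] row_bounds(6)[OF mem(2)[OF i(2)]] mem(3)[OF i(1)] mem(3)[OF i(2)]
            by metis
          then have "position j i = position j i'" by (rule injD[OF permutes_inj[OF perm]])
          then have "index_of (position j i) = index_of (position j i')" by (rule arg_cong)
          then show "i = i'" by (simp only: position_props(3)[OF j1 i(1)] position_props(3)[OF j1 i(2)])
        qed
      qed (use j mem in \<open>auto simp: drop_def\<close>)
      then show "drop \<rho> j \<in> {\<tau>. \<tau> permutes {1..\<xi> j}}" by simp
    qed (auto simp: drop_def)
    show "lift (drop \<rho>) = \<rho>"
    proof
      fix p show "lift (drop \<rho>) p = \<rho> p"
      proof (cases "p < k \<and> row_of p \<noteq> 1")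
        case True
        then have "row_of p \<in> {2..n+1}" using row_bounds(1)[of p] by auto
        then have "drop \<rho> (row_of p) (index_of p) = index_of (\<rho> p)"
          using True row_bounds(5,6)[of p] by (simp add: drop_def)
        then show ?thesis using True lower[OF \<rho>, of p] row_bounds(6)[of "\<rho> p"] by (simp add: lift_def)
      next
        case False
        then show ?thesis using \<rho> permutes_not_in[OF perm, of p]
          by (cases "p < k") (auto simp: lift_def lower_group_def)
      qed
    qed
  qed
qed

text \<open>
  On the variables of the lower rows, a row permutation agrees with an element of \<open>lower_group\<close>, and the
  sum over this group absorbs it.
\<close>

lemma row_sum_invariant:
  assumes "\<rho> \<in> row_group"
  shows "poly_act \<rho> (row_sum r) = row_sum r"
proof -
  have \<rho>: "\<rho> permutes {..<k}" using assms by (simp add: row_group_def)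
  have row_of: "row_of (\<rho> p) = row_of p" "\<rho> p < k" if "p < k" for p
    using assms that row_group_lt by (auto simp: row_group_def)
  define \<rho>' where "\<rho>' p = (if p < k \<and> row_of p \<noteq> 1 then \<rho> p else p)" for p
  have "\<rho>' permutes {..<k}"
  proof (rule inj_imp_permutes)
    show "inj_on \<rho>' {..<k}"
    proof (rule inj_onI)
      fix p q assume pq: "p \<in> {..<k}" "q \<in> {..<k}" "\<rho>' p = \<rho>' q"
      have row': "row_of (\<rho>' p) = row_of p" if "p < k" for p using that row_of(1) by (simp add: \<rho>'_def)
      have "row_of p = row_of q" using row'[of p] row'[of q] pq by simp
      then have "p = q \<or> \<rho> p = \<rho> q" using pq by (simp add: \<rho>'_def split: if_splits)
      then show "p = q" using permutes_inj[OF \<rho>] by (blast dest: injD)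
    qed
  qed (use row_of in \<open>auto simp: \<rho>'_def\<close>)
  then have \<rho>': "\<rho>' \<in> lower_group" using row_of by (auto simp: lower_group_def row_group_def \<rho>'_def)
  have perm: "\<pi> permutes {..<k}" if "\<pi> \<in> lower_group" for \<pi> using that by (simp add: lower_group_def row_group_def)
  have "poly_act \<rho> (row_sum r) = (\<Sum>\<pi>\<in>lower_group. poly_act (\<pi> \<circ> \<rho>) (row_monomial r))"
    unfolding row_sum_lower_group poly_act_sum by (rule sum.cong) (auto simp: poly_act_comp[OF \<rho> perm])
  also have "\<dots> = (\<Sum>\<pi>\<in>lower_group. poly_act (\<pi> \<circ> \<rho>') (row_monomial r))"
  proof (rule sum.cong[OF refl])
    fix \<pi> assume \<pi>: "\<pi> \<in> lower_group"
    have "exponent r (\<pi> (\<rho> p)) = exponent r (\<pi> (\<rho>' p))" if p: "p < k" for p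
    proof (cases "row_of p = 1")
      case True
      have "row_of (\<pi> q) = row_of q" if "q < k" for q using \<pi> that by (simp add: lower_group_def row_group_def)
      then show ?thesis using True p row_of[OF p] by (simp add: exponent_def \<rho>'_def)
    qed (simp add: \<rho>'_def p)
    then show "poly_act (\<pi> \<circ> \<rho>) (row_monomial r) = poly_act (\<pi> \<circ> \<rho>') (row_monomial r)"
      using permutes_compose[OF \<rho> perm[OF \<pi>]] permutes_compose[OF perm[OF \<rho>'] perm[OF \<pi>]]
      by (simp add: poly_act_row_monomial)
  qed
  also have "\<dots> = (\<Sum>\<pi>\<in>lower_group. poly_act \<pi> (row_monomial r))"
  proof (rule sum.reindex_bij_witness[of _ "\<lambda>\<pi>. \<pi> \<circ> inv \<rho>'" "\<lambda>\<pi>. \<pi> \<circ> \<rho>'"])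
    have "\<rho>' \<circ> inv \<rho>' = id" "inv \<rho>' \<circ> \<rho>' = id" using permutes_inv_o[OF perm[OF \<rho>']] by auto
    then show "\<And>\<pi>. \<pi> \<circ> \<rho>' \<circ> inv \<rho>' = \<pi>" "\<And>\<pi>. \<pi> \<circ> inv \<rho>' \<circ> \<rho>' = \<pi>" by (simp_all add: comp_assoc)
  qed (use \<rho>' in \<open>auto simp: lower_group_comp lower_group_inv\<close>)
  finally show ?thesis by (simp only: row_sum_lower_group)
qed

lemma row_monomial_polys: "row_monomial r \<in> polys k"
  unfolding row_monomial_def polys_eq by (intro polys_on_intros) auto

lemma row_sum_polys: "row_sum r \<in> polys k"
  using row_monomial_polys unfolding row_sum_def polys_eq by (intro polys_on_sum) auto

section \<open>Invariants and the module M\<close>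

lemma M_submod: "submod (sym_polys k) (*) (M k n \<xi>)"
  unfolding M_def by (rule hull_in) (auto simp: submod_def)

lemma M_add: "f \<in> M k n \<xi> \<Longrightarrow> g \<in> M k n \<xi> \<Longrightarrow> f + g \<in> M k n \<xi>"
  using M_submod by (simp add: submod_def)
lemma M_mult: "a \<in> sym_polys k \<Longrightarrow> f \<in> M k n \<xi> \<Longrightarrow> a * f \<in> M k n \<xi>"
  using M_submod by (simp add: submod_def)
lemma M_sum: "(\<And>i. i \<in> I \<Longrightarrow> f i \<in> M k n \<xi>) \<Longrightarrow> (\<Sum>i\<in>I. f i) \<in> M k n \<xi>"
  using M_submod by (induction I rule: infinite_finite_induct) (auto simp: submod_def)
lemma ppoly_M: "ppoly n \<xi> r \<in> M k n \<xi>"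
  unfolding M_def by (rule hull_inc) simp

lemma poly_alt_row_sum_M: "poly_alt (row_sum r) \<in> M k n \<xi>"
proof -
  have "of_int orient * ppoly n \<xi> r = poly_alt (row_sum r)"
    unfolding ppoly_eq by (simp add: orient_square flip: mult.assoc)
  moreover have "of_int orient \<in> sym_polys k" using sym_polys_cst[of "of_int orient" k] by (simp add: cst_of_int)
  ultimately show ?thesis using M_mult[OF _ ppoly_M] by metis
qed

abbreviation "first_row \<equiv> {p. p < k \<and> row_of p = 1}"

text \<open>
  The symmetric factor goes through the sums, and a monomial in the variables of the lower rows is some
  \<open>row_monomial r\<close>, whose row sum and antisymmetrisation is \<open>p(r)\<close> up to sign.
\<close>

lemma mixed_M:
  assumes "f \<in> mixed k first_row"
  shows "poly_alt (\<Sum>\<rho>\<in>lower_group. poly_act \<rho> f) \<in> M k n \<xi>"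
  using assms
proof (induction f)
  case (mixed_mult a b)
  let ?X = "{..<k} - first_row"
  have expand: "b = (\<Sum>m\<in>keys b. cst (lookup b m) * row_monomial (\<lambda>j i. lookup m (position j i)))"
  proof -
    have "(\<Prod>p\<in>?X. var p ^ lookup m p) = row_monomial (\<lambda>j i. lookup m (position j i))" for m
    proof -
      have "row_monomial (\<lambda>j i. lookup m (position j i)) = (\<Prod>p\<in>?X. var p ^ exponent (\<lambda>j i. lookup m (position j i)) p)"
        unfolding row_monomial_def by (rule prod.mono_neutral_right) (auto simp: exponent_def)
      also have "\<dots> = (\<Prod>p\<in>?X. var p ^ lookup m p)"
        by (rule prod.cong) (auto simp: exponent_def row_bounds(6))
      finally show ?thesis ..
    qed
    then show ?thesis using polys_on_expand[OF mixed_mult(2)] by simp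
  qed
  have "(\<Sum>\<rho>\<in>lower_group. poly_act \<rho> (a * b)) = a * (\<Sum>\<rho>\<in>lower_group. poly_act \<rho> b)"
    unfolding sum_distrib_left
    by (rule sum.cong) (use mixed_mult(1) in \<open>auto simp: poly_act_mult sym_polys_def lower_group_def row_group_def\<close>)
  also have "(\<Sum>\<rho>\<in>lower_group. poly_act \<rho> b) = (\<Sum>m\<in>keys b. cst (lookup b m) * row_sum (\<lambda>j i. lookup m (position j i)))"
  proof -
    have "poly_act \<rho> b = (\<Sum>m\<in>keys b. cst (lookup b m) * poly_act \<rho> (row_monomial (\<lambda>j i. lookup m (position j i))))" for \<rho>
      by (subst expand) (simp add: poly_act_sum poly_act_mult)
    then show ?thesis
      unfolding row_sum_lower_group by (simp add: sum_distrib_left) (rule sum.swap)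
  qed
  finally have "poly_alt (\<Sum>\<rho>\<in>lower_group. poly_act \<rho> (a * b)) =
      a * (\<Sum>m\<in>keys b. cst (lookup b m) * poly_alt (row_sum (\<lambda>j i. lookup m (position j i))))"
    using mixed_mult(1) by (simp add: poly_alt_sym poly_alt_sum)
  then show ?case using mixed_mult(1) by (simp add: M_mult M_sum poly_alt_row_sum_M)
next
  case (mixed_add f g)
  then show ?case by (simp add: poly_act_add sum.distrib poly_alt_add M_add)
qed

lemma card_groups: "card row_group > 0" "card lower_group > 0"
proof -
  have "id \<in> lower_group" "id \<in> row_group" by (simp_all add: lower_group_def row_group_def permutes_id)
  then show "card row_group > 0" "card lower_group > 0" by (auto simp: card_gt_0_iff)
qed

lemma cancel_card: "c > 0 \<Longrightarrow> cst (1 / of_nat c) * (of_nat c * f) = f"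
  by (simp add: cst_of_nat[symmetric] cst_mult[symmetric] cst_1 flip: mult.assoc)

lemma poly_alt_invariant_M:
  assumes "g \<in> polys k" "\<And>\<rho>. \<rho> \<in> row_group \<Longrightarrow> poly_act \<rho> g = g"
  shows "poly_alt g \<in> M k n \<xi>"
proof -
  have "g \<in> mixed k first_row"
  proof (rule symmetric_mixed)
    fix \<rho> assume \<rho>: "\<rho> permutes first_row"
    have "\<rho> permutes {..<k}" using \<rho> by (rule permutes_subset) auto
    moreover have "row_of (\<rho> p) = row_of p" if "p < k" for p
      using permutes_in_image[OF \<rho>, of p] permutes_not_in[OF \<rho>, of p] that by (cases "row_of p = 1") auto
    ultimately show "poly_act \<rho> g = g" by (intro assms) (simp add: row_group_def)
  qed (use assms in auto)
  then have "poly_alt (\<Sum>\<rho>\<in>lower_group. poly_act \<rho> g) \<in> M k n \<xi>" by (rule mixed_M)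
  moreover have "(\<Sum>\<rho>\<in>lower_group. poly_act \<rho> g) = cst (of_nat (card lower_group)) * g"
    using assms(2) lower_group_subset by (simp add: subset_iff cst_of_nat)
  ultimately have "of_nat (card lower_group) * poly_alt g \<in> M k n \<xi>"
    using poly_alt_sym[OF sym_polys_cst, of "of_nat (card lower_group)" g] by (simp add: cst_of_nat)
  then have "cst (1 / of_nat (card lower_group)) * (of_nat (card lower_group) * poly_alt g) \<in> M k n \<xi>"
    by (rule M_mult[OF sym_polys_cst])
  then show ?thesis by (simp add: cancel_card card_groups)
qed

text \<open>
  Invariance determines the coefficient of w at a rearrangement of \<open>w0\<close> from the coefficient at
  \<open>w0\<close>.
\<close>

lemma form_W_e: "w \<in> W k n \<Longrightarrow> form w e = poly_alt (lookup w w0)"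
proof -
  assume w: "w \<in> W k n"
  have "lookup w (permute_list c w0) = poly_act c (lookup w w0)" if "c \<in> C" for c
    using lookup_tens_act[OF C_permutes[OF that] length_w0, of w] w C_permutes[OF that] W_VA[of k n]
    by (auto simp: W_def intro: VA_tensors)
  then show ?thesis
    unfolding wedge_vector_eq poly_alt_def form_sum_right
    by (intro sum.cong refl) (simp add: form_single_right mult.commute)
qed

lemma form_W_e_M: "w \<in> W k n \<Longrightarrow> form w e \<in> M k n \<xi>"
  unfolding form_W_e
proof (rule poly_alt_invariant_M)
  assume w: "w \<in> W k n"
  then show "lookup w w0 \<in> polys k" by (simp add: W_def VA_def)
  fix \<rho> assume "\<rho> \<in> row_group"
  then have "\<rho> permutes {..<k}" "permute_list \<rho> w0 = w0" by (auto simp: row_group_iff)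
  then show "poly_act \<rho> (lookup w w0) = lookup w w0"
    using lookup_tens_act[of \<rho> k w0 w] w VA_tensors[of w k n] by (simp add: length_w0 W_def)
qed

lemma sum_orbit_W:
  assumes "u \<in> VA k n"
  shows "(\<Sum>\<sigma>\<in>S. tens_act \<sigma> u) \<in> W k n"
proof -
  have "(\<Sum>\<sigma>\<in>S. tens_act \<sigma> u) \<in> VA k n" using assms by (intro VA_sum) (auto intro: VA_act)
  moreover have "tens_act \<tau> (\<Sum>\<sigma>\<in>S. tens_act \<sigma> u) = (\<Sum>\<sigma>\<in>S. tens_act \<sigma> u)" if \<tau>: "\<tau> permutes {..<k}" for \<tau>
  proof -
    have "tens_act \<tau> (\<Sum>\<sigma>\<in>S. tens_act \<sigma> u) = (\<Sum>\<sigma>\<in>S. tens_act (\<sigma> \<circ> \<tau>) u)"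
      unfolding tens_act_sum by (rule sum.cong) (auto simp: tens_act_comp[OF \<tau> _ VA_tensors[OF assms]])
    then show ?thesis using sum_S_right[OF \<tau>, of "\<lambda>\<sigma>. tens_act \<sigma> u"] by simp
  qed
  ultimately show ?thesis by (simp add: W_def)
qed

text \<open>
  The preimage is the orbit sum of \<open>w0 \<otimes> g\<close>; the permutations that fix \<open>w0\<close> form the row group,
  under which g is invariant, so the coefficient at \<open>w0\<close> is g times the order of this group.
\<close>

lemma poly_alt_row_sum_form: "\<exists>w\<in>W k n. form w e = poly_alt (row_sum r)"
proof -
  define g where "g = cst (1 / of_nat (card row_group)) * row_sum r"
  define w where "w = (\<Sum>\<sigma>\<in>S. tens_act \<sigma> (single w0 g))"
  have "g \<in> polys k" using row_sum_polys by (auto simp: g_def polys_eq intro: polys_on_mult)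
  then have w: "w \<in> W k n" unfolding w_def by (intro sum_orbit_W VA_single w0_words)
  have "lookup w w0 = (\<Sum>\<sigma>\<in>S. if permute_list \<sigma> w0 = w0 then poly_act \<sigma> g else 0)"
    unfolding w_def lookup_sum by (simp add: tens_act_single lookup_single when_def)
  also have "\<dots> = (\<Sum>\<sigma>\<in>row_group. poly_act \<sigma> g)"
  proof -
    have "S \<inter> {\<sigma>. permute_list \<sigma> w0 = w0} = row_group" by (auto simp: row_group_iff)
    then show ?thesis by (simp add: sum.If_cases)
  qed
  also have "\<dots> = (\<Sum>\<sigma>\<in>row_group. g)"
    by (rule sum.cong) (simp_all add: g_def poly_act_mult row_sum_invariant)
  also have "\<dots> = row_sum r"
    using cancel_card[OF card_groups(1), of "row_sum r"] by (simp add: g_def mult.left_commute)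
  finally show ?thesis using form_W_e[OF w] w by auto
qed

end

section \<open>The Vandermonde determinant\<close>

text \<open>
  The Vandermonde determinant, expanded by Leibniz' formula.
\<close>

definition vandermonde :: "nat \<Rightarrow> (nat \<Rightarrow> 'a::idom) \<Rightarrow> 'a" where
  "vandermonde l x = (\<Sum>a | a permutes {..<l}. of_int (sign a) * (\<Prod>i<l. x (a i) ^ i))"

lemma vandermonde_repeated:
  fixes x :: "nat \<Rightarrow> 'a::{idom, ring_char_0}"
  assumes "p < l" "q < l" "p \<noteq> q" "x p = x q"
  shows "vandermonde l x = 0"
proof -
  let ?t = "transpose p q"
  have t: "?t permutes {..<l}" using assms by (intro permutes_swap_id) auto
  have x: "x (?t i) = x i" for i using assms by (auto simp: transpose_def)
  have "vandermonde l x = (\<Sum>a | a permutes {..<l}. of_int (sign (?t \<circ> a)) * (\<Prod>i<l. x ((?t \<circ> a) i) ^ i))"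
    unfolding vandermonde_def by (rule setum_permutations_compose_left[OF t])
  also have "\<dots> = (\<Sum>a | a permutes {..<l}. - (of_int (sign a) * (\<Prod>i<l. x (a i) ^ i)))"
  proof (rule sum.cong[OF refl], clarify)
    fix a assume "a permutes {..<l}"
    then have "permutation a" by (rule permutes_imp_permutation[rotated]) simp
    then have "sign (?t \<circ> a) = - sign a"
      using assms(3) by (simp add: sign_compose permutation_swap_id sign_swap_id)
    then show "of_int (sign (?t \<circ> a)) * (\<Prod>i<l. x ((?t \<circ> a) i) ^ i) = - (of_int (sign a) * (\<Prod>i<l. x (a i) ^ i))"
      by (simp add: x)
  qed
  also have "\<dots> = - vandermonde l x" by (simp add: vandermonde_def sum_negf)
  finally have "2 * vandermonde l x = 0" unfolding mult_2 eq_neg_iff_add_eq_0 .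
  then show ?thesis using mult_eq_0_iff zero_neq_numeral by metis
qed

text \<open>
  As a polynomial in the last variable, the determinant has degree at most l, vanishes at the other
  l variables, and has the smaller determinant as leading coefficient.
\<close>

lemma vandermonde_step:
  fixes x :: "nat \<Rightarrow> 'a::{idom, ring_char_0}"
  assumes "inj_on x {..<l}"
  shows "vandermonde (Suc l) x = vandermonde l x * (\<Prod>i<l. x l - x i)"
proof -
  let ?S = "{a. a permutes {..<Suc l}}"
  let ?c = "\<lambda>a. of_int (sign a) * (\<Prod>i\<in>{..<Suc l} - {inv a l}. x (a i) ^ i)"
  define P where "P = (\<Sum>a\<in>?S. monom (?c a) (inv a l))"
  define Q where "Q = smult (vandermonde l x) (\<Prod>i<l. [:- x i, 1:])"
  have inv: "inv a l < Suc l" "a i = l \<longleftrightarrow> i = inv a l" if "a \<in> ?S" for a i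
  proof -
    have a: "a permutes {..<Suc l}" using that by simp
    show "inv a l < Suc l" using permutes_in_image[OF permutes_inv[OF a], of l] by simp
    show "a i = l \<longleftrightarrow> i = inv a l" using permutes_inverses[OF a] by auto
  qed
  have P: "poly P z = vandermonde (Suc l) (x(l := z))" for z
  proof -
    have "?c a * z ^ inv a l = of_int (sign a) * (\<Prod>i<Suc l. (x(l := z)) (a i) ^ i)" if a: "a \<in> ?S" for a
    proof -
      have "(\<Prod>i<Suc l. (x(l := z)) (a i) ^ i) =
        (x(l := z)) (a (inv a l)) ^ inv a l * (\<Prod>i\<in>{..<Suc l} - {inv a l}. (x(l := z)) (a i) ^ i)"
        by (rule prod.remove) (use inv(1)[OF a] in auto)
      moreover have "a (inv a l) = l" using inv(2)[OF a] by simp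
      moreover have "(\<Prod>i\<in>{..<Suc l} - {inv a l}. (x(l := z)) (a i) ^ i) = (\<Prod>i\<in>{..<Suc l} - {inv a l}. x (a i) ^ i)"
        by (rule prod.cong) (use inv(2)[OF a] in auto)
      ultimately show ?thesis by (simp add: mult_ac)
    qed
    then show ?thesis unfolding P_def poly_sum poly_monom vandermonde_def by (rule sum.cong[OF refl])
  qed
  have "P = Q"
  proof (rule poly_eqI_degree_lead_coeff[where A = "x ` {..<l}" and n = l])
    have "poly.coeff P l = (\<Sum>a\<in>?S. if inv a l = l then ?c a else 0)"
      by (simp add: P_def coeff_sum)
    also have "\<dots> = (\<Sum>a\<in>{a \<in> ?S. inv a l = l}. ?c a)"
      by (rule sum.inter_filter[symmetric]) (simp add: finite_permutations)
    also have "\<dots> = (\<Sum>a | a permutes {..<l}. ?c a)"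
    proof (rule sum.cong)
      have "a permutes {..<l}" if "a permutes {..<Suc l}" "inv a l = l" for a
        by (rule permutes_superset[OF that(1)]) (use that inv(2)[of a l] in \<open>auto simp: less_Suc_eq\<close>)
      moreover have "a permutes {..<Suc l}" "inv a l = l" if "a permutes {..<l}" for a
        using that permutes_not_in[OF permutes_inv[OF that], of l] by (auto intro: permutes_subset)
      ultimately show "{a \<in> ?S. inv a l = l} = {a. a permutes {..<l}}" by auto
    qed simp
    also have "\<dots> = vandermonde l x"
      unfolding vandermonde_def
    proof (rule sum.cong[OF refl], clarify)
      fix a assume "a permutes {..<l}"
      then have "inv a l = l" using permutes_not_in[OF permutes_inv, of a "{..<l}" l] by simp
      moreover have "{..<Suc l} - {l} = {..<l}" by auto
      ultimately show "?c a = of_int (sign a) * (\<Prod>i<l. x (a i) ^ i)" by simp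
    qed
    finally have "poly.coeff P l = vandermonde l x" .
    moreover have deg: "degree (\<Prod>i<l. [:- x i, 1:]) = l" by (simp add: degree_prod_sum_eq)
    moreover have "lead_coeff (\<Prod>i<l. [:- x i, 1:]) = 1" by (simp add: lead_coeff_prod)
    ultimately show "poly.coeff P l = poly.coeff Q l" by (simp add: Q_def)
    show "degree Q \<le> l" using deg by (simp add: Q_def)
    show "degree P \<le> l"
      unfolding P_def
    proof (rule degree_sum_le)
      show "degree (monom (?c a) (inv a l)) \<le> l" if "a \<in> ?S" for a
        using degree_monom_le[of "?c a" "inv a l"] inv(1)[OF that] by simp
    qed (simp add: finite_permutations)
    show "l \<le> card (x ` {..<l})" using assms by (simp add: card_image)
    show "poly P z = poly Q z" if z: "z \<in> x ` {..<l}" for z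
    proof -
      obtain i where i: "i < l" "z = x i" using z by auto
      then have "poly P z = 0" unfolding P by (intro vandermonde_repeated[of i _ l]) auto
      then show ?thesis using i by (auto simp: Q_def poly_prod)
    qed
  qed
  then have "vandermonde (Suc l) (x(l := x l)) = poly Q (x l)" using P[of "x l"] by simp
  then show ?thesis by (simp add: Q_def poly_prod)
qed

lemma vandermonde_prod:
  fixes x :: "nat \<Rightarrow> 'a::{idom, ring_char_0}"
  assumes "inj_on x {..<l}"
  shows "vandermonde l x = (\<Prod>j<l. \<Prod>i<j. x j - x i)"
  using assms
proof (induction l)
  case 0
  show ?case by (simp add: vandermonde_def)
next
  case (Suc l)
  then have "inj_on x {..<l}" by (rule_tac inj_on_subset) auto
  then show ?case using Suc.IH by (simp add: vandermonde_step)
qed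

lemma var_eq_iff [simp]: "var i = var j \<longleftrightarrow> i = j"
  by (auto simp: var_def dest!: arg_cong[of _ _ keys])

lemma alternant_vandermonde: "alternant [0..<l] = (\<Prod>j<l. \<Prod>i<j. var j - var i)"
proof -
  have "alternant [0..<l] = vandermonde l var"
    by (simp add: vandermonde_def alternant_def)
  then show ?thesis by (simp add: vandermonde_prod inj_on_def)
qed

section \<open>Specht polynomials\<close>

lemma block_tensor_prod:
  "block_tensor (map (\<lambda>l. (l, F l)) ls) = (\<Prod>b<length ls. rename_vars (\<lambda>i. offset ls b + i) (F (ls ! b)))"
proof (induction ls)
  case (Cons l ls)
  have "block_tensor (map (\<lambda>l. (l, F l)) (l # ls)) = F l * rename_vars (\<lambda>i. l + i) (block_tensor (map (\<lambda>l. (l, F l)) ls))"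
    by (simp add: block_tensor_def)
  also have "\<dots> = F l * (\<Prod>b<length ls. rename_vars (\<lambda>i. l + (offset ls b + i)) (F (ls ! b)))"
    unfolding Cons.IH by (simp add: rename_vars_prod rename_vars_comp)
  also have "\<dots> = (\<Prod>b<length (l # ls). rename_vars (\<lambda>i. offset (l # ls) b + i) (F ((l # ls) ! b)))"
  proof -
    have "(+) (0::nat) = (\<lambda>i. i)" by auto
    then show ?thesis
      unfolding length_Cons prod.lessThan_Suc_shift by (simp add: offset_def add.assoc[symmetric])
  qed
  finally show ?case .
qed (simp add: block_tensor_def)

lemma block_tensor_scale:
  "block_tensor (map (\<lambda>l. (l, of_int (s l) * F l)) ls) = of_int (\<Prod>l\<leftarrow>ls. s l) * block_tensor (map (\<lambda>l. (l, F l)) ls)"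
  by (induction ls) (simp_all add: block_tensor_def rename_vars_mult mult_ac)

lemma specht_poly_rename:
  assumes "\<And>i j. (i, j) \<in> young_diagram n \<xi> \<Longrightarrow> T' (i, j) = g (T (i, j))"
  shows "specht_poly n \<xi> T' = rename_vars g (specht_poly n \<xi> T)"
  unfolding specht_poly_def rename_vars_prod
  by (intro prod.cong refl) (auto simp: rename_vars_diff rename_vars_var assms)

text \<open>
  The factor of a Specht polynomial that comes from a column of length l, in the first l variables.
\<close>

definition column_poly :: "nat \<Rightarrow> cpoly" where
  "column_poly l = (\<Prod>(a, b)\<in>{(a, b). 1 \<le> a \<and> a < b \<and> b \<le> l}. var (a - 1) - var (b - 1))"

lemma column_poly_alternant: "column_poly l = (-1) ^ card {(a, b). 1 \<le> a \<and> a < b \<and> b \<le> l} * alternant [0..<l]"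
proof -
  let ?P = "{(a, b). 1 \<le> a \<and> a < b \<and> b \<le> l}"
  have "alternant [0..<l] = (\<Prod>(j, i)\<in>(SIGMA j:{..<l}. {..<j}). var j - var i)"
    unfolding alternant_vandermonde by (rule prod.Sigma) auto
  also have "\<dots> = (\<Prod>(a, b)\<in>?P. var (b - 1) - var (a - 1))"
    by (rule prod.reindex_bij_witness[of _ "\<lambda>(a, b). (b - 1, a - 1)" "\<lambda>(j, i). (Suc i, Suc j)"]) auto
  also have "\<dots> = (\<Prod>(a, b)\<in>?P. -1 * (var (a - 1) - var (b - 1)))"
    by (rule prod.cong) auto
  also have "\<dots> = (-1) ^ card ?P * column_poly l"
    unfolding column_poly_def case_prod_beta prod.distrib by (simp only: prod_constant)
  finally show ?thesis by (simp flip: mult.assoc power_mult_distrib)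
qed

context young_shape
begin

text \<open>
  The tableau that numbers the columns one after the other, shortest first; the columns of the diagram
  are numbered from the longest, whence \<open>\<xi> 1 - j\<close>.
\<close>

definition tableau :: "nat \<times> nat \<Rightarrow> nat" where
  "tableau = (\<lambda>(a, j). offset ls (\<xi> 1 - j) + (a - 1))"

lemma diagram_block:
  assumes "1 \<le> j" "j \<le> \<xi> 1"
  shows "(a, j) \<in> young_diagram n \<xi> \<longleftrightarrow> 1 \<le> a \<and> a \<le> ls ! (\<xi> 1 - j)"
proof -
  have b: "\<xi> 1 - j < \<xi> 1" using assms by simp
  have "a \<le> ls ! (\<xi> 1 - j) \<longleftrightarrow> j \<le> \<xi> a" if "a \<in> {1..n+1}"
    using nth_block_sizes(2)[OF b that] \<xi>_le[of 1 a] that assms by auto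
  moreover have "ls ! (\<xi> 1 - j) \<le> n + 1" using nth_block_sizes(1)[OF b] by simp
  ultimately show ?thesis using assms by (auto simp: young_diagram_def)
qed

lemma diagram_column: "(a, j) \<in> young_diagram n \<xi> \<Longrightarrow> 1 \<le> j \<and> j \<le> \<xi> 1"
  using \<xi>_le[of 1 a] by (auto simp: young_diagram_def)

lemma tableau_bij: "bij_betw tableau (young_diagram n \<xi>) {..<k}"
proof (rule bij_betw_byWitness[where f' = "\<lambda>p. (row_of p, \<xi> 1 - block_of ls p)"])
  have T: "tableau (a, j) < k \<and> row_of (tableau (a, j)) = a \<and> \<xi> 1 - block_of ls (tableau (a, j)) = j"
    if aj: "(a, j) \<in> young_diagram n \<xi>" for a j
  proof -
    have j: "1 \<le> j" "j \<le> \<xi> 1" using diagram_column[OF aj] by auto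
    then have a: "1 \<le> a" "a - 1 < ls ! (\<xi> 1 - j)" "\<xi> 1 - j < length ls"
      using aj diagram_block[OF j] by (auto simp: length_block_sizes)
    show ?thesis
      using position_of_block[OF a(3) a(2)] a(1) j by (simp add: tableau_def row_of_def sum_block_sizes)
  qed
  then show "\<forall>x\<in>young_diagram n \<xi>. (row_of (tableau x), \<xi> 1 - block_of ls (tableau x)) = x"
    "tableau ` young_diagram n \<xi> \<subseteq> {..<k}" by auto
  have P: "(row_of p, \<xi> 1 - block_of ls p) \<in> young_diagram n \<xi> \<and> tableau (row_of p, \<xi> 1 - block_of ls p) = p"
    if p: "p < k" for p
  proof -
    have "\<xi> 1 - (\<xi> 1 - block_of ls p) = block_of ls p" using row_bounds(3)[OF p] by simp
    then show ?thesis
      using row_bounds(1,2,3)[OF p] diagram_block[of "\<xi> 1 - block_of ls p" "row_of p"] block_position(3)[of p ls] p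
      by (simp add: tableau_def row_of_def sum_block_sizes)
  qed
  then show "\<forall>p\<in>{..<k}. tableau (row_of p, \<xi> 1 - block_of ls p) = p"
    "(\<lambda>p. (row_of p, \<xi> 1 - block_of ls p)) ` {..<k} \<subseteq> young_diagram n \<xi>" by auto
qed

lemma specht_poly_tableau: "specht_poly n \<xi> tableau = block_tensor (map (\<lambda>l. (l, column_poly l)) ls)"
proof -
  have "specht_poly n \<xi> tableau = (\<Prod>j\<in>{1..\<xi> 1}. rename_vars (\<lambda>i. offset ls (\<xi> 1 - j) + i) (column_poly (ls ! (\<xi> 1 - j))))"
    unfolding specht_poly_def
  proof (rule prod.cong[OF refl])
    fix j assume "j \<in> {1..\<xi> 1}"
    then have *: "(a, j) \<in> young_diagram n \<xi> \<longleftrightarrow> 1 \<le> a \<and> a \<le> ls ! (\<xi> 1 - j)" for a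
      using diagram_block[of j a] by auto
    show "(\<Prod>(a, b) \<in> {(a, b). a < b \<and> (a, j) \<in> young_diagram n \<xi> \<and> (b, j) \<in> young_diagram n \<xi>}.
       var (tableau (a, j)) - var (tableau (b, j))) = rename_vars (\<lambda>i. offset ls (\<xi> 1 - j) + i) (column_poly (ls ! (\<xi> 1 - j)))"
      unfolding column_poly_def rename_vars_prod
      by (rule prod.cong) (auto simp: * rename_vars_diff rename_vars_var tableau_def)
  qed
  also have "\<dots> = (\<Prod>b<\<xi> 1. rename_vars (\<lambda>i. offset ls b + i) (column_poly (ls ! b)))"
    by (rule prod.reindex_bij_witness[of _ "\<lambda>b. \<xi> 1 - b" "\<lambda>j. \<xi> 1 - j"]) auto
  finally show ?thesis by (simp add: block_tensor_prod length_block_sizes)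
qed

text \<open>
  For the array with the entry j - 1 throughout row j, each column carries the exponents
  0, 1, 2, ..., and the alternating polynomials become Vandermonde determinants. As the array is constant
  along rows, its row permutations change nothing and \<open>p(r)\<close> is a multiple of \<open>b(r)\<close>.
\<close>

lemma specht_poly_M: "specht_poly n \<xi> tableau \<in> M k n \<xi>"
proof -
  define r where "r = (\<lambda>j i :: nat. j - 1 :: nat)"
  \<comment> \<open>Signs: from the position of the exponent 0, and from \<open>t_a - t_b\<close> versus \<open>t_b - t_a\<close> in the factors.\<close>
  define t where "t l = sign (cycle_perm l) * (-1) ^ card {(a, b). 1 \<le> a \<and> a < b \<and> b \<le> l}" for l
  have tt: "t l * t l = 1" for l
  proof -
    have "t l * t l = (sign (cycle_perm l) * sign (cycle_perm l)) * ((-1) * (-1)) ^ card {(a, b). 1 \<le> a \<and> a < b \<and> b \<le> l}"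
      unfolding t_def power_mult_distrib by (simp only: mult_ac)
    then show ?thesis by simp
  qed
  have col: "apoly [1..<l] = of_int (t l) * column_poly l" if "l \<ge> 1" for l
  proof -
    have "0 # [1..<l] = [0..<l]" using that by (simp add: upt_conv_Cons)
    then have "apoly [1..<l] = of_int (sign (cycle_perm l)) * alternant [0..<l]"
      using apoly_alternant[of "[1..<l]"] that by simp
    moreover have "alternant [0..<l] = (-1) ^ card {(a, b). 1 \<le> a \<and> a < b \<and> b \<le> l} * column_poly l"
      unfolding column_poly_alternant by (simp flip: mult.assoc power_mult_distrib)
    ultimately show ?thesis by (simp add: t_def)
  qed
  have "bpoly n \<xi> r = block_tensor (map (\<lambda>(l, s). (l, apoly [1..<l])) blocks)"
  proof -
    have "Phi \<xi> l s r = [1..<l]" for l s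
      by (rule nth_equalityI) (simp_all add: Phi_def r_def del: upt_Suc)
    moreover have "l \<ge> 1" if "(l, s) \<in> set blocks" for l s using that by (auto simp: blocks_def)
    ultimately show ?thesis
      unfolding bpoly_block_tensor by (intro arg_cong[of _ _ block_tensor]) (auto simp: Suc_le_eq)
  qed
  also have "map (\<lambda>(l, s). (l, apoly [1..<l])) blocks = map (\<lambda>l. (l, apoly [1..<l])) ls"
    by (simp add: fst_blocks[symmetric] case_prod_beta)
  also have "\<dots> = map (\<lambda>l. (l, of_int (t l) * column_poly l)) ls"
  proof (rule map_cong[OF refl])
    fix l assume "l \<in> set ls"
    then have "l \<ge> 1" by (auto simp: block_sizes_def simp del: upt_Suc)
    then show "(l, apoly [1..<l]) = (l, of_int (t l) * column_poly l)" by (simp only: col)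
  qed
  finally have b: "bpoly n \<xi> r = of_int (\<Prod>l\<leftarrow>ls. t l) * specht_poly n \<xi> tableau"
    by (simp only: block_tensor_scale specht_poly_tableau)
  have "(\<Prod>l\<leftarrow>xs. t l) * (\<Prod>l\<leftarrow>xs. t l) = 1" for xs
  proof (induction xs)
    case (Cons l xs)
    have "(t l * (\<Prod>l\<leftarrow>xs. t l)) * (t l * (\<Prod>l\<leftarrow>xs. t l)) = (t l * t l) * ((\<Prod>l\<leftarrow>xs. t l) * (\<Prod>l\<leftarrow>xs. t l))"
      by (simp only: mult_ac)
    then show ?case using Cons.IH by (simp add: tt)
  qed simp
  then have specht: "specht_poly n \<xi> tableau = of_int (\<Prod>l\<leftarrow>ls. t l) * bpoly n \<xi> r"
    unfolding b by (simp flip: mult.assoc of_int_mult)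
  have "ppoly n \<xi> r = of_nat (card row_symmetries) * bpoly n \<xi> r"
    unfolding ppoly_def by (simp add: r_def)
  moreover have "card row_symmetries > 0"
  proof -
    have "finite row_symmetries" by (intro finite_PiE) (auto intro: finite_permutations)
    moreover have "(\<lambda>j\<in>{2..n+1}. id) \<in> row_symmetries" by (auto intro: permutes_id)
    ultimately show ?thesis by (metis card_gt_0_iff empty_iff)
  qed
  ultimately have "bpoly n \<xi> r = cst (1 / of_nat (card row_symmetries)) * ppoly n \<xi> r"
    using cancel_card by simp
  then have "specht_poly n \<xi> tableau = cst (of_int (\<Prod>l\<leftarrow>ls. t l)) * (cst (1 / of_nat (card row_symmetries)) * ppoly n \<xi> r)"
    unfolding specht cst_of_int by simp
  then show ?thesis using M_mult[OF sym_polys_cst M_mult[OF sym_polys_cst ppoly_M]] by metis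
qed

lemma specht_poly_nonzero: "specht_poly n \<xi> tableau \<noteq> 0"
proof -
  have "var (tableau (a, j)) - var (tableau (b, j)) \<noteq> 0"
    if "a < b" "(a, j) \<in> young_diagram n \<xi>" "(b, j) \<in> young_diagram n \<xi>" for a b j
    using that inj_onD[OF bij_betw_imp_inj_on[OF tableau_bij], of "(a, j)" "(b, j)"] by auto
  moreover have "finite {(a, b). a < b \<and> (a, j) \<in> young_diagram n \<xi> \<and> (b, j) \<in> young_diagram n \<xi>}" for j
    by (rule finite_subset[of _ "{1..n+1} \<times> {1..n+1}"]) (auto simp: young_diagram_def)
  ultimately show ?thesis unfolding specht_poly_def by (auto simp: prod_zero_iff)
qed

lemma specht_polys_orbit:
  "{specht_poly n \<xi> T | T. bij_betw T (young_diagram n \<xi>) {..<k}} =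
    {poly_act \<tau> (specht_poly n \<xi> tableau) | \<tau>. \<tau> permutes {..<k}}"
proof (intro equalityI subsetI)
  fix f assume "f \<in> {specht_poly n \<xi> T | T. bij_betw T (young_diagram n \<xi>) {..<k}}"
  then obtain T where T: "f = specht_poly n \<xi> T" "bij_betw T (young_diagram n \<xi>) {..<k}" by auto
  let ?Y = "young_diagram n \<xi>"
  define \<tau> where "\<tau> p = (if p < k then T (inv_into ?Y tableau p) else p)" for p
  have "bij_betw (T \<circ> inv_into ?Y tableau) {..<k} {..<k}"
    by (rule bij_betw_trans[OF bij_betw_inv_into[OF tableau_bij] T(2)])
  then have "bij_betw \<tau> {..<k} {..<k}" by (rule bij_betw_cong[THEN iffD1, rotated]) (simp add: \<tau>_def)
  then have \<tau>: "\<tau> permutes {..<k}" by (rule bij_imp_permutes) (simp add: \<tau>_def)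
  have "T (i, j) = \<tau> (tableau (i, j))" if "(i, j) \<in> ?Y" for i j
    using that bij_betwE[OF tableau_bij] bij_betw_inv_into_left[OF tableau_bij] by (simp add: \<tau>_def)
  then have "f = rename_vars \<tau> (specht_poly n \<xi> tableau)" unfolding T(1) by (rule specht_poly_rename)
  then have "f = poly_act (inv \<tau>) (specht_poly n \<xi> tableau)" by (simp add: poly_act_def permutes_inv_inv[OF \<tau>])
  then show "f \<in> {poly_act \<tau> (specht_poly n \<xi> tableau) | \<tau>. \<tau> permutes {..<k}}" using permutes_inv[OF \<tau>] by auto
next
  fix f assume "f \<in> {poly_act \<tau> (specht_poly n \<xi> tableau) | \<tau>. \<tau> permutes {..<k}}"
  then obtain \<tau> where \<tau>: "\<tau> permutes {..<k}" "f = poly_act \<tau> (specht_poly n \<xi> tableau)" by auto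
  have "f = specht_poly n \<xi> (inv \<tau> \<circ> tableau)"
    unfolding \<tau>(2) poly_act_def by (rule specht_poly_rename[symmetric]) simp
  moreover have "bij_betw (inv \<tau> \<circ> tableau) (young_diagram n \<xi>) {..<k}"
    by (rule bij_betw_trans[OF tableau_bij permutes_imp_bij[OF permutes_inv[OF \<tau>(1)]]])
  ultimately show "f \<in> {specht_poly n \<xi> T | T. bij_betw T (young_diagram n \<xi>) {..<k}}" by blast
qed

end

section \<open>Invariant highest weight vectors as equivariant maps\<close>

interpretation ts: vector_space cscale by (rule vector_space_cscale)
interpretation ps: vector_space pscale by (rule vector_space_pscale)

lemma (in young_shape) W_add: "u \<in> W k n \<Longrightarrow> v \<in> W k n \<Longrightarrow> u + v \<in> W k n"
  by (simp add: W_def VA_add tens_act_add)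
lemma (in young_shape) W_tscale: "u \<in> W k n \<Longrightarrow> a \<in> sym_polys k \<Longrightarrow> tscale a u \<in> W k n"
  by (simp add: W_def VA_tscale tens_act_tscale sym_polys_def)

locale young_basis = young_shape +
  fixes d :: nat and \<sigma> :: "nat \<Rightarrow> nat \<Rightarrow> nat"
  assumes perms: "\<And>s. s \<in> {1..d} \<Longrightarrow> \<sigma> s permutes {..<k}"
    and cosets: "inj_on (\<lambda>s. (\<lambda>\<tau>. \<tau> \<circ> \<sigma> s) ` stabilizer k e) {1..d}"
    and independent: "\<not> ts.dependent ((\<lambda>s. et (\<sigma> s)) ` {1..d})"
    and spanning: "ts.span ((\<lambda>s. et (\<sigma> s)) ` {1..d}) = H"
begin

definition eigenvalue :: complex where
  "eigenvalue = (SOME c. c \<noteq> 0 \<and> frame e = tscale (cst c) e)"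

lemma eigenvalue: "eigenvalue \<noteq> 0" "frame e = tscale (cst eigenvalue) e"
  using someI_ex[OF frame_e] unfolding eigenvalue_def by auto

lemma H_induct [consumes 1, case_names zero add scale base]:
  assumes "h \<in> H" "P 0" "\<And>u v. P u \<Longrightarrow> P v \<Longrightarrow> P (u + v)" "\<And>a u. P u \<Longrightarrow> P (tscale (cst a) u)"
    "\<And>s. s \<in> {1..d} \<Longrightarrow> P (et (\<sigma> s))"
  shows "P h"
proof -
  have "h \<in> ts.span ((\<lambda>s. et (\<sigma> s)) ` {1..d})" using assms(1) spanning by simp
  then show ?thesis
    by (rule ts.span_induct) (use assms in \<open>auto intro!: ts.subspaceI simp: cscale_def\<close>)
qed

lemma frame_eigen_H: "h \<in> H \<Longrightarrow> frame h = tscale (cst eigenvalue) h"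
proof (induction h rule: H_induct)
  case zero
  show ?case by (simp add: frame_def)
next
  case (base s)
  then show ?case
    by (simp add: frame_act[OF perms e_tensors] eigenvalue tens_act_tscale)
qed (simp_all add: frame_add frame_tscale tscale_add mult.commute)

text \<open>
  The operator \<open>frame\<close> is linear over the polynomials, so it may be applied to the constant tensors
  of the coefficients of each monomial, which lie in \<open>H\<close>.
\<close>

lemma frame_eigen: "u \<in> VA k n \<Longrightarrow> is_hw n \<xi> u \<Longrightarrow> frame u = tscale (cst eigenvalue) u"
proof -
  assume u: "u \<in> VA k n" "is_hw n \<xi> u"
  obtain F where F: "u = (\<Sum>m\<in>F. tscale (single m 1) (mcoeff m u))" using mcoeff_expand by blast
  have "mcoeff m u \<in> H" for m using u by (simp add: highest_weight_eq mcoeff_Vpow is_hw_mcoeff)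
  then have *: "frame (mcoeff m u) = tscale (cst eigenvalue) (mcoeff m u)" for m by (rule frame_eigen_H)
  have "frame u = (\<Sum>m\<in>F. tscale (single m 1) (tscale (cst eigenvalue) (mcoeff m u)))"
    by (subst F) (simp only: frame_sum frame_tscale *)
  also have "\<dots> = tscale (cst eigenvalue) (\<Sum>m\<in>F. tscale (single m 1) (mcoeff m u))"
    by (simp add: tscale_sum mult.commute)
  finally show ?thesis using F by simp
qed

lemma WH_W: "w \<in> WH \<Longrightarrow> w \<in> W k n" by (simp add: highest_weight_eq)

lemma form_W_act:
  assumes "w \<in> W k n" "h \<in> tensors k" "\<tau> permutes {..<k}"
  shows "form w (tens_act \<tau> h) = poly_act \<tau> (form w h)"
  using form_tens_act[of \<tau> k w h] assms W_VA[of k n] by (auto simp: W_def intro: VA_tensors)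

text \<open>
  The sum over \<open>S_k\<close> of the translates of \<open>e \<otimes> \<phi>(e)\<close> is invariant, and by equivariance its pairing
  with h is \<open>\<phi>(frame h)\<close>, the multiple of \<open>\<phi>(h)\<close> by the eigenvalue.
\<close>

lemma equivariant_map_represented:
  assumes add: "\<And>h h'. h \<in> H \<Longrightarrow> h' \<in> H \<Longrightarrow> \<phi> (h + h') = \<phi> h + \<phi> h'"
    and scale: "\<And>a h. h \<in> H \<Longrightarrow> \<phi> (tscale (cst a) h) = cst a * \<phi> h"
    and act: "\<And>\<tau> h. h \<in> H \<Longrightarrow> \<tau> permutes {..<k} \<Longrightarrow> \<phi> (tens_act \<tau> h) = poly_act \<tau> (\<phi> h)"
    and poly: "\<phi> e \<in> polys k"
  shows "\<exists>w\<in>WH. \<forall>h\<in>H. form w h = \<phi> h"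
proof
  let ?u = "\<Sum>\<tau>\<in>S. tens_act \<tau> (tscale (\<phi> e) e)"
  define w where "w = tscale (cst (1 / eigenvalue)) ?u"
  have "?u \<in> W k n" using poly e_H by (intro sum_orbit_W VA_tscale H_VA)
  moreover have "is_hw n \<xi> ?u"
    using e_hw e_tensors by (intro is_hw_sum) (auto intro!: is_hw_tens_act is_hw_tscale tensors_tscale)
  ultimately show "w \<in> WH" by (simp add: w_def highest_weight_eq W_tscale is_hw_tscale)
  have \<phi>0: "\<phi> 0 = 0" using scale[OF e_H, of 0] by simp
  show "\<forall>h\<in>H. form w h = \<phi> h"
  proof
    fix h assume h: "h \<in> H"
    have sum: "\<phi> (\<Sum>i\<in>I. g i) = (\<Sum>i\<in>I. \<phi> (g i))" if "\<And>i. i \<in> I \<Longrightarrow> g i \<in> H" for g and I :: "(nat \<Rightarrow> nat) set"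
      using that by (induction I rule: infinite_finite_induct) (auto simp: \<phi>0 add H_sum)
    have term_eq: "form (tens_act \<tau> (tscale (\<phi> e) e)) h = \<phi> (tscale (form h (et \<tau>)) (et \<tau>)) \<and>
      tscale (form h (et \<tau>)) (et \<tau>) \<in> H" if \<tau>: "\<tau> permutes {..<k}" for \<tau>
    proof -
      obtain a where "form h (et \<tau>) = cst a" using H_form_const[OF h et_H[OF \<tau>]] by auto
      then show ?thesis
        using \<tau> e_H et_H[OF \<tau>]
        by (simp add: tens_act_tscale form_tscale_right form_commute[of _ h] scale act H_cscale mult.commute)
    qed
    have "form ?u h = (\<Sum>\<tau>\<in>S. \<phi> (tscale (form h (et \<tau>)) (et \<tau>)))"
      unfolding form_sum_left by (rule sum.cong) (simp_all add: term_eq)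
    also have "\<dots> = \<phi> (frame h)" unfolding frame_def by (rule sum[symmetric]) (simp add: term_eq)
    also have "\<dots> = cst eigenvalue * \<phi> h" by (simp add: frame_eigen_H h scale)
    finally show "form w h = \<phi> h"
      using eigenvalue(1) by (simp add: w_def form_tscale_left cst_1 flip: mult.assoc cst_mult)
  qed
qed

lemma H_polys: "w \<in> W k n \<Longrightarrow> h \<in> H \<Longrightarrow> form w h \<in> polys k"
  using H_VA[of h] W_VA[of k n] by (intro form_polys) (auto simp: VA_def)

text \<open>
  Pairing with an arbitrary invariant tensor is an equivariant map on \<open>H\<close>, so it is also pairing with a
  highest weight vector; this takes the place of an equivariant projection.
\<close>

lemma project_to_WH: "w \<in> W k n \<Longrightarrow> \<exists>w'\<in>WH. \<forall>h\<in>H. form w' h = form w h"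
  by (rule equivariant_map_represented)
    (auto simp: form_add_right form_tscale_right form_W_act H_tensors H_polys e_H)

text \<open>
  By equivariance the value at e gives the values at all \<open>e\<sigma>\<close>, and \<open>frame\<close> recovers w from them.
\<close>

lemma WH_zero:
  assumes "w \<in> WH" "form w e = 0"
  shows "w = 0"
proof -
  have "form w (et \<tau>) = 0" if "\<tau> permutes {..<k}" for \<tau>
    using assms that by (simp add: form_W_act WH_W e_tensors)
  then have "frame w = 0" by (simp add: frame_def)
  moreover have "frame w = tscale (cst eigenvalue) w"
    using assms W_VA[of k n] by (intro frame_eigen) (auto simp: highest_weight_eq)
  ultimately have "tscale (cst (1 / eigenvalue)) (tscale (cst eigenvalue) w) = 0" by simp
  then show ?thesis using eigenvalue(1) by (simp add: cst_1 flip: cst_mult)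
qed

lemma WH_add: "u \<in> WH \<Longrightarrow> v \<in> WH \<Longrightarrow> u + v \<in> WH"
  by (simp add: highest_weight_eq W_add is_hw_add)
lemma WH_tscale: "u \<in> WH \<Longrightarrow> a \<in> sym_polys k \<Longrightarrow> tscale a u \<in> WH"
  by (simp add: highest_weight_eq W_tscale is_hw_tscale)
lemma WH_0: "0 \<in> WH"
  by (simp add: highest_weight_eq W_def tens_act_def)
lemma WH_diff: "u \<in> WH \<Longrightarrow> v \<in> WH \<Longrightarrow> u - v \<in> WH"
  using WH_add[of u "tscale (cst (-1)) v"] WH_tscale[OF _ sym_polys_cst, of v "-1"]
  by (simp add: cst_uminus cst_1 tscale_uminus)

lemma form_diff_left: "form (u - v) h = form u h - form v h"
  using form_add_left[of "u - v" v h] by simp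

lemma M_eq_image: "M k n \<xi> = (\<lambda>w. form w e) ` WH"
proof
  show "(\<lambda>w. form w e) ` WH \<subseteq> M k n \<xi>" using form_W_e_M WH_W by auto
  show "M k n \<xi> \<subseteq> (\<lambda>w. form w e) ` WH"
    unfolding M_def
  proof (rule hull_minimal)
    show "submod (sym_polys k) (*) ((\<lambda>w. form w e) ` WH)"
      unfolding submod_def
    proof (intro conjI ballI)
      show "0 \<in> (\<lambda>w. form w e) ` WH" using WH_0 by (intro image_eqI[of _ _ 0]) auto
    next
      fix f g assume "f \<in> (\<lambda>w. form w e) ` WH" "g \<in> (\<lambda>w. form w e) ` WH"
      then obtain u v where "u \<in> WH" "v \<in> WH" "f = form u e" "g = form v e" by auto
      then show "f + g \<in> (\<lambda>w. form w e) ` WH"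
        by (intro image_eqI[of _ _ "u + v"]) (auto simp: form_add_left WH_add)
    next
      fix a f assume "a \<in> sym_polys k" "f \<in> (\<lambda>w. form w e) ` WH"
      then obtain u where "u \<in> WH" "f = form u e" by auto
      then show "a * f \<in> (\<lambda>w. form w e) ` WH" using \<open>a \<in> sym_polys k\<close>
        by (intro image_eqI[of _ _ "tscale a u"]) (auto simp: form_tscale_left WH_tscale)
    qed
    show "range (ppoly n \<xi>) \<subseteq> (\<lambda>w. form w e) ` WH"
    proof (rule image_subsetI)
      fix r
      obtain w where "w \<in> W k n" "form w e = poly_alt (row_sum r)" using poly_alt_row_sum_form by blast
      then obtain w' where w': "w' \<in> WH" "form w' e = poly_alt (row_sum r)" using project_to_WH e_H by metis
      have "ppoly n \<xi> r = form (tscale (cst (of_int orient)) w') e"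
        by (simp add: ppoly_eq form_tscale_left w' cst_of_int)
      moreover have "tscale (cst (of_int orient)) w' \<in> WH" using w' by (intro WH_tscale) auto
      ultimately show "ppoly n \<xi> r \<in> (\<lambda>w. form w e) ` WH" by blast
    qed
  qed
qed

lemma form_iso: "module_iso (sym_polys k) tscale (*) WH (M k n \<xi>) (\<lambda>w. form w e)"
  unfolding module_iso_def
proof (intro conjI ballI)
  show "submod (sym_polys k) tscale WH" by (simp add: submod_def WH_0 WH_add WH_tscale)
  show "bij_betw (\<lambda>w. form w e) WH (M k n \<xi>)"
    unfolding bij_betw_def M_eq_image
  proof (intro conjI inj_onI refl)
    fix u v assume "u \<in> WH" "v \<in> WH" "form u e = form v e"
    then show "u = v" using WH_zero[of "u - v"] by (simp add: WH_diff form_diff_left)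
  qed
qed (simp_all add: M_submod form_add_left form_tscale_left)

lemma act_M: "\<tau> permutes {..<k} \<Longrightarrow> poly_act \<tau> ` M k n \<xi> = (\<lambda>w. form w (et \<tau>)) ` WH"
  unfolding M_eq_image image_image by (rule image_cong) (simp_all add: form_W_act WH_W e_tensors)

text \<open>
  Moving a vector h to \<open>(h, e \<rho>) e\<close> by the group algebra isolates the coordinate of h along
  \<open>e \<rho>\<close>; on the side of the polynomials the same element of the group algebra acts.
\<close>

lemma isolate:
  assumes "w \<in> W k n" "h \<in> H" "\<rho> permutes {..<k}"
  shows "form h (et \<rho>) * form w e = poly_alt (poly_act (inv \<rho>) (form w h))"
proof -
  have \<rho>: "inv \<rho> permutes {..<k}" by (rule permutes_inv) (rule assms)
  let ?h = "tens_act (inv \<rho>) h"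
  have h: "?h \<in> H" using H_act \<rho> assms by blast
  obtain a where a: "form ?h e = cst a" using H_form_const[OF h e_H] by auto
  have "form h (et \<rho>) = form (tens_act \<rho> ?h) (et \<rho>)"
    using tens_act_inv(2)[OF assms(3) H_tensors[OF assms(2)]] by simp
  also have "\<dots> = form ?h e"
    using form_tens_act[OF assms(3) H_tensors[OF h] e_tensors] by (simp add: a)
  finally have "form h (et \<rho>) * form w e = form w (column_alt ls ?h)"
    by (simp add: column_alt_H[OF h] form_tscale_right)
  also have "\<dots> = (\<Sum>c\<in>C. of_int (sign c) * poly_act c (poly_act (inv \<rho>) (form w h)))"
    unfolding column_alt_def form_sum_right form_tscale_right
    by (rule sum.cong) (simp_all add: form_W_act assms C_permutes \<rho> H_tensors h)
  finally show ?thesis by (simp add: poly_alt_def)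
qed

text \<open>
  The translates \<open>e\<sigma>\<close> correspond to the cosets of the stabiliser. So the family is injective, and linear
  independence of the set of its members is linear independence of the family.
\<close>

lemma inj_et: "inj_on (\<lambda>s. et (\<sigma> s)) {1..d}"
proof (rule inj_onI)
  fix s t assume s: "s \<in> {1..d}" and t: "t \<in> {1..d}" and eq: "et (\<sigma> s) = et (\<sigma> t)"
  have coset: "(\<lambda>\<tau>. \<tau> \<circ> \<sigma> s) ` stabilizer k e = {\<pi>. \<pi> permutes {..<k} \<and> et \<pi> = et (\<sigma> s)}" if s: "s \<in> {1..d}" for s
  proof (intro equalityI subsetI)
    fix \<pi> assume "\<pi> \<in> (\<lambda>\<tau>. \<tau> \<circ> \<sigma> s) ` stabilizer k e"
    then obtain \<tau> where \<tau>: "\<pi> = \<tau> \<circ> \<sigma> s" "\<tau> permutes {..<k}" "et \<tau> = e" by (auto simp: stabilizer_def)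
    then show "\<pi> \<in> {\<pi>. \<pi> permutes {..<k} \<and> et \<pi> = et (\<sigma> s)}"
      using act_et[OF perms[OF s] \<tau>(2)] perms[OF s] by (auto intro: permutes_compose)
  next
    fix \<pi> assume "\<pi> \<in> {\<pi>. \<pi> permutes {..<k} \<and> et \<pi> = et (\<sigma> s)}"
    then have \<pi>: "\<pi> permutes {..<k}" "et \<pi> = et (\<sigma> s)" by auto
    have i: "inv (\<sigma> s) permutes {..<k}" by (rule permutes_inv[OF perms[OF s]])
    have "et (\<pi> \<circ> inv (\<sigma> s)) = tens_act (inv (\<sigma> s)) (et (\<sigma> s))"
      using act_et[OF i \<pi>(1)] \<pi>(2) by simp
    also have "\<dots> = e" by (rule tens_act_inv[OF perms[OF s] e_tensors])
    finally have "\<pi> \<circ> inv (\<sigma> s) \<in> stabilizer k e"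
      using permutes_compose[OF i \<pi>(1)] by (simp add: stabilizer_def)
    moreover have "\<pi> = (\<pi> \<circ> inv (\<sigma> s)) \<circ> \<sigma> s"
      using permutes_inv_o(2)[OF perms[OF s]] by (simp add: comp_assoc)
    ultimately show "\<pi> \<in> (\<lambda>\<tau>. \<tau> \<circ> \<sigma> s) ` stabilizer k e" by blast
  qed
  show "s = t" using inj_onD[OF cosets _ s t] eq by (simp add: coset[OF s] coset[OF t])
qed

lemma independent_family:
  assumes "(\<Sum>s\<in>{1..d}. tscale (cst (a s)) (et (\<sigma> s))) = 0" "s \<in> {1..d}"
  shows "a s = 0"
proof -
  let ?f = "\<lambda>s. et (\<sigma> s)" let ?g = "\<lambda>v. a (inv_into {1..d} ?f v)"
  have "(\<Sum>v\<in>?f ` {1..d}. cscale (?g v) v) = (\<Sum>s\<in>{1..d}. cscale (?g (?f s)) (?f s))"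
    by (rule sum.reindex[OF inj_et, unfolded comp_def])
  also have "\<dots> = 0"
    using assms(1) inv_into_f_f[OF inj_et] by (simp add: cscale_def)
  finally have "(\<Sum>v\<in>?f ` {1..d}. cscale (?g v) v) = 0" .
  then have "?g (?f s) = 0"
    using ts.independentD[OF independent _ subset_refl, of ?g "?f s"] assms(2) by simp
  then show ?thesis using inv_into_f_f[OF inj_et assms(2)] by simp
qed

text \<open>
  The vectors have constant coordinates, so a relation with polynomial coefficients holds for each monomial
  separately.
\<close>

lemma polynomial_independent:
  assumes "(\<Sum>s\<in>{1..d}. tscale (p s) (et (\<sigma> s))) = 0" "s \<in> {1..d}"
  shows "p s = 0"
proof (rule poly_mapping_eqI)
  fix m
  have "(\<Sum>s\<in>{1..d}. tscale (cst (lookup (p s) m)) (et (\<sigma> s))) = 0"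
  proof (rule poly_mapping_eqI)
    fix w
    have const: "\<exists>z. lookup (et (\<sigma> s)) w = cst z" if "s \<in> {1..d}" for s
      using et_H[OF perms[OF that]] by (auto simp: highest_weight_eq Vpow_def)
    then obtain z where z: "\<And>s. s \<in> {1..d} \<Longrightarrow> lookup (et (\<sigma> s)) w = cst (z s)" by metis
    have "0 = lookup (lookup (\<Sum>s\<in>{1..d}. tscale (p s) (et (\<sigma> s))) w) m"
      by (simp only: assms(1) lookup_zero)
    also have "\<dots> = (\<Sum>s\<in>{1..d}. z s * lookup (p s) m)"
      unfolding lookup_sum lookup_tscale by (rule sum.cong) (simp_all add: z mult.commute[of _ "cst _"] lookup_cst_mult)
    finally have "cst (\<Sum>s\<in>{1..d}. z s * lookup (p s) m) = 0" by simp
    then show "lookup (\<Sum>s\<in>{1..d}. tscale (cst (lookup (p s) m)) (et (\<sigma> s))) w = lookup 0 w"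
      unfolding lookup_sum lookup_tscale cst_sum by (simp add: z cst_mult mult.commute)
  qed
  then show "lookup (p s) m = lookup 0 m" using independent_family[OF _ assms(2), of "\<lambda>s. lookup (p s) m"] by simp
qed

lemma direct: "sum_is_direct {1..d} (\<lambda>s. poly_act (\<sigma> s) ` M k n \<xi>)"
  unfolding sum_is_direct_def
proof (intro allI impI)
  fix u assume u: "(\<forall>i\<in>{1..d}. u i \<in> poly_act (\<sigma> i) ` M k n \<xi>) \<and> sum u {1..d} = 0"
  then have "\<exists>w\<in>WH. u s = form w (et (\<sigma> s))" if "s \<in> {1..d}" for s
    using act_M[OF perms[OF that]] that by auto
  then obtain w where w: "\<And>s. s \<in> {1..d} \<Longrightarrow> w s \<in> WH" "\<And>s. s \<in> {1..d} \<Longrightarrow> u s = form (w s) (et (\<sigma> s))"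
    by metis
  define p where "p s = form (w s) e" for s
  have zero: "(\<Sum>s\<in>{1..d}. p s * form (et (\<sigma> s)) (et \<rho>)) = 0" if \<rho>: "\<rho> permutes {..<k}" for \<rho>
  proof -
    have "(\<Sum>s\<in>{1..d}. p s * form (et (\<sigma> s)) (et \<rho>)) = (\<Sum>s\<in>{1..d}. poly_alt (poly_act (inv \<rho>) (u s)))"
      by (rule sum.cong)
        (auto simp: p_def w mult.commute isolate[OF WH_W[OF w(1)] et_H[OF perms] \<rho>, symmetric])
    also have "\<dots> = poly_alt (poly_act (inv \<rho>) (sum u {1..d}))" by (simp add: poly_alt_sum poly_act_sum)
    finally show ?thesis using u by (simp add: poly_alt_def)
  qed
  have "frame (\<Sum>s\<in>{1..d}. tscale (p s) (et (\<sigma> s))) = 0"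
    unfolding frame_def form_sum_left form_tscale_left using zero by (intro sum.neutral) auto
  moreover have "frame (\<Sum>s\<in>{1..d}. tscale (p s) (et (\<sigma> s))) =
      tscale (cst eigenvalue) (\<Sum>s\<in>{1..d}. tscale (p s) (et (\<sigma> s)))"
    unfolding frame_sum frame_tscale tscale_sum
    by (rule sum.cong) (auto simp: frame_eigen_H et_H perms mult.commute)
  ultimately have "tscale (cst (1 / eigenvalue)) (tscale (cst eigenvalue) (\<Sum>s\<in>{1..d}. tscale (p s) (et (\<sigma> s)))) = 0"
    by simp
  then have "(\<Sum>s\<in>{1..d}. tscale (p s) (et (\<sigma> s))) = 0"
    using eigenvalue(1) unfolding tscale_tscale by (simp add: cst_1 flip: cst_mult)
  then have "p s = 0" if "s \<in> {1..d}" for s using polynomial_independent that by blast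
  then show "\<forall>i\<in>{1..d}. u i = 0"
    using w by (auto simp: p_def form_W_act WH_W e_tensors perms)
qed

section \<open>The isotypical component\<close>

abbreviation "values \<equiv> {form w v | w v. w \<in> WH \<and> v \<in> H}"

text \<open>
  By \<open>act_M\<close> the s-th summand consists of the values at the basis vector \<open>e\<sigma>_s\<close> of \<open>H\<close>.
\<close>

lemma sum_space_eq: "sum_space {1..d} (\<lambda>s. poly_act (\<sigma> s) ` M k n \<xi>) = ps.span values" (is "?B = _")
proof
  show "?B \<subseteq> ps.span values"
  proof
    fix f assume "f \<in> ?B"
    then obtain u where u: "f = (\<Sum>s\<in>{1..d}. u s)" "\<And>s. s \<in> {1..d} \<Longrightarrow> u s \<in> poly_act (\<sigma> s) ` M k n \<xi>"
      by (auto simp: sum_space_def)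
    have "u s \<in> values" if "s \<in> {1..d}" for s
      using u(2)[OF that] act_M[OF perms[OF that]] et_H[OF perms[OF that]] by auto
    then show "f \<in> ps.span values" unfolding u(1) by (intro ps.span_sum ps.span_base)
  qed
  have M0: "0 \<in> poly_act \<tau> ` M k n \<xi>" for \<tau>
    using M_submod by (intro image_eqI[of _ _ 0]) (auto simp: submod_def)
  have add: "f + g \<in> ?B" if fg: "f \<in> ?B" "g \<in> ?B" for f g
  proof -
    obtain u v where uv: "f = (\<Sum>s\<in>{1..d}. u s)" "\<And>s. s \<in> {1..d} \<Longrightarrow> u s \<in> poly_act (\<sigma> s) ` M k n \<xi>"
      "g = (\<Sum>s\<in>{1..d}. v s)" "\<And>s. s \<in> {1..d} \<Longrightarrow> v s \<in> poly_act (\<sigma> s) ` M k n \<xi>"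
      using fg by (auto simp: sum_space_def)
    have "u s + v s \<in> poly_act (\<sigma> s) ` M k n \<xi>" if s: "s \<in> {1..d}" for s
      using uv(2)[OF s] uv(4)[OF s] by (auto simp flip: poly_act_add intro: M_add)
    then show ?thesis unfolding sum_space_def uv(1,3) by (intro CollectI exI[of _ "\<lambda>s. u s + v s"]) (simp add: sum.distrib)
  qed
  have scale: "cst a * f \<in> ?B" if "f \<in> ?B" for a f
  proof -
    obtain u where u: "f = (\<Sum>s\<in>{1..d}. u s)" "\<And>s. s \<in> {1..d} \<Longrightarrow> u s \<in> poly_act (\<sigma> s) ` M k n \<xi>"
      using \<open>f \<in> ?B\<close> by (auto simp: sum_space_def)
    have "cst a * u s \<in> poly_act (\<sigma> s) ` M k n \<xi>" if s: "s \<in> {1..d}" for s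
    proof -
      obtain g where "u s = poly_act (\<sigma> s) g" "g \<in> M k n \<xi>" using u(2)[OF s] by auto
      then show ?thesis
        by (intro image_eqI[of _ _ "cst a * g"]) (auto simp: poly_act_mult intro: M_mult)
    qed
    then show ?thesis unfolding sum_space_def u(1) by (intro CollectI exI[of _ "\<lambda>s. cst a * u s"]) (simp add: sum_distrib_left)
  qed
  have zero: "0 \<in> ?B" unfolding sum_space_def using M0 by (intro CollectI exI[of _ "\<lambda>_. 0"]) simp
  show "ps.span values \<subseteq> ?B"
  proof (rule ps.span_minimal)
    show "ps.subspace ?B" by (rule ps.subspaceI) (use zero add scale in \<open>simp_all only: pscale_def\<close>)
    show "values \<subseteq> ?B"
    proof clarify
      fix w v assume w: "w \<in> WH" and "v \<in> H"
      from this(2) show "form w v \<in> ?B"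
      proof (induction v rule: H_induct)
        case (base s)
        have "form w (et (\<sigma> s)) \<in> poly_act (\<sigma> s) ` M k n \<xi>" using act_M[OF perms[OF base]] w by auto
        then show ?case unfolding sum_space_def using base M0
          by (intro CollectI exI[of _ "\<lambda>t. if t = s then form w (et (\<sigma> s)) else 0"]) (auto simp: sum.delta)
      qed (use zero add scale in \<open>simp_all only: form_0 form_add_right form_tscale_right\<close>)
    qed
  qed
qed

lemma span_values_induct [consumes 1, case_names zero add base]:
  assumes "f \<in> ps.span values" "P 0" "\<And>f g. P f \<Longrightarrow> P g \<Longrightarrow> P (f + g)"
    "\<And>w v. w \<in> WH \<Longrightarrow> v \<in> H \<Longrightarrow> P (form w v)"
  shows "P f"
  using assms(1)
proof (induction f rule: ps.span_induct_alt)
  case (step a f g)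
  then obtain w v where "w \<in> WH" "v \<in> H" "f = form w v" by auto
  then have "pscale a f = form (tscale (cst a) w) v" "tscale (cst a) w \<in> WH"
    by (simp_all add: pscale_def form_tscale_left WH_tscale)
  then show ?case using assms(3,4) step \<open>v \<in> H\<close> by metis
qed (rule assms)

lemma span_values_stable: "perm_stable k (ps.span values)"
  unfolding perm_stable_def
proof (intro allI impI image_subsetI)
  fix \<tau> f assume \<tau>: "\<tau> permutes {..<k}" and "f \<in> ps.span values"
  from this(2) show "poly_act \<tau> f \<in> ps.span values"
  proof (induction f rule: span_values_induct)
    case (base w v)
    then have "poly_act \<tau> (form w v) = form w (tens_act \<tau> v)" by (simp add: form_W_act WH_W H_tensors \<tau>)
    then show ?case using base H_act[OF \<tau>] by (intro ps.span_base) auto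
  qed (auto simp: poly_act_add intro: ps.span_add ps.span_zero)
qed

lemma span_values_submod: "submod (sym_polys k) (*) (ps.span values)"
  unfolding submod_def
proof (intro conjI ballI)
  fix a f assume a: "a \<in> sym_polys k" and "f \<in> ps.span values"
  from this(2) show "a * f \<in> ps.span values"
  proof (induction f rule: span_values_induct)
    case (base w v)
    then have "a * form w v = form (tscale a w) v" "tscale a w \<in> WH"
      by (simp_all add: form_tscale_left WH_tscale a)
    then show ?case using base by (intro ps.span_base) auto
  qed (auto simp: distrib_left intro: ps.span_add ps.span_zero)
qed (auto intro: ps.span_add ps.span_zero)

lemma isomorphic_refl: "perm_stable k U \<Longrightarrow> submod R (*) U \<Longrightarrow> isomorphic R k U U"
  unfolding isomorphic_def module_iso_def by (intro conjI exI[of _ "\<lambda>u. u"]) (auto simp: bij_betw_def)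

text \<open>
  The kernel is a subrepresentation of \<open>H\<close>. If h lies in it, then \<open>(h, e\<rho>) \<langle>w, e\<rangle> = 0\<close> for all
  \<open>\<rho>\<close> by \<open>isolate\<close>, and \<open>frame\<close> recovers \<open>h = 0\<close>.
\<close>

lemma form_inj_H:
  assumes "w \<in> W k n" "form w e \<noteq> 0"
  shows "inj_on (form w) H"
proof (rule inj_onI)
  fix h h' assume h: "h \<in> H" "h' \<in> H" "form w h = form w h'"
  let ?g = "h + tscale (cst (-1)) h'"
  have g: "?g \<in> H" "form w ?g = 0"
    using h by (simp_all only: H_add H_cscale form_add_right form_tscale_right) (simp add: cst_uminus cst_1)
  have "form ?g (et \<rho>) = 0" if "\<rho> permutes {..<k}" for \<rho>
    using isolate[OF assms(1) g(1) that] assms(2) by (simp add: g(2) poly_alt_def)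
  then have "frame ?g = 0" by (simp add: frame_def)
  then have "tscale (cst (1 / eigenvalue)) (tscale (cst eigenvalue) ?g) = 0" using frame_eigen_H[OF g(1)] by simp
  then have "?g = 0" using eigenvalue(1) unfolding tscale_tscale by (simp add: cst_1 flip: cst_mult)
  then show "h = h'" by (simp add: cst_uminus cst_1 tscale_uminus)
qed

lemma form_image_stable: "w \<in> W k n \<Longrightarrow> perm_stable k (form w ` H)"
  unfolding perm_stable_def by (auto simp: form_W_act H_tensors H_act simp flip: form_W_act)

lemma form_image_submod: "submod (range cst) (*) (form w ` H)"
  unfolding submod_def
proof (intro conjI ballI)
  show "0 \<in> form w ` H" using H_cscale[OF e_H, of 0] by (intro image_eqI[of _ _ 0]) auto
next
  fix f g assume "f \<in> form w ` H" "g \<in> form w ` H"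
  then show "f + g \<in> form w ` H" by (auto simp flip: form_add_right intro: H_add)
next
  fix a f assume "a \<in> range cst" "f \<in> form w ` H"
  then show "a * f \<in> form w ` H" by (auto simp flip: form_tscale_right intro: H_cscale)
qed

text \<open>Both maps from \<open>H\<close> are injective, so one goes back from the first image to \<open>H\<close>.\<close>

lemma form_images_isomorphic:
  assumes w: "w \<in> W k n" "form w e \<noteq> 0" and w': "w' \<in> W k n" "form w' e \<noteq> 0"
  shows "isomorphic (range cst) k (form w ` H) (form w' ` H)"
proof -
  define \<phi> where "\<phi> f = form w' (inv_into H (form w) f)" for f
  have \<phi>: "\<phi> (form w h) = form w' h" if "h \<in> H" for h
    using that inv_into_f_f[OF form_inj_H[OF w]] by (simp add: \<phi>_def)
  have bij: "bij_betw \<phi> (form w ` H) (form w' ` H)"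
  proof (rule bij_betw_imageI)
    show "inj_on \<phi> (form w ` H)"
      using inj_onD[OF form_inj_H[OF w']] by (auto simp: inj_on_def \<phi>)
    show "\<phi> ` form w ` H = form w' ` H" by (auto simp: \<phi> image_image)
  qed
  have add: "\<phi> (f + g) = \<phi> f + \<phi> g" if "f \<in> form w ` H" "g \<in> form w ` H" for f g
    using that by (auto simp: \<phi> H_add form_add_right simp flip: form_add_right)
  have scale: "\<phi> (a * f) = a * \<phi> f" if "a \<in> range cst" "f \<in> form w ` H" for a f
    using that by (auto simp: \<phi> H_cscale form_tscale_right simp flip: form_tscale_right)
  have act: "\<phi> (poly_act \<tau> f) = poly_act \<tau> (\<phi> f)" if f: "\<tau> permutes {..<k}" "f \<in> form w ` H" for \<tau> f
  proof -
    obtain h where h: "h \<in> H" "f = form w h" using f by auto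
    then have "poly_act \<tau> f = form w (tens_act \<tau> h)" by (simp add: form_W_act w H_tensors f)
    then show ?thesis using h f by (simp add: \<phi> H_act form_W_act w' H_tensors)
  qed
  show ?thesis
    unfolding isomorphic_def module_iso_def
    by (intro conjI exI[of _ \<phi>] allI impI ballI form_image_stable w w' form_image_submod bij add scale act)
qed

text \<open>
  The Specht polynomials are the translates of one of them, which lies in \<open>M\<close> and so is \<open>\<langle>w, e\<rangle>\<close>
  for some w; their span is the image of the span \<open>H\<close> of the translates of e.
\<close>

lemma specht_form: "\<exists>w\<in>WH. form w e \<noteq> 0 \<and> specht_module k n \<xi> = form w ` H"
proof -
  let ?f = "specht_poly n \<xi> tableau"
  obtain w where w: "w \<in> WH" "form w e = ?f" using specht_poly_M M_eq_image by auto
  have "specht_module k n \<xi> = ps.span {poly_act \<tau> ?f | \<tau>. \<tau> permutes {..<k}}"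
    by (simp add: specht_module_def specht_polys_orbit)
  also have "\<dots> = form w ` H"
  proof
    have orbit: "poly_act \<tau> ?f = form w (et \<tau>)" if "\<tau> permutes {..<k}" for \<tau>
      using that w by (simp add: form_W_act WH_W e_tensors)
    show "ps.span {poly_act \<tau> ?f | \<tau>. \<tau> permutes {..<k}} \<subseteq> form w ` H"
    proof (rule ps.span_minimal)
      show "ps.subspace (form w ` H)"
        using form_image_submod[of w] by (auto simp: submod_def pscale_def intro!: ps.subspaceI)
      show "{poly_act \<tau> ?f | \<tau>. \<tau> permutes {..<k}} \<subseteq> form w ` H" using orbit et_H by auto
    qed
    show "form w ` H \<subseteq> ps.span {poly_act \<tau> ?f | \<tau>. \<tau> permutes {..<k}}"
    proof (rule image_subsetI)
      fix h assume "h \<in> H"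
      then show "form w h \<in> ps.span {poly_act \<tau> ?f | \<tau>. \<tau> permutes {..<k}}"
      proof (induction h rule: H_induct)
        case (scale a u)
        have "form w (tscale (cst a) u) = pscale a (form w u)" by (simp add: form_tscale_right pscale_def)
        then show ?case using ps.span_scale[OF scale] by (simp only:)
      next
        case (base s)
        then show ?case
          using orbit[OF perms[OF base]] perms[OF base]
          by (intro ps.span_base CollectI exI[of _ "\<sigma> s"]) simp
      qed (auto simp: form_add_right intro: ps.span_add ps.span_zero)
    qed
  qed
  finally show ?thesis using w specht_poly_nonzero by (intro bexI[of _ w] conjI) simp_all
qed

text \<open>
  An isomorphism from the Specht module \<open>\<langle>ws, H\<rangle>\<close> onto U, composed with \<open>\<langle>ws, _\<rangle>\<close>, is an
  equivariant map on \<open>H\<close>, hence \<open>\<langle>w, _\<rangle>\<close> for some w, and \<open>U = \<langle>w, H\<rangle>\<close>. Conversely each nonzero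
  \<open>\<langle>w, H\<rangle>\<close> is isomorphic to the Specht module.
\<close>

lemma isotypical_eq: "isotypical k n \<xi> = ps.span values"
proof -
  obtain ws where ws: "ws \<in> WH" "form ws e \<noteq> 0" "specht_module k n \<xi> = form ws ` H" using specht_form by auto
  let ?U = "\<Union>{U. U \<subseteq> polys k \<and> isomorphic (range cst) k (specht_module k n \<xi>) U}"
  have "?U \<subseteq> values"
  proof clarify
    fix U f assume U: "U \<subseteq> polys k" "isomorphic (range cst) k (specht_module k n \<xi>) U" and f: "f \<in> U"
    then obtain \<psi> where iso: "module_iso (range cst) (*) (*) (form ws ` H) U \<psi>"
      and act: "\<And>\<tau> u. \<tau> permutes {..<k} \<Longrightarrow> u \<in> form ws ` H \<Longrightarrow> \<psi> (poly_act \<tau> u) = poly_act \<tau> (\<psi> u)"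
      unfolding isomorphic_def ws(3) by blast
    have bij: "\<psi> ` form ws ` H = U" using iso by (simp add: module_iso_def bij_betw_def)
    have "\<exists>w\<in>WH. \<forall>h\<in>H. form w h = \<psi> (form ws h)"
    proof (rule equivariant_map_represented)
      show "\<psi> (form ws e) \<in> polys k" using bij U(1) e_H by auto
      show "\<psi> (form ws (tens_act \<tau> h)) = poly_act \<tau> (\<psi> (form ws h))" if "h \<in> H" "\<tau> permutes {..<k}" for \<tau> h
        using that ws act by (simp add: form_W_act WH_W H_tensors)
    qed (use iso in \<open>auto simp: module_iso_def form_add_right form_tscale_right\<close>)
    then obtain w where w: "w \<in> WH" "\<And>h. h \<in> H \<Longrightarrow> form w h = \<psi> (form ws h)" by auto
    obtain h where "h \<in> H" "f = \<psi> (form ws h)" using f bij by auto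
    then show "\<exists>w v. f = form w v \<and> w \<in> WH \<and> v \<in> H" using w by metis
  qed
  moreover have "values \<subseteq> ps.span ?U"
  proof clarify
    fix w v assume w: "w \<in> WH" and v: "v \<in> H"
    show "form w v \<in> ps.span ?U"
    proof (cases "form w e = 0")
      case True
      then have "w = 0" using WH_zero w by simp
      then show ?thesis by (simp add: ps.span_zero)
    next
      case False
      have "isomorphic (range cst) k (specht_module k n \<xi>) (form w ` H)"
        unfolding ws(3) using ws w False by (intro form_images_isomorphic WH_W)
      moreover have "form w ` H \<subseteq> polys k" using H_polys WH_W w by auto
      ultimately have "form w ` H \<subseteq> ?U" by blast
      then show ?thesis using v by (intro ps.span_base) auto
    qed
  qed
  ultimately have "ps.span ?U \<subseteq> ps.span values" "ps.span values \<subseteq> ps.span ?U"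
    by (simp_all add: ps.span_mono ps.span_minimal)
  then show ?thesis unfolding isotypical_def by (rule subset_antisym)
qed

end

theorem theorem3:
  fixes k n :: nat and \<xi> :: "nat \<Rightarrow> nat" and \<sigma> :: "nat \<Rightarrow> nat \<Rightarrow> nat"
  assumes "k \<ge> 1" and "n \<ge> 1"
    and "\<And>i. i \<in> {1..n} \<Longrightarrow> \<xi> (i + 1) \<le> \<xi> i" and "\<xi> (n + 1) > 0"
    and "(\<Sum>i=1..n+1. \<xi> i) = k"
    and "\<And>s. s \<in> {1..specht_dim k n \<xi>} \<Longrightarrow> \<sigma> s permutes {..<k}"
    and "\<sigma> 1 = id"
    and "inj_on (\<lambda>s. (\<lambda>\<tau>. \<tau> \<circ> \<sigma> s) ` stabilizer k (evec n \<xi>)) {1..specht_dim k n \<xi>}"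
    and "\<not> module.dependent cscale ((\<lambda>s. tens_act (\<sigma> s) (evec n \<xi>)) ` {1..specht_dim k n \<xi>})"
    and "module.span cscale ((\<lambda>s. tens_act (\<sigma> s) (evec n \<xi>)) ` {1..specht_dim k n \<xi>})
           = highest_weight n \<xi> (Vpow k n)"
  shows "module_iso (sym_polys k) tscale (*)
           (highest_weight n \<xi> (W k n)) (M k n \<xi>) (\<lambda>w. form w (evec n \<xi>))
    \<and> (\<forall>\<tau>. \<tau> permutes {..<k} \<longrightarrow>
         poly_act \<tau> ` M k n \<xi>
           = (\<lambda>w. form w (tens_act \<tau> (evec n \<xi>))) ` highest_weight n \<xi> (W k n))
    \<and> sum_is_direct {1..specht_dim k n \<xi>} (\<lambda>s. poly_act (\<sigma> s) ` M k n \<xi>)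
    \<and> isomorphic (sym_polys k) k
         (module.span pscale
           {form w v | w v. w \<in> highest_weight n \<xi> (W k n) \<and> v \<in> highest_weight n \<xi> (Vpow k n)})
         (sum_space {1..specht_dim k n \<xi>} (\<lambda>s. poly_act (\<sigma> s) ` M k n \<xi>))
    \<and> isomorphic (sym_polys k) k
         (sum_space {1..specht_dim k n \<xi>} (\<lambda>s. poly_act (\<sigma> s) ` M k n \<xi>))
         (isotypical k n \<xi>)"
proof -
  interpret young_shape k n \<xi> by unfold_locales (use assms in auto)
  interpret young_basis k n \<xi> "specht_dim k n \<xi>" \<sigma>
    by (unfold_locales; (erule assms(6) | rule assms(8-10)[unfolded evec_eq]))
  show ?thesis
    unfolding evec_eq sum_space_eq isotypical_eq
    by (intro conjI allI impI form_iso act_M direct isomorphic_refl span_values_stable span_values_submod)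
qed

end
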